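(* Let $\Sigma\subset\mathbb{N}^*$ be a finite non-empty subset of cardinality $s$, and write $s=(m-1)(q-1)+l$ with $m\ge1$ and $1\le l\le q-1$. Let $n\ge0$ be an integer such that $\ell_q(n)\le l$, where $\ell_q(n)$ is the sum of the digits of the base-$q$ expansion of $n$. Then $$v(\psi(1+n;\sigma_\Sigma))=q^{1-m}-(l-\ell_q(n))q^{-m},$$ where $\psi(1+n;\sigma_\Sigma)(z)=\sum_{a\in A}(z-a)^{-(1+n)}\prod_{i\in\Sigma}a(t_i)$.
   Context: $q$ is a power of a prime $p$; $A=\mathbb{F}_q[\theta]$, $K_\infty=\mathbb{F}_q((1/\theta))$, $|\theta|=q$, $\mathbb{C}_\infty$ the completion of a separable closure of $K_\infty$. For $a\in A$, $a(t)$ is the image of $a$ under $\theta\mapsto t$. $\exp_C(X)=\sum_{i\ge0}X^{q^i}/d_i$ with $d_i=\prod_{j<i}(\theta^{q^i}-\theta^{q^j})$ is the Carlitz exponential, with kernel $\widetilde\pi A$; $u(z)=\exp_C(\widetilde\pi z)^{-1}$. For finite $\Sigma\subset\mathbb{N}^*$ (positive integers), $\underline t_\Sigma=(t_i)_{i\in\Sigma}$ are independent variables and $\mathbb{K}_\Sigma$ is the completion of $\mathbb{C}_\infty(\underline t_\Sigma)$ for the Gauss norm $\|\cdot\|$. For $i\in\mathbb{Z}$, $e_i(z)=\exp_C(\widetilde\pi z/\theta^i)$. For $j\in\mathbb{Z}[1/p]_{\ge0}$ with base-$q$ expansion $j=\sum_{k\in\mathbb{Z}}j_kq^{-k}$ ($0\le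 j_k\le q-1$), $\langle e\rangle^j=\prod_ke_k^{j_k}$, $\ell_q(j)=\sum_kj_k$. $\mathcal{T}(\mathbb{K}_\Sigma)$ is the ring of entire functions $\mathbb{C}_\infty\to\mathbb{K}_\Sigma$ of the form $f=\sum_jf_j\langle e\rangle^j$, $f_j\in\mathbb{K}_\Sigma$, with $\ell_q(j)$ bounded over $\{j:f_j\ne0\}$, $\{j:f_j\neq0\}$ bounded above and $\sup_j\|f_j\|<\infty$ (such an expansion is unique); $v(f)=-\max\{j:f_j\ne0\}$ is a valuation, extended to the fraction field and to its $v$-completion $\mathfrak{K}_\Sigma$. In particular $u=e_0^{-1}$ has $v(u)=1$. The series $\psi(n;\sigma_\Sigma)$ converges for $z\in\mathbb{C}_\infty\setminus A$, and it is a polynomial in $u$ with coefficients in $\mathcal{T}(\mathbb{K}_\Sigma)$; in this way it is an element of $\mathfrak{K}_\Sigma$ and its $v$-valuation is defined. *)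

theory Defs
  imports "HOL-Analysis.Analysis" "HOL-Computational_Algebra.Computational_Algebra"
    "HOL-Library.Poly_Mapping"
begin

section \<open>Complete ultrametric fields\<close>

text \<open>
  The absolute value is the distance to 0 (\<^const>\<open>norm\<close> can only be used in real normed
  vector spaces).
\<close>

class ultrametric_field = field + metric_space +
  assumes dist_eq_dist_diff: "dist x y = dist (x - y) 0"
    and dist_mult_0: "dist (x * y) 0 = dist x 0 * dist y 0"
    and dist_add_0: "dist (x + y) 0 \<le> max (dist x 0) (dist y 0)"

class complete_ultrametric_field = ultrametric_field + complete_space

definition absval :: "'a::ultrametric_field \<Rightarrow> real" where
  "absval x = dist x 0"

definition field_embedding :: "('a::field \<Rightarrow> 'b::field) \<Rightarrow> bool" where
  "field_embedding h \<longleftrightarrow>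
     h 1 = 1 \<and> (\<forall>x y. h (x + y) = h x + h y) \<and> (\<forall>x y. h (x * y) = h x * h y)"

section \<open>The base fields\<close>

text \<open>
  Throughout, \<open>'f\<close> is the finite field with \<open>q = CARD('f)\<close> elements, so that \<open>q\<close> is a power of the
  prime \<open>p = CHAR('f)\<close>, and \<open>A\<close> is \<open>'f poly\<close>.  The field of Laurent series in \<open>1/\<theta>\<close> is
  \<open>'f fls\<close>: the variable \<^const>\<open>fls_X\<close> is \<open>1/\<theta>\<close>, hence \<open>\<theta>\<close> is \<^const>\<open>fls_X_inv\<close>.

  The completed fields are described as models: \<open>\<iota>\<close> embeds \<open>'f fls\<close> into \<open>'c\<close>, the completion of a
  separable closure, and \<open>\<kappa>\<close> embeds \<open>'c\<close> into \<open>'k\<close>, the completion of the field of rational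
  functions in the variables \<open>t i\<close>, \<open>i \<in> S\<close>.  These properties determine \<open>'c\<close> and \<open>'k\<close> up to
  isometric isomorphism.
\<close>

definition separable_elements ::
    "('f::{finite,field} fls \<Rightarrow> 'c::complete_ultrametric_field) \<Rightarrow> 'c set" where
  "separable_elements \<iota> =
     {x. \<exists>P. irreducible P \<and> coprime P (pderiv P) \<and> poly (map_poly \<iota> P) x = 0}"

definition separably_closed :: "'c::field set \<Rightarrow> bool" where
  "separably_closed K \<longleftrightarrow>
     (\<forall>P. (\<forall>i. coeff P i \<in> K) \<and> degree P > 0 \<and> coprime P (pderiv P)
        \<longrightarrow> (\<exists>x\<in>K. poly P x = 0))"

definition completed_separable_closure ::
    "('f::{finite,field} fls \<Rightarrow> 'c::complete_ultrametric_field) \<Rightarrow> bool" where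
  "completed_separable_closure \<iota> \<longleftrightarrow>
     field_embedding \<iota> \<and>
     (\<forall>x. x \<noteq> 0 \<longrightarrow> absval (\<iota> x) = real CARD('f) powi (- fls_subdegree x)) \<and>
     separably_closed (separable_elements \<iota>) \<and>
     closure (separable_elements \<iota>) = UNIV"

text \<open>
  Polynomials over \<open>'c\<close> in the variables indexed by \<open>S\<close> are elements of \<open>(nat \<Rightarrow>\<^sub>0 nat) \<Rightarrow>\<^sub>0 'c\<close>
  supported on monomials in these variables.
\<close>

definition mpolys :: "nat set \<Rightarrow> ((nat \<Rightarrow>\<^sub>0 nat) \<Rightarrow>\<^sub>0 'c::zero) set" where
  "mpolys S = {P. \<forall>\<mu>\<in>Poly_Mapping.keys P. Poly_Mapping.keys \<mu> \<subseteq> S}"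

definition mpoly_eval ::
    "('c::field \<Rightarrow> 'k::field) \<Rightarrow> (nat \<Rightarrow> 'k) \<Rightarrow> ((nat \<Rightarrow>\<^sub>0 nat) \<Rightarrow>\<^sub>0 'c) \<Rightarrow> 'k" where
  "mpoly_eval \<kappa> t P =
     (\<Sum>\<mu>\<in>Poly_Mapping.keys P. \<kappa> (Poly_Mapping.lookup P \<mu>) *
        (\<Prod>i\<in>Poly_Mapping.keys \<mu>. t i ^ Poly_Mapping.lookup \<mu> i))"

definition gauss_norm :: "((nat \<Rightarrow>\<^sub>0 nat) \<Rightarrow>\<^sub>0 'c::ultrametric_field) \<Rightarrow> real" where
  "gauss_norm P =
     (if P = 0 then 0 else Max ((\<lambda>\<mu>. absval (Poly_Mapping.lookup P \<mu>)) ` Poly_Mapping.keys P))"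

text \<open>
  The condition on the norm implies that the \<open>t i\<close> with \<open>i \<in> S\<close> are algebraically independent
  over \<open>\<kappa> ` UNIV\<close>.
\<close>

definition gauss_completion ::
    "nat set \<Rightarrow> ('c::complete_ultrametric_field \<Rightarrow> 'k::complete_ultrametric_field) \<Rightarrow> (nat \<Rightarrow> 'k)
      \<Rightarrow> bool" where
  "gauss_completion S \<kappa> t \<longleftrightarrow>
     field_embedding \<kappa> \<and>
     (\<forall>P\<in>mpolys S. absval (mpoly_eval \<kappa> t P) = gauss_norm P) \<and>
     closure {mpoly_eval \<kappa> t P / mpoly_eval \<kappa> t Q | P Q.
        P \<in> mpolys S \<and> Q \<in> mpolys S \<and> Q \<noteq> 0} = UNIV"

section \<open>Carlitz exponential\<close>

definition theta :: "('f::{finite,field} fls \<Rightarrow> 'c::field) \<Rightarrow> 'c" where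
  "theta \<iota> = \<iota> fls_X_inv"

definition A_emb :: "('f::{finite,field} fls \<Rightarrow> 'c::field) \<Rightarrow> 'f poly \<Rightarrow> 'c" where
  "A_emb \<iota> a = poly (map_poly (\<lambda>x. \<iota> (fls_const x)) a) (theta \<iota>)"

definition carlitz_d :: "('f::{finite,field} fls \<Rightarrow> 'c::field) \<Rightarrow> nat \<Rightarrow> 'c" where
  "carlitz_d \<iota> i = (\<Prod>j<i. theta \<iota> ^ (CARD('f) ^ i) - theta \<iota> ^ (CARD('f) ^ j))"

definition carlitz_exp ::
    "('f::{finite,field} fls \<Rightarrow> 'c::complete_ultrametric_field) \<Rightarrow> 'c \<Rightarrow> 'c" where
  "carlitz_exp \<iota> X = suminf (\<lambda>i. X ^ (CARD('f) ^ i) / carlitz_d \<iota> i)"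

text \<open>\<open>\<pi>\<close> is only determined up to a factor in the multiplicative group of \<open>'f\<close>.\<close>

definition carlitz_period ::
    "('f::{finite,field} fls \<Rightarrow> 'c::complete_ultrametric_field) \<Rightarrow> 'c \<Rightarrow> bool" where
  "carlitz_period \<iota> \<pi> \<longleftrightarrow> {x. carlitz_exp \<iota> x = 0} = range (\<lambda>a. \<pi> * A_emb \<iota> a)"

definition e_fun ::
    "('f::{finite,field} fls \<Rightarrow> 'c::complete_ultrametric_field) \<Rightarrow> 'c \<Rightarrow> int \<Rightarrow> 'c \<Rightarrow> 'c" where
  "e_fun \<iota> \<pi> i z = carlitz_exp \<iota> (\<pi> * z / theta \<iota> powi i)"

definition u_fun ::
    "('f::{finite,field} fls \<Rightarrow> 'c::complete_ultrametric_field) \<Rightarrow> 'c \<Rightarrow> 'c \<Rightarrow> 'c" where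
  "u_fun \<iota> \<pi> z = inverse (carlitz_exp \<iota> (\<pi> * z))"

section \<open>Tame series\<close>

text \<open>
  \<open>digit q j k\<close> is the coefficient of \<open>q\<close> to the power \<open>-k\<close> in the base-\<open>q\<close> expansion of \<open>j\<close>;
  for natural numbers \<open>j\<close> the nonzero digits are the usual ones, at indices \<open>k \<le> 0\<close>.
\<close>

definition digit :: "nat \<Rightarrow> real \<Rightarrow> int \<Rightarrow> nat" where
  "digit q j k = nat (\<lfloor>j * real q powi k\<rfloor> mod int q)"

definition digit_sum :: "nat \<Rightarrow> real \<Rightarrow> nat" where
  "digit_sum q j = (\<Sum>k | digit q j k \<noteq> 0. digit q j k)"

definition tame_exponents :: "nat \<Rightarrow> real set" where
  "tame_exponents p = {real a / real p ^ b | a b :: nat. True}"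

definition e_monomial ::
    "('f::{finite,field} fls \<Rightarrow> 'c::complete_ultrametric_field) \<Rightarrow> 'c \<Rightarrow> real \<Rightarrow> 'c \<Rightarrow> 'c" where
  "e_monomial \<iota> \<pi> j z =
     (\<Prod>k | digit CARD('f) j k \<noteq> 0. e_fun \<iota> \<pi> k z ^ digit CARD('f) j k)"

definition tame_expansion ::
    "('f::{finite,field} fls \<Rightarrow> 'c::complete_ultrametric_field) \<Rightarrow> 'c
      \<Rightarrow> ('c \<Rightarrow> 'k::complete_ultrametric_field) \<Rightarrow> ('c \<Rightarrow> 'k) \<Rightarrow> (real \<Rightarrow> 'k) \<Rightarrow> bool" where
  "tame_expansion \<iota> \<pi> \<kappa> f F \<longleftrightarrow>
     (\<forall>j. F j \<noteq> 0 \<longrightarrow> j \<in> tame_exponents CHAR('f)) \<and>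
     (\<exists>L. \<forall>j. F j \<noteq> 0 \<longrightarrow> digit_sum CARD('f) j \<le> L) \<and>
     (\<exists>M. \<forall>j. F j \<noteq> 0 \<longrightarrow> j \<le> M) \<and>
     (\<exists>B. \<forall>j. absval (F j) \<le> B) \<and>
     (\<forall>z. ((\<lambda>j. F j * \<kappa> (e_monomial \<iota> \<pi> j z)) has_sum f z) (tame_exponents CHAR('f)))"

text \<open>
  The series of a tame expansion converges uniformly on bounded sets, so its sum is automatically
  entire.
\<close>

definition tame_functions ::
    "('f::{finite,field} fls \<Rightarrow> 'c::complete_ultrametric_field) \<Rightarrow> 'c
      \<Rightarrow> ('c \<Rightarrow> 'k::complete_ultrametric_field) \<Rightarrow> ('c \<Rightarrow> 'k) set" where
  "tame_functions \<iota> \<pi> \<kappa> = {f. \<exists>F. tame_expansion \<iota> \<pi> \<kappa> f F}"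

definition tame_coeffs ::
    "('f::{finite,field} fls \<Rightarrow> 'c::complete_ultrametric_field) \<Rightarrow> 'c
      \<Rightarrow> ('c \<Rightarrow> 'k::complete_ultrametric_field) \<Rightarrow> ('c \<Rightarrow> 'k) \<Rightarrow> real \<Rightarrow> 'k" where
  "tame_coeffs \<iota> \<pi> \<kappa> f = (THE F. tame_expansion \<iota> \<pi> \<kappa> f F)"

definition tame_val ::
    "('f::{finite,field} fls \<Rightarrow> 'c::complete_ultrametric_field) \<Rightarrow> 'c
      \<Rightarrow> ('c \<Rightarrow> 'k::complete_ultrametric_field) \<Rightarrow> ('c \<Rightarrow> 'k) \<Rightarrow> ereal" where
  "tame_val \<iota> \<pi> \<kappa> f =
     (if f = (\<lambda>_. 0) then \<infinity> else - ereal (GREATEST j. tame_coeffs \<iota> \<pi> \<kappa> f j \<noteq> 0))"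

section \<open>Fraction field of the ring of tame functions, and its completion\<close>

type_synonym ('c, 'k) frac = "(('c \<Rightarrow> 'k) \<times> ('c \<Rightarrow> 'k)) set"

definition tame_frac_pairs ::
    "('f::{finite,field} fls \<Rightarrow> 'c::complete_ultrametric_field) \<Rightarrow> 'c
      \<Rightarrow> ('c \<Rightarrow> 'k::complete_ultrametric_field) \<Rightarrow> (('c \<Rightarrow> 'k) \<times> ('c \<Rightarrow> 'k)) set" where
  "tame_frac_pairs \<iota> \<pi> \<kappa> = tame_functions \<iota> \<pi> \<kappa> \<times> (tame_functions \<iota> \<pi> \<kappa> - {\<lambda>_. 0})"

definition tame_frac_rel ::
    "('f::{finite,field} fls \<Rightarrow> 'c::complete_ultrametric_field) \<Rightarrow> 'c
      \<Rightarrow> ('c \<Rightarrow> 'k::complete_ultrametric_field)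
      \<Rightarrow> ((('c \<Rightarrow> 'k) \<times> ('c \<Rightarrow> 'k)) \<times> (('c \<Rightarrow> 'k) \<times> ('c \<Rightarrow> 'k))) set" where
  "tame_frac_rel \<iota> \<pi> \<kappa> =
     {((f, g), (f', g')). (f, g) \<in> tame_frac_pairs \<iota> \<pi> \<kappa> \<and> (f', g') \<in> tame_frac_pairs \<iota> \<pi> \<kappa> \<and>
        (\<forall>z. f z * g' z = f' z * g z)}"

definition tame_fracs ::
    "('f::{finite,field} fls \<Rightarrow> 'c::complete_ultrametric_field) \<Rightarrow> 'c
      \<Rightarrow> ('c \<Rightarrow> 'k::complete_ultrametric_field) \<Rightarrow> ('c, 'k) frac set" where
  "tame_fracs \<iota> \<pi> \<kappa> = tame_frac_pairs \<iota> \<pi> \<kappa> // tame_frac_rel \<iota> \<pi> \<kappa>"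

definition tame_frac ::
    "('f::{finite,field} fls \<Rightarrow> 'c::complete_ultrametric_field) \<Rightarrow> 'c
      \<Rightarrow> ('c \<Rightarrow> 'k::complete_ultrametric_field) \<Rightarrow> ('c \<Rightarrow> 'k) \<Rightarrow> ('c \<Rightarrow> 'k) \<Rightarrow> ('c, 'k) frac" where
  "tame_frac \<iota> \<pi> \<kappa> f g = tame_frac_rel \<iota> \<pi> \<kappa> `` {(f, g)}"

definition frac_diff ::
    "('f::{finite,field} fls \<Rightarrow> 'c::complete_ultrametric_field) \<Rightarrow> 'c
      \<Rightarrow> ('c \<Rightarrow> 'k::complete_ultrametric_field) \<Rightarrow> ('c, 'k) frac \<Rightarrow> ('c, 'k) frac \<Rightarrow> ('c, 'k) frac"
  where
  "frac_diff \<iota> \<pi> \<kappa> x y =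
     (\<Union>(f, g)\<in>x. \<Union>(f', g')\<in>y.
        tame_frac \<iota> \<pi> \<kappa> (\<lambda>z. f z * g' z - f' z * g z) (\<lambda>z. g z * g' z))"

definition frac_val ::
    "('f::{finite,field} fls \<Rightarrow> 'c::complete_ultrametric_field) \<Rightarrow> 'c
      \<Rightarrow> ('c \<Rightarrow> 'k::complete_ultrametric_field) \<Rightarrow> ('c, 'k) frac \<Rightarrow> ereal" where
  "frac_val \<iota> \<pi> \<kappa> x = the_elem ((\<lambda>(f, g). tame_val \<iota> \<pi> \<kappa> f - tame_val \<iota> \<pi> \<kappa> g) ` x)"

definition frac_cauchy ::
    "('f::{finite,field} fls \<Rightarrow> 'c::complete_ultrametric_field) \<Rightarrow> 'c
      \<Rightarrow> ('c \<Rightarrow> 'k::complete_ultrametric_field) \<Rightarrow> (nat \<Rightarrow> ('c, 'k) frac) set" where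
  "frac_cauchy \<iota> \<pi> \<kappa> =
     {X. range X \<subseteq> tame_fracs \<iota> \<pi> \<kappa> \<and>
        (\<forall>B::real. \<exists>N. \<forall>m\<ge>N. \<forall>n\<ge>N. ereal B \<le> frac_val \<iota> \<pi> \<kappa> (frac_diff \<iota> \<pi> \<kappa> (X m) (X n)))}"

definition completion_rel ::
    "('f::{finite,field} fls \<Rightarrow> 'c::complete_ultrametric_field) \<Rightarrow> 'c
      \<Rightarrow> ('c \<Rightarrow> 'k::complete_ultrametric_field)
      \<Rightarrow> ((nat \<Rightarrow> ('c, 'k) frac) \<times> (nat \<Rightarrow> ('c, 'k) frac)) set" where
  "completion_rel \<iota> \<pi> \<kappa> =
     {(X, Y). X \<in> frac_cauchy \<iota> \<pi> \<kappa> \<and> Y \<in> frac_cauchy \<iota> \<pi> \<kappa> \<and>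
        (\<lambda>n. frac_val \<iota> \<pi> \<kappa> (frac_diff \<iota> \<pi> \<kappa> (X n) (Y n))) \<longlonglongrightarrow> \<infinity>}"

definition tame_completion ::
    "('f::{finite,field} fls \<Rightarrow> 'c::complete_ultrametric_field) \<Rightarrow> 'c
      \<Rightarrow> ('c \<Rightarrow> 'k::complete_ultrametric_field) \<Rightarrow> (nat \<Rightarrow> ('c, 'k) frac) set set" where
  "tame_completion \<iota> \<pi> \<kappa> = frac_cauchy \<iota> \<pi> \<kappa> // completion_rel \<iota> \<pi> \<kappa>"

definition completion_of_frac ::
    "('f::{finite,field} fls \<Rightarrow> 'c::complete_ultrametric_field) \<Rightarrow> 'c
      \<Rightarrow> ('c \<Rightarrow> 'k::complete_ultrametric_field) \<Rightarrow> ('c, 'k) frac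
      \<Rightarrow> (nat \<Rightarrow> ('c, 'k) frac) set" where
  "completion_of_frac \<iota> \<pi> \<kappa> x = completion_rel \<iota> \<pi> \<kappa> `` {\<lambda>_. x}"

definition completion_val ::
    "('f::{finite,field} fls \<Rightarrow> 'c::complete_ultrametric_field) \<Rightarrow> 'c
      \<Rightarrow> ('c \<Rightarrow> 'k::complete_ultrametric_field) \<Rightarrow> (nat \<Rightarrow> ('c, 'k) frac) set \<Rightarrow> ereal" where
  "completion_val \<iota> \<pi> \<kappa> \<xi> = the_elem ((\<lambda>X. lim (\<lambda>n. frac_val \<iota> \<pi> \<kappa> (X n))) ` \<xi>)"

text \<open>
  A function \<open>h\<close> on the complement of \<open>A\<close> which is a polynomial \<open>g 0 + g 1 u + \<dots> + g N u\<^sup>N\<close> in \<open>u\<close>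
  with tame coefficients is identified with the element of the completion given by the same
  polynomial.  Since \<open>u\<close> is the inverse of \<open>e\<^sub>0\<close>, this element is the fraction with numerator
  \<open>g 0 e\<^sub>0\<^sup>N + g 1 e\<^sub>0\<^sup>N\<^sup>-\<^sup>1 + \<dots> + g N\<close> and denominator \<open>e\<^sub>0\<^sup>N\<close>.
\<close>

definition u_polynomial_represents ::
    "('f::{finite,field} fls \<Rightarrow> 'c::complete_ultrametric_field) \<Rightarrow> 'c
      \<Rightarrow> ('c \<Rightarrow> 'k::complete_ultrametric_field) \<Rightarrow> ('c \<Rightarrow> 'k)
      \<Rightarrow> (nat \<Rightarrow> ('c, 'k) frac) set \<Rightarrow> bool" where
  "u_polynomial_represents \<iota> \<pi> \<kappa> h \<xi> \<longleftrightarrow>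
     (\<exists>N g. (\<forall>i\<le>N. g i \<in> tame_functions \<iota> \<pi> \<kappa>) \<and>
        (\<forall>z. z \<notin> range (A_emb \<iota>) \<longrightarrow> h z = (\<Sum>i\<le>N. g i z * \<kappa> (u_fun \<iota> \<pi> z) ^ i)) \<and>
        \<xi> = completion_of_frac \<iota> \<pi> \<kappa>
              (tame_frac \<iota> \<pi> \<kappa>
                 (\<lambda>z. \<Sum>i\<le>N. g i z * \<kappa> (e_fun \<iota> \<pi> 0 z) ^ (N - i))
                 (\<lambda>z. \<kappa> (e_fun \<iota> \<pi> 0 z) ^ N)))"

section \<open>The series \<open>\<psi>(n; \<sigma>\<^sub>S)\<close>\<close>

definition A_at ::
    "('f::{finite,field} fls \<Rightarrow> 'c::field) \<Rightarrow> ('c \<Rightarrow> 'k::field) \<Rightarrow> 'k \<Rightarrow> 'f poly \<Rightarrow> 'k" where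
  "A_at \<iota> \<kappa> x a = poly (map_poly (\<lambda>c. \<kappa> (\<iota> (fls_const c))) a) x"

definition psi ::
    "('f::{finite,field} fls \<Rightarrow> 'c::complete_ultrametric_field)
      \<Rightarrow> ('c \<Rightarrow> 'k::complete_ultrametric_field) \<Rightarrow> (nat \<Rightarrow> 'k) \<Rightarrow> nat set \<Rightarrow> nat \<Rightarrow> 'c \<Rightarrow> 'k" where
  "psi \<iota> \<kappa> t S n z =
     (\<Sum>\<^sub>\<infinity>a\<in>UNIV. \<kappa> (inverse ((z - A_emb \<iota> a) ^ n)) * (\<Prod>i\<in>S. A_at \<iota> \<kappa> (t i) a))"

end

(* For the points z = theta^r eta with eta^(q+1) = theta one knows |e_k(z)| exactly, and |<e>^j(z)|
   has the size of Q_r^j with Q_r tending to infinity.  Hence v(f) is minus the growth exponent of f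
   along these points; this gives uniqueness of tame expansions and multiplicativity of v, and it
   reduces the theorem to finding the growth of psi.

   Put chi_i(z) = sum_{k>=1} e_k(z) t_i^(k-1).  Then chi_i(a) = a(t_i) chi_i(1) for a in A.  The
   product of the chi_i is a tame series; reducing it with e_k^q = e_{k-1} - theta e_k and dropping
   the monomials with some e_k, k <= 0, which vanish on A, gives a series g with exponents below 1
   and the same values on A.  Interpolation at the theta^d-division points of the Carlitz module,
   with d tending to infinity, yields u(z) g(z) = pi^(-1) sum_a g(a) / (z - a).  Replacing z by z + x
   and comparing coefficients of x^n expresses psi(1 + n) through u and the coefficients H_n of x^n in
   g(z + x), so that psi(1 + n) grows like u H_n.

   The coefficient of x^n in a product of r factors e_k(x) vanishes for r < l_q(n).  So the monomials
   of H_n have degree at most s - l_q(n), and the largest possible exponent is that of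
   e_1^(q-1) ... e_{m-1}^(q-1) e_m^(l - l_q(n)).  Its coefficient is not affected by the reduction and
   is a power series in the t_i, some coefficient of which is nonzero. *)
theory Submission
  imports Defs
begin

section \<open>Ultrametric fields\<close>

text \<open>Exponents below 1 are what interpolation demands: \<open>e_k\<close> is a polynomial of
  degree q^(d-k) in \<open>e_d\<close>, so a monomial of exponent j has degree j q^d, and
  interpolation at the q^d division points reproduces it when j < 1. Since the expansions are
  infinite, a largest exponent has to be shown to exist: with boundedly many digits the exponents
  may accumulate, but never from below, and this also leaves a uniform gap under the leading
  exponent. The bound l_q(n) <= l enters twice. It gives the extremal multiset of size s - l_q(n)
  its form, with all indices below m filled, and it allows the l_q(n) factors that produce x^n to be
  put at indices beyond m. There are at most q - 1 of these, so both groups together still form a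
  reduced multiset of size s, where the coefficients are those of the unreduced product. As the two
  groups of indices are separated, the splitting is unique, and no binomial coefficient, which might
  vanish modulo p, appears.\<close>

lemma absval_nonneg [simp]: "0 \<le> absval x"
  by (simp add: absval_def)

lemma absval_eq_0_iff [simp]: "absval x = 0 \<longleftrightarrow> x = 0"
  by (simp add: absval_def)

lemma absval_0 [simp]: "absval 0 = 0"
  by simp

lemma absval_pos_iff [simp]: "0 < absval x \<longleftrightarrow> x \<noteq> 0"
  by (simp add: absval_def)

lemma absval_le_0_iff [simp]: "absval x \<le> 0 \<longleftrightarrow> x = 0"
  by (simp add: absval_def)

lemma absval_mult: "absval (x * y) = absval x * absval y"
  by (simp add: absval_def dist_mult_0)

lemma absval_1 [simp]: "absval (1 :: 'a :: ultrametric_field) = 1"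
proof -
  have "absval (1 :: 'a) * absval (1 :: 'a) = absval (1 :: 'a) * 1"
    using absval_mult[of "1 :: 'a" 1] by simp
  thus ?thesis
    by (metis absval_eq_0_iff mult_left_cancel one_neq_zero)
qed

lemma absval_power: "absval (x ^ n) = absval x ^ n"
  by (induction n) (auto simp: absval_mult)

lemma absval_prod: "absval (prod f A) = (\<Prod>x\<in>A. absval (f x))"
  by (induction A rule: infinite_finite_induct) (auto simp: absval_mult)

lemma absval_inverse: "absval (inverse x) = inverse (absval x)"
proof (cases "x = 0")
  case False
  have "absval x * absval (inverse x) = 1"
    using False by (simp flip: absval_mult)
  thus ?thesis
    by (simp add: inverse_unique)
qed auto

lemma absval_divide: "absval (x / y) = absval x / absval y"
  by (simp add: divide_inverse absval_mult absval_inverse)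

lemma absval_power_int: "absval (x powi k) = absval x powi k"
  by (auto simp: power_int_def absval_power absval_inverse)

lemma absval_minus [simp]: "absval (- x) = absval (x :: 'a :: ultrametric_field)"
proof -
  have "absval (- 1 :: 'a) ^ 2 = 1"
    by (simp flip: absval_power)
  hence "absval (- 1 :: 'a) = 1"
    using absval_nonneg[of "- 1 :: 'a"] by (simp add: power2_eq_1_iff)
  thus ?thesis
    using absval_mult[of "-1" x] by simp
qed

lemma absval_minus_commute: "absval (x - y) = absval (y - x)"
  by (metis absval_minus minus_diff_eq)

lemma absval_add_le: "absval (x + y) \<le> max (absval x) (absval y)"
  by (simp add: absval_def dist_add_0)

lemma absval_diff_le: "absval (x - y) \<le> max (absval x) (absval y)"
  using absval_add_le[of x "- y"] by simp

lemma dist_conv_absval: "dist x y = absval (x - y)"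
  by (simp add: absval_def dist_eq_dist_diff[of x y])

lemma absval_add_eq_left:
  assumes "absval y < absval x"
  shows   "absval (x + y) = absval x"
proof (rule antisym)
  show "absval (x + y) \<le> absval x"
    using absval_add_le[of x y] assms by simp
  show "absval x \<le> absval (x + y)"
    using absval_diff_le[of "x + y" y] assms by auto
qed

lemma absval_add_eq_right: "absval x < absval y \<Longrightarrow> absval (x + y) = absval y"
  using absval_add_eq_left[of x y] by (simp add: add.commute)

lemma absval_diff_eq_left: "absval y < absval x \<Longrightarrow> absval (x - y) = absval x"
  using absval_add_eq_left[of "- y" x] by simp

lemma absval_diff_eq_right: "absval x < absval y \<Longrightarrow> absval (x - y) = absval y"
  using absval_diff_eq_left[of x y] by (simp add: absval_minus_commute)

lemma absval_eq_of_diff_less: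
  assumes "absval (x - y) < absval x"
  shows   "absval y = absval x"
  using absval_diff_eq_left[OF assms] by simp

lemma absval_sum_le:
  assumes "\<And>x. x \<in> A \<Longrightarrow> absval (f x) \<le> B" "0 \<le> B"
  shows   "absval (sum f A) \<le> B"
  using assms
proof (induction A rule: infinite_finite_induct)
  case (insert x A)
  thus ?case
    using absval_add_le[of "f x" "sum f A"] by (force simp: max_def split: if_splits)
qed auto

lemma absval_sum_less:
  assumes "\<And>x. x \<in> A \<Longrightarrow> absval (f x) < B" "0 < B"
  shows   "absval (sum f A) < B"
  using assms
proof (induction A rule: infinite_finite_induct)
  case (insert x A)
  thus ?case
    using absval_add_le[of "f x" "sum f A"] by (force simp: max_def split: if_splits)
qed auto

lemma tendsto_ultrametric_iff:
  fixes l :: "'a :: ultrametric_field"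
  shows "(f \<longlongrightarrow> l) F \<longleftrightarrow> (\<forall>e>0. eventually (\<lambda>x. absval (f x - l) < e) F)"
  by (simp add: tendsto_iff dist_conv_absval)

text \<open>Opens the general rules for limits and \<open>has_sum\<close>, which are stated for
  topological groups rather than normed spaces.\<close>

instance ultrametric_field \<subseteq> topological_ab_group_add
proof
  fix a b :: 'a
  show "((\<lambda>x. fst x + snd x) \<longlongrightarrow> a + b) (nhds a \<times>\<^sub>F nhds b)"
    unfolding tendsto_ultrametric_iff
  proof safe
    fix e :: real assume e: "0 < e"
    have "eventually (\<lambda>x. absval (x - a) < e) (nhds a)" "eventually (\<lambda>x. absval (x - b) < e) (nhds b)"
      using e by (auto simp: eventually_nhds_metric dist_conv_absval)
    hence "eventually (\<lambda>x. absval (fst x - a) < e \<and> absval (snd x - b) < e) (nhds a \<times>\<^sub>F nhds b)"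
      by (auto simp: eventually_prod_filter)
    thus "\<forall>\<^sub>F x in nhds a \<times>\<^sub>F nhds b. absval (fst x + snd x - (a + b)) < e"
    proof eventually_elim
      case (elim x)
      have eq: "fst x + snd x - (a + b) = (fst x - a) + (snd x - b)"
        by (simp add: algebra_simps)
      show ?case
        unfolding eq using absval_add_le[of "fst x - a" "snd x - b"] elim by auto
    qed
  qed
next
  fix a :: 'a
  show "(uminus \<longlongrightarrow> - a) (nhds a)"
    unfolding tendsto_ultrametric_iff
    by (auto simp: eventually_nhds_metric dist_conv_absval absval_minus_commute)
qed

instance ultrametric_field \<subseteq> topological_comm_monoid_mult
proof
  fix a b :: 'a
  show "((\<lambda>x. fst x * snd x) \<longlongrightarrow> a * b) (nhds a \<times>\<^sub>F nhds b)"
    unfolding tendsto_ultrametric_iff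
  proof safe
    fix e :: real assume e: "0 < e"
    define M where "M = max 1 (max (absval a) (absval b))"
    have M: "M \<ge> 1" "absval a \<le> M" "absval b \<le> M"
      by (auto simp: M_def)
    define d where "d = min 1 (e / M)"
    have d: "d > 0" "d \<le> 1" "d * M \<le> e"
      using e M by (auto simp: d_def min_def field_simps)
    have "eventually (\<lambda>x. absval (x - a) < d) (nhds a)" "eventually (\<lambda>x. absval (x - b) < d) (nhds b)"
      using d by (auto simp: eventually_nhds_metric dist_conv_absval)
    hence "eventually (\<lambda>x. absval (fst x - a) < d \<and> absval (snd x - b) < d) (nhds a \<times>\<^sub>F nhds b)"
      by (auto simp: eventually_prod_filter)
    thus "\<forall>\<^sub>F x in nhds a \<times>\<^sub>F nhds b. absval (fst x * snd x - a * b) < e"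
    proof eventually_elim
      case (elim x)
      have eq: "fst x * snd x - a * b = (fst x - a) * snd x + a * (snd x - b)"
        by (simp add: algebra_simps)
      have "absval (snd x) \<le> M"
        using absval_add_le[of "snd x - b" b] elim M d by auto
      hence "absval (fst x - a) * absval (snd x) \<le> absval (fst x - a) * M"
        by (intro mult_left_mono) auto
      also have "\<dots> < d * M"
        using elim M by (intro mult_strict_right_mono) auto
      finally have 1: "absval ((fst x - a) * snd x) < e"
        using d by (simp add: absval_mult)
      have "absval a * absval (snd x - b) \<le> M * absval (snd x - b)"
        using M by (intro mult_right_mono) auto
      also have "\<dots> < M * d"
        using elim M by (intro mult_strict_left_mono) auto
      finally have 2: "absval (a * (snd x - b)) < e"
        using d by (simp add: absval_mult mult.commute)
      show ?case
        unfolding eq using 1 2 absval_add_le[of "(fst x - a) * snd x" "a * (snd x - b)"] by auto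
    qed
  qed
qed

lemma tendsto_inverse_ultrametric:
  fixes l :: "'a :: ultrametric_field"
  assumes "(f \<longlongrightarrow> l) F" "l \<noteq> 0"
  shows   "((\<lambda>x. inverse (f x)) \<longlongrightarrow> inverse l) F"
  unfolding tendsto_ultrametric_iff
proof safe
  fix e :: real assume e: "0 < e"
  \<comment> \<open>The first bound forces \<open>f x\<close> and \<open>l\<close> to have equal
    size; the second then absorbs the denominator, of size |l|^2.\<close>
  define d where "d = min (absval l) (e * absval l ^ 2)"
  have d: "d > 0" "d \<le> absval l" "d \<le> e * absval l ^ 2"
    using e assms(2) by (auto simp: d_def)
  have "eventually (\<lambda>x. absval (f x - l) < d) F"
    using assms d by (auto simp: tendsto_ultrametric_iff)
  thus "\<forall>\<^sub>F x in F. absval (inverse (f x) - inverse l) < e"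
  proof eventually_elim
    case (elim x)
    have fx: "absval (f x) = absval l"
      using absval_eq_of_diff_less[of l "f x"] elim d by (simp add: absval_minus_commute)
    hence nz: "f x \<noteq> 0"
      using assms(2) by (metis absval_eq_0_iff)
    have "inverse (f x) - inverse l = (l - f x) / (f x * l)"
      using nz assms(2) by (simp add: field_simps)
    hence "absval (inverse (f x) - inverse l) = absval (f x - l) / absval l ^ 2"
      by (simp add: absval_divide absval_mult fx absval_minus_commute power2_eq_square)
    also have "\<dots> < e"
      using elim d assms(2) by (simp add: field_simps)
    finally show ?case .
  qed
qed

lemma tendsto_absval:
  fixes l :: "'a :: ultrametric_field"
  shows "(f \<longlongrightarrow> l) F \<Longrightarrow> ((\<lambda>x. absval (f x)) \<longlongrightarrow> absval l) F"
  unfolding absval_def by (intro tendsto_intros)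

lemma tendsto_absval_0I:
  fixes f :: "_ \<Rightarrow> 'a :: ultrametric_field"
  assumes "((\<lambda>x. absval (f x)) \<longlongrightarrow> 0) F"
  shows   "(f \<longlongrightarrow> 0) F"
  using assms by (simp add: tendsto_ultrametric_iff tendsto_iff)

lemma absval_tendsto_le:
  fixes l :: "'a :: ultrametric_field"
  assumes "(f \<longlongrightarrow> l) F" "F \<noteq> bot" "eventually (\<lambda>x. absval (f x) \<le> B) F"
  shows   "absval l \<le> B"
  using tendsto_upperbound[OF tendsto_absval[OF assms(1)] assms(3,2)] .

subsection \<open>Infinite sums\<close>

lemma has_sum_absval_le:
  fixes S :: "'a :: ultrametric_field"
  assumes "(f has_sum S) A" "\<And>x. x \<in> A \<Longrightarrow> absval (f x) \<le> B" "0 \<le> B"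
  shows   "absval S \<le> B"
proof (rule absval_tendsto_le)
  show "(sum f \<longlongrightarrow> S) (finite_subsets_at_top A)"
    using assms(1) by (simp add: has_sum_def)
  show "\<forall>\<^sub>F X in finite_subsets_at_top A. absval (sum f X) \<le> B"
    by (rule eventually_finite_subsets_at_top_weakI) (use assms in \<open>auto intro!: absval_sum_le\<close>)
qed auto

text \<open>In an ultrametric field a finite sum is no larger than its largest term, so terms that
  tend to zero along the index set already make the partial sums Cauchy.\<close>

lemma summable_on_ultrametricI:
  fixes f :: "'i \<Rightarrow> 'a :: complete_ultrametric_field"
  assumes "\<And>e. e > 0 \<Longrightarrow> finite {x\<in>A. e \<le> absval (f x)}"
  shows   "f summable_on A"
proof -
  have "cauchy_filter (filtermap (sum f) (finite_subsets_at_top A))"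
    unfolding cauchy_filter_metric_filtermap
  proof safe
    fix e :: real assume e: "e > 0"
    define X where "X = {x\<in>A. e \<le> absval (f x)}"
    have X: "finite X" "X \<subseteq> A"
      using assms e by (auto simp: X_def)
    have *: "absval (sum f Y - sum f X) < e" if "finite Y" "X \<subseteq> Y" "Y \<subseteq> A" for Y
    proof -
      have "sum f Y - sum f X = sum f (Y - X)"
        using that by (simp add: sum_diff)
      also have "absval \<dots> < e"
        using that e by (intro absval_sum_less) (auto simp: X_def)
      finally show ?thesis .
    qed
    show "\<exists>P. eventually P (finite_subsets_at_top A) \<and> (\<forall>x y. P x \<and> P y \<longrightarrow> dist (sum f x) (sum f y) < e)"
    proof (intro exI[of _ "\<lambda>Y. finite Y \<and> X \<subseteq> Y \<and> Y \<subseteq> A"] conjI allI impI)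
      show "\<forall>\<^sub>F Y in finite_subsets_at_top A. finite Y \<and> X \<subseteq> Y \<and> Y \<subseteq> A"
        using X by (auto simp: eventually_finite_subsets_at_top)
    next
      fix Y Z assume YZ: "(finite Y \<and> X \<subseteq> Y \<and> Y \<subseteq> A) \<and> (finite Z \<and> X \<subseteq> Z \<and> Z \<subseteq> A)"
      have "sum f Y - sum f Z = (sum f Y - sum f X) - (sum f Z - sum f X)"
        by simp
      thus "dist (sum f Y) (sum f Z) < e"
        using *[of Y] *[of Z] YZ absval_diff_le[of "sum f Y - sum f X" "sum f Z - sum f X"]
        by (auto simp: dist_conv_absval)
    qed
  qed
  moreover have "complete (UNIV :: 'a set)"
    by (meson Cauchy_convergent UNIV_I complete_def convergent_def)
  ultimately obtain L' where "(sum f \<longlongrightarrow> L') (finite_subsets_at_top A)"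
    using complete_uniform[where S = "UNIV :: 'a set"] by (force simp add: filterlim_def)
  thus ?thesis
    using summable_on_def has_sum_def by blast
qed

text \<open>The finiteness condition concerns pairs, so it gives summability over the product, and
  both iterated sums are then evaluations of one sum.\<close>

lemma has_sum_ultrametric_swap:
  fixes f :: "'i \<Rightarrow> 'j \<Rightarrow> 'a :: complete_ultrametric_field"
  assumes fin: "\<And>e. e > 0 \<Longrightarrow> finite {(x, y). x \<in> A \<and> y \<in> B \<and> e \<le> absval (f x y)}"
  assumes 1: "\<And>x. x \<in> A \<Longrightarrow> (f x has_sum g x) B"
  assumes 2: "\<And>y. y \<in> B \<Longrightarrow> ((\<lambda>x. f x y) has_sum h y) A"
  assumes 3: "(g has_sum S) A"
  shows   "(h has_sum S) B"
proof -
  have "(\<lambda>(x, y). f x y) summable_on A \<times> B"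
    by (rule summable_on_ultrametricI, rule finite_subset[OF _ fin]) auto
  hence "((\<lambda>(x, y). f x y) has_sum S) (A \<times> B)"
    using has_sum_SigmaI[where A = A and f = "\<lambda>(x, y). f x y" and g = g and B = "\<lambda>_. B" and S = S] 1 3 by auto
  hence "((\<lambda>(x, y). f y x) has_sum S) (B \<times> A)"
    by (subst (asm) has_sum_swap) auto
  thus ?thesis
    by (rule has_sum_SigmaD) (use 2 in auto)
qed

text \<open>Dominated convergence with a majorant that tends to zero in place of an integrable one:
  finitely many indices are handled by pointwise convergence, the rest by \<open>g\<close>.\<close>

lemma has_sum_tendsto_dominated:
  fixes f :: "nat \<Rightarrow> 'i \<Rightarrow> 'a :: complete_ultrametric_field"
  assumes fin: "\<And>e. e > 0 \<Longrightarrow> finite {x\<in>A. e \<le> g x}"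
  assumes bound: "eventually (\<lambda>d. \<forall>x\<in>A. absval (f d x) \<le> g x) sequentially"
  assumes lim: "\<And>x. x \<in> A \<Longrightarrow> (\<lambda>d. f d x) \<longlonglongrightarrow> f' x"
  assumes sums: "\<And>d. (f d has_sum S d) A" and sum': "(f' has_sum S') A"
  shows   "S \<longlonglongrightarrow> S'"
  unfolding tendsto_ultrametric_iff
proof safe
  fix e :: real assume e: "0 < e"
  define X where "X = {x\<in>A. e / 2 \<le> g x}"
  have X: "finite X" "X \<subseteq> A"
    using fin[of "e / 2"] e by (auto simp: X_def)
  have le': "absval (f' x) \<le> g x" if "x \<in> A" for x
    by (rule absval_tendsto_le[OF lim[OF that]]) (use bound that in \<open>auto elim!: eventually_mono\<close>)
  have "eventually (\<lambda>d. absval (f d x - f' x) < e / 2) sequentially" if "x \<in> X" for x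
    using lim[of x, unfolded tendsto_ultrametric_iff] that X(2) half_gt_zero[OF e] by blast
  hence "eventually (\<lambda>d. \<forall>x\<in>X. absval (f d x - f' x) < e / 2) sequentially"
    using X by (simp add: eventually_ball_finite)
  with bound show "\<forall>\<^sub>F d in sequentially. absval (S d - S') < e"
  proof eventually_elim
    case (elim d)
    have "absval (S d - S') \<le> e / 2"
    proof (rule has_sum_absval_le)
      show "((\<lambda>x. f d x + - f' x) has_sum (S d - S')) A"
        using has_sum_add[OF sums[of d] has_sum_uminusI[OF sum']] by simp
    next
      fix x assume x: "x \<in> A"
      show "absval (f d x + - f' x) \<le> e / 2"
      proof (cases "x \<in> X")
        case True
        thus ?thesis using elim by (auto intro: less_imp_le)
      next
        case False
        hence "g x < e / 2"
          using x by (auto simp: X_def)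
        thus ?thesis
          using absval_diff_le[of "f d x" "f' x"] elim(1) le'[OF x] x by force
      qed
    qed (use e in auto)
    thus ?case using e by simp
  qed
qed

text \<open>The finiteness statement is part of the induction because it supplies the summability of
  the joint family in the next step. As all factors are bounded, a large product forces both the new
  factor and the old product to be bounded below.\<close>

lemma has_sum_prod_PiE:
  fixes f :: "'i \<Rightarrow> 'j \<Rightarrow> 'a :: complete_ultrametric_field"
  assumes "finite A" "\<And>x. x \<in> A \<Longrightarrow> (f x has_sum s x) B"
    and "\<And>x e. x \<in> A \<Longrightarrow> e > 0 \<Longrightarrow> finite {y\<in>B. e \<le> absval (f x y)}"
    and "\<And>x y. x \<in> A \<Longrightarrow> y \<in> B \<Longrightarrow> absval (f x y) \<le> C x" "\<And>x. x \<in> A \<Longrightarrow> C x \<ge> 1"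
  shows "((\<lambda>k. \<Prod>x\<in>A. f x (k x)) has_sum (\<Prod>x\<in>A. s x)) (PiE A (\<lambda>_. B))
    \<and> (\<forall>e>0. finite {k\<in>PiE A (\<lambda>_. B). e \<le> absval (\<Prod>x\<in>A. f x (k x))})"
  using assms
proof (induction A)
  case empty
  have "{k \<in> PiE {} (\<lambda>_. B). e \<le> absval (\<Prod>x\<in>{}. f x (k x))} \<subseteq> {\<lambda>_. undefined}" for e
    by auto
  thus ?case
    using finite_subset[of _ "{\<lambda>_. undefined}"] has_sum_finite[of "{\<lambda>_. undefined}" "\<lambda>k. \<Prod>x\<in>{}. f x (k x)"]
    by auto
next
  case (insert a A)
  let ?P = "PiE A (\<lambda>_. B)" and ?g = "\<lambda>k. \<Prod>x\<in>A. f x (k x)"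
  have IH: "(?g has_sum (\<Prod>x\<in>A. s x)) ?P" "\<And>e. e > 0 \<Longrightarrow> finite {k\<in>?P. e \<le> absval (?g k)}"
    using insert.IH insert.prems by auto
  have bd: "absval (?g k) \<le> (\<Prod>x\<in>A. C x)" if "k \<in> ?P" for k
    unfolding absval_prod using insert.prems PiE_mem[OF that] by (intro prod_mono) auto
  have C1: "(\<Prod>x\<in>A. C x) \<ge> 1"
    using insert.prems by (intro prod_ge_1) auto
  have fin: "finite {(y, k). y \<in> B \<and> k \<in> ?P \<and> e \<le> absval (f a y * ?g k)}" if e: "e > 0" for e
  proof (rule finite_subset)
    have "e / (\<Prod>x\<in>A. C x) \<le> absval (f a y)" "e / C a \<le> absval (?g k)"
      if "y \<in> B" "k \<in> ?P" "e \<le> absval (f a y * ?g k)" for y k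
    proof -
      have "e \<le> absval (f a y) * absval (?g k)"
        using that by (simp add: absval_mult)
      also have "\<dots> \<le> absval (f a y) * (\<Prod>x\<in>A. C x)"
        using bd[OF that(2)] by (intro mult_left_mono) auto
      finally show "e / (\<Prod>x\<in>A. C x) \<le> absval (f a y)"
        using C1 by (simp add: field_simps)
      have "e \<le> absval (f a y) * absval (?g k)"
        using that by (simp add: absval_mult)
      also have "\<dots> \<le> C a * absval (?g k)"
        using insert.prems that by (intro mult_right_mono) auto
      finally show "e / C a \<le> absval (?g k)"
        using insert.prems(4)[of a] by (simp add: field_simps)
    qed
    thus "{(y, k). y \<in> B \<and> k \<in> ?P \<and> e \<le> absval (f a y * ?g k)} \<subseteq>
            {y\<in>B. e / (\<Prod>x\<in>A. C x) \<le> absval (f a y)} \<times> {k\<in>?P. e / C a \<le> absval (?g k)}"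
      by auto
    have "e / (\<Prod>x\<in>A. C x) > 0" "e / C a > 0"
      using e C1 insert.prems(4)[of a] by auto
    thus "finite ({y\<in>B. e / (\<Prod>x\<in>A. C x) \<le> absval (f a y)} \<times> {k\<in>?P. e / C a \<le> absval (?g k)})"
      using IH(2) insert.prems by (intro finite_cartesian_product) auto
  qed
  have "(\<lambda>(y, k). f a y * ?g k) summable_on B \<times> ?P"
    by (rule summable_on_ultrametricI, rule finite_subset[OF _ fin]) auto
  moreover have "((\<lambda>k. f a y * ?g k) has_sum (f a y * (\<Prod>x\<in>A. s x))) ?P" for y
    by (rule has_sum_cmult_right[OF IH(1)])
  moreover have "((\<lambda>y. f a y * (\<Prod>x\<in>A. s x)) has_sum (s a * (\<Prod>x\<in>A. s x))) B"
    using insert.prems by (intro has_sum_cmult_left) auto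
  ultimately have "((\<lambda>(y, k). f a y * ?g k) has_sum (s a * (\<Prod>x\<in>A. s x))) (B \<times> ?P)"
    using has_sum_SigmaI[where A = B and f = "\<lambda>(y, k). f a y * ?g k" and g = "\<lambda>y. f a y * (\<Prod>x\<in>A. s x)"
        and B = "\<lambda>_. ?P" and S = "s a * (\<Prod>x\<in>A. s x)"] by simp
  hence sum: "((\<lambda>(y, k). f a y * ?g k) has_sum (\<Prod>x\<in>insert a A. s x)) (B \<times> ?P)"
    using insert.hyps by simp
  have inj: "inj_on (\<lambda>(y, k). k(a := y)) (B \<times> ?P)"
    using insert.hyps
    by (intro inj_onI) (auto simp: fun_eq_iff PiE_def extensional_def, metis, metis)
  have img: "(\<lambda>(y, k). k(a := y)) ` (B \<times> ?P) = PiE (insert a A) (\<lambda>_. B)"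
    by (simp add: PiE_insert_eq)
  have eq: "(\<Prod>x\<in>insert a A. f x ((k(a := y)) x)) = f a y * ?g k" for y k
    using insert.hyps by (auto intro!: prod.cong)
  have "((\<lambda>k. \<Prod>x\<in>insert a A. f x (k x)) has_sum (\<Prod>x\<in>insert a A. s x)) (PiE (insert a A) (\<lambda>_. B))"
    using sum unfolding img[symmetric] has_sum_reindex[OF inj]
    by (rule iffD1[OF has_sum_cong, rotated]) (auto simp: eq simp del: prod.insert fun_upd_apply)
  moreover have "finite {k \<in> PiE (insert a A) (\<lambda>_. B). e \<le> absval (\<Prod>x\<in>insert a A. f x (k x))}"
    if "e > 0" for e
    unfolding img[symmetric]
    by (rule finite_subset[OF _ finite_imageI[OF fin[OF that], of "\<lambda>(y, k). k(a := y)"]])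
       (auto simp: eq simp del: prod.insert fun_upd_apply)
  ultimately show ?case by blast
qed

section \<open>The Carlitz exponential\<close>

lemma finite_ge_of_tendsto_0:
  fixes f :: "nat \<Rightarrow> real"
  assumes "f \<longlonglongrightarrow> 0" "e > 0"
  shows   "finite {i. e \<le> f i}"
proof -
  have "eventually (\<lambda>i. f i < e) sequentially"
    using assms by (simp add: order_tendsto_iff)
  then obtain N where "\<And>i. i \<ge> N \<Longrightarrow> f i < e"
    by (auto simp: eventually_sequentially)
  hence "{i. e \<le> f i} \<subseteq> {..<N}"
    by (force simp: not_le[symmetric])
  thus ?thesis
    by (rule finite_subset) auto
qed

section \<open>Finite fields and the Frobenius map\<close>

lemma prime_CHAR_finite_field: "prime CHAR('a :: {finite, field})"
  by (intro prime_CHAR_semidom finite_imp_CHAR_pos) auto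

text \<open>A largest subset that is closed under addition and has cardinality a power of p must be
  everything: otherwise the multiples of an outside element \<open>x\<close> would enlarge it by the
  factor p.\<close>

lemma finite_field_card_eq_power_CHAR: "\<exists>e. CARD('a :: {finite, field}) = CHAR('a) ^ e"
proof -
  let ?p = "CHAR('a)"
  define P where
    "P = (\<lambda>H :: 'a set. 0 \<in> H \<and> (\<forall>x\<in>H. \<forall>y\<in>H. x + y \<in> H) \<and> (\<exists>e. card H = ?p ^ e))"
  have "P {0}"
    by (auto simp: P_def intro: exI[of _ 0])
  moreover have "card H \<le> CARD('a)" for H :: "'a set"
    by (intro card_mono) auto
  ultimately obtain H where H: "P H" "\<And>H'. P H' \<Longrightarrow> card H' \<le> card H"
    using ex_has_greatest_nat[of P "{0}" card "Suc CARD('a)"] by (auto simp: less_Suc_eq_le)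
  obtain e where e: "card H = ?p ^ e"
    using H by (auto simp: P_def)
  have p: "prime ?p"
    by (rule prime_CHAR_finite_field)
  have mult: "of_nat m * h \<in> H" if "h \<in> H" for m h
    using that H(1) by (induction m) (auto simp: P_def algebra_simps)
  \<comment> \<open>Closure under negation comes from closure under addition, since -h = (p - 1)
    h.\<close>
  have uminus: "- h \<in> H" if "h \<in> H" for h
  proof -
    have "of_nat (?p - 1) * h + h = of_nat (?p - 1 + 1) * h"
      by (simp add: algebra_simps)
    also have "\<dots> = 0"
      using prime_gt_0_nat[OF p] by simp
    finally have "- h = of_nat (?p - 1) * h"
      by (metis add.commute add_eq_0_iff)
    thus ?thesis
      using mult[OF that, of "?p - 1"] by simp
  qed
  have "H = UNIV"
  proof (rule ccontr)
    assume "H \<noteq> UNIV"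
    then obtain x where x: "x \<notin> H"
      by auto
    define H' where "H' = (\<lambda>(h, k). h + of_nat k * x) ` (H \<times> {..<?p})"
    \<comment> \<open>Two equal representations would put (k' - k) x into \<open>H\<close>; as k' -
      k is invertible modulo p by Bezout, \<open>x\<close> itself would lie in
      \<open>H\<close>.\<close>
    have aux: False if "h \<in> H" "h' \<in> H" "k < k'" "k' < ?p" "h + of_nat k * x = h' + of_nat k' * x"
      for h h' k k'
    proof -
      have "of_nat (k' - k) * x = h - h'"
        using that by (simp add: of_nat_diff algebra_simps)
      also have "h - h' \<in> H"
        using H(1) that uminus[of h'] unfolding P_def by (metis diff_conv_add_uminus)
      finally have *: "of_nat (k' - k) * x \<in> H" .
      have "coprime (k' - k) ?p"
        using that p by (metis coprime_commute dvd_imp_le less_imp_diff_less linorder_not_less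
            prime_imp_coprime zero_less_diff)
      moreover obtain m y where "(k' - k) * m = ?p * y + gcd (k' - k) ?p"
        using bezout_nat[of "k' - k" ?p] \<open>k < k'\<close> by (metis less_irrefl zero_less_diff)
      ultimately have "of_nat ((k' - k) * m) = (of_nat (?p * y + 1) :: 'a)"
        by simp
      moreover have "of_nat m * (of_nat (k' - k) * x) = of_nat ((k' - k) * m) * x"
        by (simp only: of_nat_mult mult_ac)
      ultimately have "of_nat m * (of_nat (k' - k) * x) = x"
        by simp
      thus False
        using mult[OF *, of m] x by metis
    qed
    have inj: "inj_on (\<lambda>(h, k). h + of_nat k * x) (H \<times> {..<?p})"
    proof (rule inj_onI, clarify)
      fix h k h' k' assume A: "h \<in> H" "h' \<in> H" "k < ?p" "k' < ?p" "h + of_nat k * x = h' + of_nat k' * x"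
      have "k = k'"
        using aux[of h h' k k'] aux[of h' h k' k] A by (metis linorder_neqE_nat)
      thus "h = h' \<and> k = k'"
        using A by simp
    qed
    have "card H' = ?p ^ Suc e"
      unfolding H'_def card_image[OF inj] by (simp add: e)
    moreover have "0 \<in> H'"
      using H(1) prime_gt_0_nat[OF p] unfolding H'_def P_def by (auto intro!: image_eqI[of _ _ "(0, 0)"])
    moreover have "y + z \<in> H'" if "y \<in> H'" "z \<in> H'" for y z
    proof -
      obtain h k h' k' where 1: "y = h + of_nat k * x" "z = h' + of_nat k' * x" "h \<in> H" "h' \<in> H"
        using \<open>y \<in> H'\<close> \<open>z \<in> H'\<close> by (auto simp: H'_def)
      have "of_nat (k + k') = (of_nat ((k + k') mod ?p) + of_nat ?p * of_nat ((k + k') div ?p) :: 'a)"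
        by (metis mod_mult_div_eq of_nat_add of_nat_mult)
      hence "of_nat (k + k') = (of_nat ((k + k') mod ?p) :: 'a)"
        by (simp del: of_nat_add)
      moreover have "y + z = (h + h') + of_nat (k + k') * x"
        by (simp add: 1 algebra_simps)
      ultimately have "y + z = (h + h') + of_nat ((k + k') mod ?p) * x"
        by (simp del: of_nat_add)
      moreover have "h + h' \<in> H"
        using 1 H(1) by (auto simp: P_def)
      ultimately show ?thesis
        using prime_gt_0_nat[OF p] unfolding H'_def
        by (auto intro!: image_eqI[of _ _ "(h + h', (k + k') mod ?p)"])
    qed
    ultimately have "P H'"
      unfolding P_def by blast
    hence "?p ^ Suc e \<le> ?p ^ e"
      using H(2)[of H'] \<open>card H' = _\<close> e by simp
    thus False
      using prime_gt_1_nat[OF p] by simp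
  qed
  thus ?thesis
    using e by auto
qed

text \<open>Multiplication by a nonzero \<open>x\<close> permutes the nonzero elements, so it does
  not change their product; cancelling this product gives the claim.\<close>

lemma finite_field_power_card: "(x :: 'a :: {finite, field}) ^ CARD('a) = x"
proof (cases "x = 0")
  case False
  have "x * (\<Prod>y\<in>UNIV-{0}. x * y) = x * x ^ (CARD('a) - 1) * \<Prod>(UNIV-{0})"
    by (simp add: prod.distrib mult_ac)
  also have "x * x ^ (CARD('a) - 1) = x ^ Suc (CARD('a) - 1)"
    by (subst power_Suc) auto
  also have "(\<Prod>y\<in>UNIV-{0}. x * y) = (\<Prod>y\<in>UNIV-{0}. y)"
    by (rule prod.reindex_bij_witness[of _ "\<lambda>y. y / x" "\<lambda>y. x * y"]) (use False in auto)
  finally show ?thesis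
    by simp
qed auto

lemma card_field_ge_2: "2 \<le> CARD('a :: {finite, field})"
proof -
  have "card {0, 1 :: 'a} \<le> CARD('a)"
    by (intro card_mono) auto
  thus ?thesis by simp
qed

lemma frobenius_add:
  fixes x y :: "'r :: comm_semiring_1"
  assumes "CHAR('r) = CHAR('f :: {finite, field})"
  shows   "(x + y) ^ (CARD('f) ^ i) = x ^ (CARD('f) ^ i) + y ^ (CARD('f) ^ i)"
proof -
  obtain e where "CARD('f) = CHAR('f) ^ e"
    using finite_field_card_eq_power_CHAR[where 'a = 'f] by blast
  thus ?thesis
    using freshmans_dream'[of "CARD('f) ^ i" "e * i" x y] assms prime_CHAR_finite_field[where 'a = 'f]
    by (simp add: power_mult)
qed

lemma frobenius_sum:
  fixes f :: "'i \<Rightarrow> 'r :: comm_semiring_1"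
  assumes "CHAR('r) = CHAR('f :: {finite, field})"
  shows   "sum f A ^ (CARD('f) ^ i) = (\<Sum>x\<in>A. f x ^ (CARD('f) ^ i))"
proof -
  obtain e where "CARD('f) = CHAR('f) ^ e"
    using finite_field_card_eq_power_CHAR[where 'a = 'f] by blast
  thus ?thesis
    using freshmans_dream_sum'[of "CARD('f) ^ i" "e * i" f A] assms prime_CHAR_finite_field[where 'a = 'f]
    by (simp add: power_mult)
qed

lemma frobenius_diff:
  fixes x y :: "'r :: comm_ring_1"
  assumes "CHAR('r) = CHAR('f :: {finite, field})"
  shows   "(x - y) ^ (CARD('f) ^ i) = x ^ (CARD('f) ^ i) - y ^ (CARD('f) ^ i)"
  using frobenius_add[OF assms, of "x - y" y i] by (simp add: algebra_simps)

section \<open>Field embeddings\<close>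

locale field_embed =
  fixes \<iota> :: "'a :: field \<Rightarrow> 'b :: field"
  assumes emb: "field_embedding \<iota>"
begin

lemma emb_1 [simp]: "\<iota> 1 = 1"
  and emb_add: "\<iota> (x + y) = \<iota> x + \<iota> y"
  and emb_mult: "\<iota> (x * y) = \<iota> x * \<iota> y"
  using emb by (auto simp: field_embedding_def)

lemma emb_0 [simp]: "\<iota> 0 = 0"
  using emb_add[of 0 0] by (metis add.right_neutral add_left_cancel)

lemma emb_minus: "\<iota> (- x) = - \<iota> x"
  using emb_add[of x "- x"] by (simp add: add_eq_0_iff)

lemma emb_diff: "\<iota> (x - y) = \<iota> x - \<iota> y"
  using emb_add[of x "- y"] by (simp add: emb_minus)

lemma emb_eq_0_iff [simp]: "\<iota> x = 0 \<longleftrightarrow> x = 0"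
  using emb_mult[of x "inverse x"] by (cases "x = 0") auto

lemma emb_power: "\<iota> (x ^ n) = \<iota> x ^ n"
  by (induction n) (auto simp: emb_mult)

lemma emb_sum: "\<iota> (sum f A) = (\<Sum>x\<in>A. \<iota> (f x))"
  by (induction A rule: infinite_finite_induct) (auto simp: emb_add)

lemma emb_prod: "\<iota> (prod f A) = (\<Prod>x\<in>A. \<iota> (f x))"
  by (induction A rule: infinite_finite_induct) (auto simp: emb_mult)

lemma emb_inverse: "\<iota> (inverse x) = inverse (\<iota> x)"
  using emb_mult[of x "inverse x"] by (cases "x = 0") (auto simp: inverse_unique)

lemma emb_of_nat: "\<iota> (of_nat n) = of_nat n"
  by (induction n) (auto simp: emb_add)

lemma emb_CHAR: "CHAR('b) = CHAR('a)"
proof -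
  have "CHAR('b) dvd n \<longleftrightarrow> CHAR('a) dvd n" for n
    by (simp flip: of_nat_eq_0_iff_char_dvd emb_of_nat)
  thus ?thesis
    by (meson dvd_antisym dvd_refl)
qed

end

section \<open>The ring A inside the completed closure\<close>

locale carlitz =
  fixes \<iota> :: "'f::{finite,field} fls \<Rightarrow> 'c::complete_ultrametric_field"
    and \<pi> :: 'c
    and q :: nat
  assumes completed: "completed_separable_closure \<iota>"
    and period: "carlitz_period \<iota> \<pi>"
    and q_def: "q = CARD('f)"
begin

abbreviation \<theta> :: 'c where "\<theta> \<equiv> theta \<iota>"
abbreviation cd :: "nat \<Rightarrow> 'c" where "cd \<equiv> carlitz_d \<iota>"
abbreviation cexp :: "'c \<Rightarrow> 'c" where "cexp \<equiv> carlitz_exp \<iota>"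

lemma q_ge_2: "2 \<le> q"
  unfolding q_def by (rule card_field_ge_2)

lemma q_gt_0: "0 < q" and q_gt_1: "1 < q" and real_q_gt_1: "1 < real q" and real_q_pos: "0 < real q"
  using q_ge_2 by auto

sublocale field_embed \<iota>
  using completed by unfold_locales (auto simp: completed_separable_closure_def)

lemma CHAR_C: "CHAR('c) = CHAR('f)"
  using emb_CHAR by simp

lemma absval_emb: "x \<noteq> 0 \<Longrightarrow> absval (\<iota> x) = real q powi (- fls_subdegree x)"
  using completed by (auto simp: completed_separable_closure_def q_def)

lemma absval_theta: "absval \<theta> = real q"
  unfolding theta_def by (subst absval_emb) auto

lemma theta_nz [simp]: "\<theta> \<noteq> 0"
  using absval_theta q_gt_0 by (metis absval_0 of_nat_0_less_iff order_less_irrefl)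

lemma absval_const: "c \<noteq> 0 \<Longrightarrow> absval (\<iota> (fls_const c)) = 1"
  by (subst absval_emb) auto

lemmas frob_add = frobenius_add[where 'f = 'f, OF CHAR_C, folded q_def]
lemmas frob_diff = frobenius_diff[where 'f = 'f, OF CHAR_C, folded q_def]
lemmas frob_sum = frobenius_sum[where 'f = 'f, OF CHAR_C, folded q_def]

lemma const_power: "\<iota> (fls_const c) ^ (q ^ i) = \<iota> (fls_const c)"
proof -
  have 1: "\<iota> (fls_const c) ^ q = \<iota> (fls_const c)" for c :: 'f
    by (metis emb_power fls_const_power finite_field_power_card q_def)
  show ?thesis
    by (induction i) (simp_all add: power_mult 1)
qed

lemma A_emb_0 [simp]: "A_emb \<iota> 0 = 0"
  by (simp add: A_emb_def)

lemma A_emb_pCons: "A_emb \<iota> (pCons c a) = \<iota> (fls_const c) + \<theta> * A_emb \<iota> a"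
  by (simp add: A_emb_def map_poly_pCons)

lemma A_emb_add: "A_emb \<iota> (a + b) = A_emb \<iota> a + A_emb \<iota> b"
  by (induction a b rule: poly_induct2)
     (simp_all add: A_emb_pCons emb_add algebra_simps flip: fls_plus_const)

lemma A_emb_minus: "A_emb \<iota> (- a) = - A_emb \<iota> a"
  using A_emb_add[of a "- a"] by (simp add: add_eq_0_iff)

lemma A_emb_diff: "A_emb \<iota> (a - b) = A_emb \<iota> a - A_emb \<iota> b"
  using A_emb_add[of a "- b"] by (simp add: A_emb_minus)

lemma A_emb_1 [simp]: "A_emb \<iota> 1 = 1"
  by (simp add: one_pCons A_emb_pCons)

lemma absval_A_emb: "a \<noteq> 0 \<Longrightarrow> absval (A_emb \<iota> a) = real q ^ degree a"
proof (induction a)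
  case (pCons c a)
  show ?case
  proof (cases "a = 0")
    case True
    thus ?thesis using pCons by (auto simp: A_emb_pCons absval_const)
  next
    case False
    have "absval (\<iota> (fls_const c)) \<le> 1"
      using absval_const[of c] by (cases "c = 0") auto
    also have "1 < real q ^ Suc (degree a)"
      using real_q_gt_1 by (intro one_less_power) auto
    also have "\<dots> = absval (\<theta> * A_emb \<iota> a)"
      using pCons False by (simp add: absval_mult absval_theta)
    finally show ?thesis
      using False pCons by (simp add: A_emb_pCons absval_add_eq_right absval_mult absval_theta)
  qed
qed auto

lemma A_emb_eq_0_iff [simp]: "A_emb \<iota> a = 0 \<longleftrightarrow> a = 0"
  using absval_A_emb[of a] q_gt_0 by fastforce

lemma A_emb_eq_iff [simp]: "A_emb \<iota> a = A_emb \<iota> b \<longleftrightarrow> a = b"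
  using A_emb_eq_0_iff[of "a - b"] by (simp add: A_emb_diff)

lemma absval_A_emb_ge_1: "a \<noteq> 0 \<Longrightarrow> 1 \<le> absval (A_emb \<iota> a)"
  using real_q_gt_1 by (simp add: absval_A_emb)

text \<open>A bound on the size bounds the degree, and the coefficients come from a finite field.
  The sums over A converge for this reason.\<close>

lemma finite_A_le: "finite {a. absval (A_emb \<iota> a) \<le> B}"
proof -
  obtain n where n: "B < real q ^ n"
    using real_arch_pow[OF real_q_gt_1] by blast
  have "degree a \<le> n" if "absval (A_emb \<iota> a) \<le> B" for a
  proof (cases "a = 0")
    case False
    hence "real q ^ degree a < real q ^ n"
      using that n absval_A_emb[of a] by simp
    thus ?thesis
      using real_q_gt_1 power_less_imp_less_exp less_imp_le by metis
  qed auto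
  hence "{a. absval (A_emb \<iota> a) \<le> B} \<subseteq> {a. degree a \<le> n}"
    by auto
  also have "{a :: 'f poly. degree a \<le> n} \<subseteq> Poly ` {xs. set xs \<subseteq> UNIV \<and> length xs \<le> Suc n}"
  proof safe
    fix a :: "'f poly" assume "degree a \<le> n"
    thus "a \<in> Poly ` {xs. set xs \<subseteq> UNIV \<and> length xs \<le> Suc n}"
      by (cases "a = 0") (auto intro!: image_eqI[of _ _ "coeffs a"] simp: length_coeffs_degree)
  qed
  finally show ?thesis
    by (rule finite_subset) (intro finite_imageI finite_lists_length_le finite)
qed

subsection \<open>The exponential series\<close>

lemma cd_0 [simp]: "cd 0 = 1"
  by (simp add: carlitz_d_def)

lemma cd_def: "cd i = (\<Prod>j<i. \<theta> ^ (q ^ i) - \<theta> ^ (q ^ j))"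
  by (simp add: carlitz_d_def q_def)

text \<open>Taking q-th powers is additive, so it shifts both exponents in each factor of
  \<open>cd i\<close>; only the factor j = 0 of \<open>cd (Suc i)\<close> is new.\<close>

lemma cd_Suc: "cd (Suc i) = (\<theta> ^ (q ^ Suc i) - \<theta>) * cd i ^ q"
proof -
  have *: "(\<theta> ^ q ^ i - \<theta> ^ q ^ j) ^ q = \<theta> ^ q ^ Suc i - \<theta> ^ q ^ Suc j" for j
    using frob_diff[of "\<theta> ^ q ^ i" "\<theta> ^ q ^ j" 1] by (simp add: mult.commute flip: power_mult)
  have "cd (Suc i) = (\<theta> ^ q ^ Suc i - \<theta> ^ q ^ 0) * (\<Prod>j<i. \<theta> ^ q ^ Suc i - \<theta> ^ q ^ Suc j)"
    unfolding cd_def by (subst prod.lessThan_Suc_shift) simp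
  also have "(\<Prod>j<i. \<theta> ^ q ^ Suc i - \<theta> ^ q ^ Suc j) = cd i ^ q"
    unfolding cd_def * [symmetric] by (simp add: prod_power_distrib)
  finally show ?thesis by simp
qed

lemma absval_theta_diff:
  assumes "j < i"
  shows   "absval (\<theta> ^ q ^ i - \<theta> ^ q ^ j) = real q ^ (q ^ i)"
proof -
  have "real q ^ (q ^ j) < real q ^ (q ^ i)"
    using assms q_gt_1 by (intro power_strict_increasing) auto
  thus ?thesis
    by (simp add: absval_diff_eq_left absval_power absval_theta)
qed

lemma absval_cd: "absval (cd i) = real q ^ (i * q ^ i)"
  unfolding cd_def absval_prod
  by (subst prod.cong[OF refl, of _ _ "\<lambda>_. real q ^ (q ^ i)"])
     (auto simp: absval_theta_diff mult.commute simp flip: power_mult)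

lemma cd_nz [simp]: "cd i \<noteq> 0"
  using absval_cd[of i] q_gt_0 by (metis absval_0 of_nat_0_less_iff order_less_irrefl zero_less_power)

lemma absval_exp_term: "absval (X ^ (q ^ i) / cd i) = (absval X / real q ^ i) ^ (q ^ i)"
  by (simp add: absval_divide absval_power absval_cd power_divide power_mult)

lemma self_le_q_power: "i \<le> q ^ i"
  using less_exp[of i] power_mono[of 2 q i] q_ge_2 by linarith

lemma exp_term_tendsto: "(\<lambda>i. (x / real q ^ i) ^ (q ^ i)) \<longlonglongrightarrow> 0" if "x \<ge> 0" for x :: real
proof (rule Lim_null_comparison)
  obtain N where N: "2 * x < real q ^ N"
    using real_arch_pow[OF real_q_gt_1] by blast
  have "norm ((x / real q ^ i) ^ (q ^ i)) \<le> (1 / 2) ^ i" if "i \<ge> N" for i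
  proof -
    have "real q ^ N \<le> real q ^ i"
      using that real_q_gt_1 by (intro power_increasing) auto
    hence "x / real q ^ i \<le> 1 / 2"
      using N real_q_pos by (simp add: field_simps)
    hence "(x / real q ^ i) ^ (q ^ i) \<le> (1 / 2) ^ (q ^ i)"
      using \<open>x \<ge> 0\<close> by (intro power_mono) auto
    also have "\<dots> \<le> (1 / 2) ^ i"
      using self_le_q_power by (intro power_decreasing) auto
    finally show ?thesis
      using \<open>x \<ge> 0\<close> by simp
  qed
  thus "eventually (\<lambda>i. norm ((x / real q ^ i) ^ (q ^ i)) \<le> (1 / 2) ^ i) sequentially"
    by (auto simp: eventually_sequentially)
qed (simp add: LIMSEQ_power_zero)

lemma finite_exp_terms: "e > 0 \<Longrightarrow> finite {i. e \<le> absval (X ^ (q ^ i) / cd i)}"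
  unfolding absval_exp_term by (intro finite_ge_of_tendsto_0 exp_term_tendsto) auto

lemma exp_has_sum: "((\<lambda>i. X ^ (q ^ i) / cd i) has_sum cexp X) UNIV"
proof -
  have "(\<lambda>i. X ^ (q ^ i) / cd i) summable_on UNIV"
    using finite_exp_terms by (intro summable_on_ultrametricI) auto
  then obtain S where S: "((\<lambda>i. X ^ (q ^ i) / cd i) has_sum S) UNIV"
    by (auto simp: summable_on_def)
  hence "S = cexp X"
    unfolding carlitz_exp_def q_def using has_sum_imp_sums sums_unique by blast
  thus ?thesis using S by simp
qed

lemma exp_sums: "(\<lambda>i. X ^ (q ^ i) / cd i) sums cexp X"
  by (rule has_sum_imp_sums[OF exp_has_sum])

lemma exp_add: "cexp (X + Y) = cexp X + cexp Y"
  using has_sum_unique[OF exp_has_sum[of "X + Y"]] has_sum_add[OF exp_has_sum[of X] exp_has_sum[of Y]]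
  by (simp add: frob_add add_divide_distrib)

lemma exp_0 [simp]: "cexp 0 = 0"
  using exp_add[of 0 0] by (metis add.right_neutral add_left_cancel)

lemma exp_minus: "cexp (- X) = - cexp X"
  using exp_add[of X "- X"] by (simp add: add_eq_0_iff)

lemma exp_diff: "cexp (X - Y) = cexp X - cexp Y"
  using exp_add[of X "- Y"] by (simp add: exp_minus)

lemma exp_const: "cexp (\<iota> (fls_const c) * X) = \<iota> (fls_const c) * cexp X"
proof -
  have "((\<lambda>i. \<iota> (fls_const c) * (X ^ (q ^ i) / cd i)) has_sum \<iota> (fls_const c) * cexp X) UNIV"
    by (rule has_sum_cmult_right[OF exp_has_sum])
  thus ?thesis
    using has_sum_unique exp_has_sum[of "\<iota> (fls_const c) * X"] by (simp add: power_mult_distrib const_power)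
qed

text \<open>By \<open>cd_Suc\<close> the q-th power of one term of the series is the next term, of
  index i say, times \<theta>^(q^i) - \<theta>. The same factor is the defect between the term at
  \<theta> X and \<theta> times the term at X.\<close>

lemma exp_theta: "cexp (\<theta> * X) = \<theta> * cexp X + cexp X ^ q"
proof -
  have "(\<lambda>n. \<Sum>i<n. (X ^ q ^ i / cd i) ^ q) \<longlonglongrightarrow> cexp X ^ q"
  proof -
    have "(\<lambda>n. (\<Sum>i<n. X ^ q ^ i / cd i) ^ q) \<longlonglongrightarrow> cexp X ^ q"
      using exp_sums[of X] unfolding sums_def by (intro tendsto_intros)
    thus ?thesis
      by (simp add: frob_sum[where i = 1, simplified])
  qed
  hence "(\<lambda>i. (X ^ q ^ i / cd i) ^ q) sums (cexp X ^ q)"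
    by (simp add: sums_def)
  also have "(\<lambda>i. (X ^ q ^ i / cd i) ^ q) = (\<lambda>i. (\<theta> ^ q ^ Suc i - \<theta>) * X ^ q ^ Suc i / cd (Suc i))"
  proof
    fix i
    have "\<theta> ^ q ^ Suc i - \<theta> \<noteq> 0"
      using absval_theta_diff[of 0 "Suc i"] q_gt_0
      by (metis absval_0 of_nat_0_less_iff order_less_irrefl power_0 power_one_right zero_less_Suc zero_less_power)
    thus "(X ^ q ^ i / cd i) ^ q = (\<theta> ^ q ^ Suc i - \<theta>) * X ^ q ^ Suc i / cd (Suc i)"
      by (simp add: cd_Suc power_divide power_mult mult.commute[of q])
  qed
  finally have 1: "(\<lambda>i. (\<theta> ^ q ^ Suc i - \<theta>) * X ^ q ^ Suc i / cd (Suc i)) sums (cexp X ^ q)" .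
  \<comment> \<open>The index shift is free because the term at i = 0 has the factor \<theta> -
    \<theta>.\<close>
  have 1: "(\<lambda>i. (\<theta> ^ q ^ i - \<theta>) * X ^ q ^ i / cd i) sums (cexp X ^ q)"
  proof -
    have "(\<lambda>n. \<Sum>i<Suc n. (\<theta> ^ q ^ i - \<theta>) * X ^ q ^ i / cd i) \<longlonglongrightarrow> cexp X ^ q"
      using 1 unfolding sums_def by (subst sum.lessThan_Suc_shift) simp
    thus ?thesis
      unfolding sums_def by (subst (asm) filterlim_sequentially_Suc)
  qed
  have "(\<lambda>n. (\<Sum>i<n. \<theta> * (X ^ q ^ i / cd i)) + (\<Sum>i<n. (\<theta> ^ q ^ i - \<theta>) * X ^ q ^ i / cd i))
          \<longlonglongrightarrow> \<theta> * cexp X + cexp X ^ q"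
    using 1 exp_sums[of X] unfolding sums_def sum_distrib_left[symmetric] by (intro tendsto_intros)
  also have "(\<lambda>n. (\<Sum>i<n. \<theta> * (X ^ q ^ i / cd i)) + (\<Sum>i<n. (\<theta> ^ q ^ i - \<theta>) * X ^ q ^ i / cd i))
     = (\<lambda>n. \<Sum>i<n. (\<theta> * X) ^ q ^ i / cd i)"
    by (auto simp: fun_eq_iff power_mult_distrib diff_divide_distrib left_diff_distrib simp flip: sum.distrib)
  finally have "(\<lambda>i. (\<theta> * X) ^ q ^ i / cd i) sums (\<theta> * cexp X + cexp X ^ q)"
    by (simp add: sums_def)
  thus ?thesis
    using exp_sums sums_unique2 by blast
qed

text \<open>One factor \<open>X\<close> is split off each term; what remains is at most a term of
  the null sequence of \<open>exp_term_tendsto\<close>. Linearity in |X| later gives the decay of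
  \<open>E k x\<close> as k grows.\<close>

lemma exp_bound: "\<exists>C\<ge>1. \<forall>X. absval X \<le> R \<longrightarrow> absval (cexp X) \<le> C * absval X"
proof -
  define R' where "R' = max 1 R"
  have R': "R' \<ge> 1" "R \<le> R'" by (auto simp: R'_def)
  have "Bseq (\<lambda>i. (R' / real q ^ i) ^ (q ^ i))"
    using exp_term_tendsto[of R'] R' by (intro convergent_imp_Bseq convergentI) auto
  then obtain C where C: "C > 0" "\<And>i. norm ((R' / real q ^ i) ^ (q ^ i)) \<le> C"
    by (auto simp: Bseq_def)
  have "absval (cexp X) \<le> max 1 C * absval X" if X: "absval X \<le> R" for X
  proof (rule has_sum_absval_le[OF exp_has_sum])
    fix i :: nat
    show "absval (X ^ q ^ i / cd i) \<le> max 1 C * absval X"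
    proof (cases "X = 0")
      case True
      thus ?thesis using q_gt_0 by (simp add: power_0_left)
    next
      case False
      have "q ^ i = Suc (q ^ i - 1)"
        using q_gt_0 by simp
      hence "absval X ^ (q ^ i) = absval X * absval X ^ (q ^ i - 1)"
        by (metis power_Suc)
      also have "\<dots> \<le> absval X * R' ^ (q ^ i - 1)"
        using X R' by (intro mult_left_mono power_mono) auto
      also have "\<dots> \<le> absval X * R' ^ (q ^ i)"
        using R' by (intro mult_left_mono power_increasing) auto
      finally have "absval (X ^ q ^ i / cd i) \<le> absval X * (R' / real q ^ i) ^ (q ^ i)"
        unfolding absval_exp_term using real_q_pos by (simp add: power_divide divide_right_mono)
      also have "\<dots> \<le> absval X * max 1 C"
        using C(2)[of i] R' by (intro mult_left_mono) auto
      finally show ?thesis by (simp add: mult.commute)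
    qed
  qed auto
  thus ?thesis
    by (intro exI[of _ "max 1 C"]) auto
qed

text \<open>
  The hypothesis says that \<open>X\<close> lies inside the radius of injectivity, \<open>q\<close> to the power \<open>q / (q - 1)\<close>.
\<close>

lemma exp_term_less:
  assumes "X \<noteq> 0" "absval X ^ (q - 1) < real q ^ q" "i > 0"
  shows   "absval (X ^ (q ^ i) / cd i) < absval X"
proof -
  have "absval X ^ (q ^ i - 1) < real q ^ (i * q ^ i)"
    using \<open>i > 0\<close>
  proof (induction i rule: nat_induct_non_zero)
    case 1
    thus ?case using assms by simp
  next
    case (Suc i)
    \<comment> \<open>The hypothesis controls only the power q - 1 of |X|, so the exponent is split
      into a multiple of q - 1 and the previous exponent.\<close>
    have "q ^ Suc i - 1 = (q - 1) * q ^ i + (q ^ i - 1)"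
      using q_gt_0 by (simp add: algebra_simps)
    hence "absval X ^ (q ^ Suc i - 1) = (absval X ^ (q - 1)) ^ (q ^ i) * absval X ^ (q ^ i - 1)"
      by (simp add: power_add power_mult)
    also have "\<dots> \<le> (real q ^ q) ^ (q ^ i) * absval X ^ (q ^ i - 1)"
      using assms(2) by (intro mult_right_mono power_mono) auto
    also have "\<dots> < (real q ^ q) ^ (q ^ i) * real q ^ (i * q ^ i)"
      using Suc real_q_pos by (intro mult_strict_left_mono) auto
    also have "\<dots> = real q ^ (q ^ Suc i + i * q ^ i)"
      by (simp add: power_add flip: power_mult)
    also have "\<dots> \<le> real q ^ (Suc i * q ^ Suc i)"
      using real_q_gt_1 q_gt_0 by (intro power_increasing) (auto intro: mult_le_mono)
    finally show ?case .
  qed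
  hence "absval X ^ (q ^ i - 1) * absval X < real q ^ (i * q ^ i) * absval X"
    using assms by (intro mult_strict_right_mono) auto
  also have "absval X ^ (q ^ i - 1) * absval X = absval X ^ (q ^ i)"
    using q_gt_0 by (metis Suc_diff_1 power_Suc2 zero_less_power)
  finally show ?thesis
    using real_q_pos by (simp add: absval_divide absval_power absval_cd field_simps)
qed

lemma exp_minus_id_has_sum: "((\<lambda>i. X ^ (q ^ i) / cd i) has_sum (cexp X - X)) {0<..}"
proof -
  have "((\<lambda>i. X ^ (q ^ i) / cd i) has_sum X) {0}"
    using has_sum_finite[of "{0}" "\<lambda>i. X ^ (q ^ i) / cd i"] by simp
  hence "((\<lambda>i. X ^ (q ^ i) / cd i) has_sum (cexp X - X)) (UNIV - {0})"
    by (intro has_sum_Diff[OF exp_has_sum]) auto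
  also have "UNIV - {0 :: nat} = {0<..}"
    by auto
  finally show ?thesis .
qed

lemma absval_exp:
  assumes "absval X ^ (q - 1) < real q ^ q"
  shows   "absval (cexp X) = absval X"
proof (cases "X = 0")
  case False
  \<comment> \<open>Strict inequality for each term does not pass to an infinite sum. But only
    finitely many terms reach |X| / 2, so the maximum of these and |X| / 2 is a uniform bound below
    |X|.\<close>
  define I where "I = insert (absval X / 2) ((\<lambda>i. absval (X ^ (q ^ i) / cd i)) ` {i. i > 0 \<and> absval X / 2 \<le> absval (X ^ (q ^ i) / cd i)})"
  have I: "finite I"
    using finite_exp_terms[of "absval X / 2" X] False unfolding I_def
    by (intro finite.insertI finite_imageI) (auto elim: rev_finite_subset)
  have "\<forall>x\<in>I. x < absval X"
    using exp_term_less[OF False assms] False by (auto simp: I_def)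
  hence "Max I < absval X"
    using I by (subst Max_less_iff) (auto simp: I_def)
  have "absval (cexp X - X) \<le> Max I"
  proof (rule has_sum_absval_le[OF exp_minus_id_has_sum])
    have half: "absval X / 2 \<le> Max I"
      using I by (intro Max_ge) (auto simp: I_def)
    thus "0 \<le> Max I"
      using absval_nonneg[of X] by linarith
    fix i :: nat assume "i \<in> {0<..}"
    thus "absval (X ^ q ^ i / cd i) \<le> Max I"
      using I half by (cases "absval X / 2 \<le> absval (X ^ (q ^ i) / cd i)") (auto intro!: Max_ge simp: I_def)
  qed
  hence "absval (X - cexp X) < absval X"
    using \<open>Max I < absval X\<close> by (simp add: absval_minus_commute)
  thus ?thesis
    by (rule absval_eq_of_diff_less)
qed auto

text \<open>By additivity of \<open>cexp\<close> this applies to differences, so exp(y) - y is a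
  contraction on the disc. This is how a preimage under \<open>cexp\<close> is found in
  \<open>period_facts\<close>.\<close>

lemma exp_minus_id_le:
  assumes "absval X ^ (q - 1) \<le> real q"
  shows   "absval (cexp X - X) \<le> absval X / real q"
proof (rule has_sum_absval_le[OF exp_minus_id_has_sum])
  fix i :: nat assume i: "i \<in> {0<..}"
  have "absval X ^ (q ^ i - 1) \<le> real q ^ (i * q ^ i - 1)"
  proof -
    have "absval X ^ (q ^ i - 1) \<le> real q ^ (q ^ i - 1)"
    proof (induction i)
      case (Suc i)
      have eq: "q ^ Suc i - 1 = (q - 1) * q ^ i + (q ^ i - 1)"
        using q_gt_0 by (simp add: algebra_simps)
      hence "absval X ^ (q ^ Suc i - 1) = (absval X ^ (q - 1)) ^ (q ^ i) * absval X ^ (q ^ i - 1)"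
        by (simp add: power_add power_mult)
      also have "\<dots> \<le> real q ^ (q ^ i) * real q ^ (q ^ i - 1)"
        by (intro mult_mono power_mono[OF assms] Suc) auto
      also have "\<dots> = real q ^ (q ^ i + (q ^ i - 1))"
        by (simp add: power_add)
      also have "\<dots> \<le> real q ^ (q ^ Suc i - 1)"
      proof (rule power_increasing)
        show "q ^ i + (q ^ i - 1) \<le> q ^ Suc i - 1"
          unfolding eq using q_gt_1 mult_le_mono1[of 1 "q - 1" "q ^ i"] by (intro add_right_mono) linarith
      qed (use real_q_gt_1 in simp)
      finally show ?case .
    qed auto
    also have "\<dots> \<le> real q ^ (i * q ^ i - 1)"
      using i real_q_gt_1 by (intro power_increasing diff_le_mono) auto
    finally show ?thesis .
  qed
  hence "absval X ^ (q ^ i - 1) * absval X \<le> real q ^ (i * q ^ i - 1) * absval X"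
    by (intro mult_right_mono) auto
  also have "absval X ^ (q ^ i - 1) * absval X = absval X ^ (q ^ i)"
    using q_gt_0 by (metis Suc_diff_1 power_Suc2 zero_less_power)
  also have "real q ^ (i * q ^ i - 1) = real q ^ (i * q ^ i) / real q"
    using i q_gt_0 by (simp add: power_diff)
  finally show "absval (X ^ q ^ i / cd i) \<le> absval X / real q"
    using real_q_pos by (simp add: absval_divide absval_power absval_cd field_simps)
qed auto

end

context carlitz
begin

subsection \<open>Existence of roots and the period\<close>

lemma of_nat_q [simp]: "of_nat q = (0 :: 'c)"
proof -
  obtain e where e: "q = CHAR('f) ^ e"
    using finite_field_card_eq_power_CHAR[where 'a = 'f] q_def by auto
  hence "e \<noteq> 0"
    using q_ge_2 by (cases e) auto
  hence "CHAR('c) dvd q"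
    by (simp add: e CHAR_C)
  thus ?thesis
    by (simp add: of_nat_eq_0_iff_char_dvd)
qed

lemma emb_separable: "\<iota> x \<in> separable_elements \<iota>"
proof -
  let ?P = "[:- x, 1:]"
  have "irreducible ?P"
    by (rule irreducible_linear_field_poly) auto
  moreover have "coprime ?P (pderiv ?P)"
    by (simp add: pderiv_pCons flip: one_pCons)
  moreover have "poly (map_poly \<iota> ?P) (\<iota> x) = 0"
    by (simp add: map_poly_pCons emb_minus)
  ultimately show ?thesis
    unfolding separable_elements_def by blast
qed

text \<open>The polynomial P = X^N - c is separable, since X P' - N P is the nonzero constant N
  c.\<close>

lemma root_exists:
  assumes "N > 0" "of_nat N \<noteq> (0 :: 'c)" "c \<noteq> 0"
  shows   "\<exists>x. x ^ N = \<iota> c"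
proof -
  define P where "P = monom 1 N - [:\<iota> c:]"
  have "coeff P i = \<iota> (coeff (monom 1 N - [:c:]) i)" for i
    by (auto simp: P_def emb_diff coeff_pCons split: nat.splits)
  hence 1: "coeff P i \<in> separable_elements \<iota>" for i
    using emb_separable by simp
  have "degree P = N"
    unfolding P_def diff_conv_add_uminus using assms
    by (subst degree_add_eq_left) (auto simp: degree_monom_eq)
  moreover have "coprime P (pderiv P)"
  proof (rule coprimeI)
    fix D assume D: "D dvd P" "D dvd pderiv P"
    have "pderiv P = monom (of_nat N) (N - 1)"
      by (simp add: P_def pderiv_diff pderiv_monom pderiv_pCons)
    hence "[:0, 1:] * pderiv P - smult (of_nat N) P = [:of_nat N * \<iota> c:]"
      using assms by (cases N) (simp_all add: P_def smult_diff_right smult_monom monom_Suc)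
    moreover have "D dvd [:0, 1:] * pderiv P - smult (of_nat N) P"
      using D by (intro dvd_diff dvd_mult dvd_smult)
    ultimately have "D dvd [:of_nat N * \<iota> c:]"
      by simp
    moreover have "is_unit [:of_nat N * \<iota> c:]"
      using assms by (simp add: is_unit_const_poly_iff dvd_field_iff)
    ultimately show "is_unit D"
      by (rule dvd_trans)
  qed
  moreover have "separably_closed (separable_elements \<iota>)"
    using completed by (simp add: completed_separable_closure_def)
  ultimately obtain x where "poly P x = 0"
    using 1 assms unfolding separably_closed_def by blast
  thus ?thesis
    by (intro exI[of _ x]) (simp add: P_def poly_monom)
qed

lemma exp_kernel: "cexp x = 0 \<longleftrightarrow> (\<exists>a. x = \<pi> * A_emb \<iota> a)"
  using period unfolding carlitz_period_def by blast

text \<open>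
  A root \<open>\<lambda>\<close> of \<open>\<theta> X + X\<^sup>q\<close> is in the domain where the exponential is invertible, and \<open>\<theta>\<close> times
  its preimage is a nonzero period.
\<close>

lemma period_facts: "\<pi> \<noteq> 0 \<and> absval \<pi> ^ (q - 1) = real q ^ q"
proof -
  \<comment> \<open>In characteristic p the number q - 1 becomes -1, so \<open>root_exists\<close>
    applies to the exponent q - 1.\<close>
  have "of_nat q = of_nat (q - 1) + (1 :: 'c)"
    using q_gt_0 by (metis Suc_pred' of_nat_Suc add.commute)
  hence "of_nat (q - 1) = (- 1 :: 'c)"
    by (simp add: eq_neg_iff_add_eq_0)
  then obtain l where l: "l ^ (q - 1) = \<iota> (- fls_X_inv)"
    using root_exists[of "q - 1" "- fls_X_inv"] q_gt_1 by auto
  hence l: "l ^ (q - 1) = - \<theta>"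
    by (simp add: theta_def emb_minus)
  hence lnz: "l \<noteq> 0"
    using q_gt_1 theta_nz by (auto simp: power_0_left split: if_splits)
  have abs_l: "absval l ^ (q - 1) = real q"
    using l by (metis absval_minus absval_power absval_theta)
  have small: "absval x ^ (q - 1) \<le> real q" if "absval x \<le> absval l" for x
    using power_mono[OF that, of "q - 1"] abs_l by simp
  \<comment> \<open>A fixed point of \<open>f\<close> is a solution of
    \<open>cexp y = l\<close>.\<close>
  define f where "f = (\<lambda>y. l - (cexp y - y))"
  have "\<exists>!y. y \<in> cball 0 (absval l) \<and> f y = y"
  proof (rule Banach_fix[of "cball 0 (absval l)" "1 / real q" f])
    show "complete (cball 0 (absval l) :: 'c set)"
      by (meson Cauchy_convergent closed_cball complete_def convergent_def closed_sequentially)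
    show "cball 0 (absval l) \<noteq> {}"
      by (simp add: not_less)
    show "f ` cball 0 (absval l) \<subseteq> cball 0 (absval l)"
    proof (safe)
      fix y :: 'c assume "y \<in> cball 0 (absval l)"
      hence y: "absval y \<le> absval l"
        by (simp add: dist_conv_absval)
      have "absval (cexp y - y) \<le> absval y / real q"
        by (intro exp_minus_id_le small y)
      also have "\<dots> \<le> absval y"
        using q_gt_0 mult_left_mono[of 1 "real q" "absval y"] by (simp add: field_simps)
      also have "\<dots> \<le> absval l" by (rule y)
      finally have "absval (f y) \<le> absval l"
        using absval_diff_le[of l "cexp y - y"] by (auto simp: f_def)
      thus "f y \<in> cball 0 (absval l)"
        by (simp add: dist_conv_absval)
    qed
    fix y z :: 'c assume yz: "y \<in> cball 0 (absval l)" "z \<in> cball 0 (absval l)"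
    have "f y - f z = - (cexp (y - z) - (y - z))"
      by (simp add: f_def exp_diff)
    hence "absval (f y - f z) = absval (cexp (y - z) - (y - z))"
      by (metis absval_minus)
    also have "\<dots> \<le> absval (y - z) / real q"
      using yz absval_diff_le[of y z] by (intro exp_minus_id_le small) (auto simp: dist_conv_absval)
    finally show "dist (f y) (f z) \<le> 1 / real q * dist y z"
      by (simp add: dist_conv_absval)
  qed (use q_gt_1 in auto)
  then obtain y where y: "absval y \<le> absval l" "cexp y = l"
    by (auto simp: f_def dist_conv_absval)
  have "absval y ^ (q - 1) < real q ^ q"
    using small[OF y(1)] power_strict_increasing[of 1 q "real q"] q_gt_1 real_q_gt_1
    by (metis le_less_trans power_one_right)
  hence abs_y: "absval y = absval l"
    using absval_exp y by metis
  have "cexp (\<theta> * y) = \<theta> * l + l ^ q"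
    by (simp add: exp_theta y)
  also have "l ^ q = l ^ (q - 1) * l"
    using q_gt_0 by (metis Suc_pred' power_Suc2)
  finally have "cexp (\<theta> * y) = 0"
    unfolding l by simp
  then obtain a where a: "\<theta> * y = \<pi> * A_emb \<iota> a"
    by (auto simp: exp_kernel)
  have ynz: "\<theta> * y \<noteq> 0"
    using abs_y lnz by auto
  hence nz: "\<pi> \<noteq> 0" "a \<noteq> 0"
    using a by auto
  have "real q * absval l = absval \<pi> * absval (A_emb \<iota> a)"
    using a by (metis abs_y absval_mult absval_theta)
  \<comment> \<open>A nonzero \<open>a\<close> has size at least 1, which bounds |\<pi>| from above.
    The opposite bound uses that a nonzero zero of \<open>cexp\<close> cannot lie where
    \<open>cexp\<close> preserves sizes.\<close>
  hence "absval \<pi> \<le> real q * absval l"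
    using absval_A_emb_ge_1[OF nz(2)] mult_left_mono[of 1 "absval (A_emb \<iota> a)" "absval \<pi>"] by simp
  hence "absval \<pi> ^ (q - 1) \<le> (real q * absval l) ^ (q - 1)"
    by (intro power_mono) auto
  also have "\<dots> = real q ^ (q - 1) * real q"
    by (simp only: power_mult_distrib abs_l)
  also have "\<dots> = real q ^ q"
    using q_gt_0 by (metis Suc_pred' power_Suc2)
  finally have "absval \<pi> ^ (q - 1) \<le> real q ^ q" .
  moreover have "\<not> absval \<pi> ^ (q - 1) < real q ^ q"
  proof
    assume "absval \<pi> ^ (q - 1) < real q ^ q"
    hence "absval (cexp \<pi>) = absval \<pi>"
      by (rule absval_exp)
    moreover have "cexp \<pi> = 0"
      unfolding exp_kernel by (intro exI[of _ 1]) simp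
    ultimately show False
      using nz by simp
  qed
  ultimately show ?thesis
    using nz by simp
qed

lemma pi_nz [simp]: "\<pi> \<noteq> 0" and absval_pi: "absval \<pi> ^ (q - 1) = real q ^ q"
  using period_facts by auto

subsection \<open>The functions \<open>e\<^sub>k\<close>\<close>

abbreviation E :: "int \<Rightarrow> 'c \<Rightarrow> 'c" where "E \<equiv> e_fun \<iota> \<pi>"

lemma E_add: "E k (x + y) = E k x + E k y"
  by (simp add: e_fun_def exp_add[symmetric] add_divide_distrib ring_distribs)

lemma E_diff: "E k (x - y) = E k x - E k y"
  by (simp add: e_fun_def exp_diff[symmetric] diff_divide_distrib ring_distribs)

lemma E_const: "E k (\<iota> (fls_const c) * x) = \<iota> (fls_const c) * E k x"
  by (simp add: e_fun_def exp_const[symmetric] mult_ac)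

lemma E_pred_arg: "\<pi> * x / \<theta> powi (k - 1) = \<theta> * (\<pi> * x / \<theta> powi k)"
  by (simp add: power_int_diff)

lemma E_pred: "E (k - 1) x = \<theta> * E k x + E k x ^ q"
  by (simp only: e_fun_def E_pred_arg exp_theta)

lemma E_theta: "E k (\<theta> * x) = E (k - 1) x"
  by (simp only: e_fun_def E_pred_arg) (simp add: mult_ac)

lemma E_nat_eq_0_iff: "E (int d) x = 0 \<longleftrightarrow> (\<exists>a. x = \<theta> ^ d * A_emb \<iota> a)"
proof -
  have "E (int d) x = 0 \<longleftrightarrow> (\<exists>a. \<pi> * x / \<theta> ^ d = \<pi> * A_emb \<iota> a)"
    by (simp add: e_fun_def exp_kernel)
  also have "\<dots> \<longleftrightarrow> (\<exists>a. x = \<theta> ^ d * A_emb \<iota> a)"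
    by (simp add: field_simps)
  finally show ?thesis .
qed

lemma E_0_eq_0_iff: "E 0 x = 0 \<longleftrightarrow> x \<in> range (A_emb \<iota>)"
  using E_nat_eq_0_iff[of 0 x] by auto

lemma E_nonpos_A [simp]:
  assumes "k \<le> 0"
  shows   "E k (A_emb \<iota> a) = 0"
proof -
  have "E (- int n) (A_emb \<iota> a) = 0" for n
  proof (induction n)
    case (Suc n)
    have "- int (Suc n) = - int n - 1"
      by simp
    thus ?case
      by (simp only: E_pred Suc) (use q_gt_0 in \<open>simp add: power_0_left\<close>)
  qed (simp add: E_0_eq_0_iff)
  from this[of "nat (- k)"] show ?thesis
    using assms by simp
qed

lemma absval_E:
  assumes "absval x < real q powi k"
  shows   "absval (E k x) = absval \<pi> * absval x / real q powi k"
proof -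
  have eq: "absval (\<pi> * x / \<theta> powi k) = absval \<pi> * (absval x / real q powi k)"
    by (simp add: absval_divide absval_mult absval_power_int absval_theta)
  have "absval x / real q powi k < 1"
    using assms real_q_pos by simp
  hence "(absval x / real q powi k) ^ (q - 1) < 1"
    using q_gt_1 real_q_pos power_strict_mono[of "absval x / real q powi k" 1 "q - 1"] by simp
  hence "absval (\<pi> * x / \<theta> powi k) ^ (q - 1) < real q ^ q"
    unfolding eq power_mult_distrib absval_pi using real_q_pos mult_strict_left_mono by fastforce
  from absval_exp[OF this] show ?thesis
    unfolding e_fun_def by (simp add: eq)
qed

lemma E_bound: "\<exists>C\<ge>1. \<forall>k\<ge>K. absval (E k x) \<le> C * real q powi (- k)"
proof -
  obtain C where C: "C \<ge> 1"
    "\<And>X. absval X \<le> absval (\<pi> * x) * real q powi (- K) \<Longrightarrow> absval (cexp X) \<le> C * absval X"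
    using exp_bound by blast
  have "absval (E k x) \<le> (C * max 1 (absval (\<pi> * x))) * real q powi (- k)" if k: "k \<ge> K" for k
  proof -
    have eq: "absval (\<pi> * x / \<theta> powi k) = absval (\<pi> * x) * real q powi (- k)"
      by (simp add: absval_divide absval_mult absval_power_int absval_theta power_int_minus field_simps)
    have "real q powi (- k) \<le> real q powi (- K)"
      using k real_q_gt_1 by (intro power_int_increasing) auto
    hence "absval (E k x) \<le> C * (absval (\<pi> * x) * real q powi (- k))"
      unfolding e_fun_def eq[symmetric] by (intro C(2)) (auto simp: eq intro: mult_left_mono)
    also have "\<dots> \<le> C * (max 1 (absval (\<pi> * x)) * real q powi (- k))"
      using C(1) real_q_pos by (intro mult_left_mono mult_right_mono) auto
    finally show ?thesis by (simp add: mult_ac)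
  qed
  moreover have "C * max 1 (absval (\<pi> * x)) \<ge> 1 * 1"
    using C(1) by (intro mult_mono) auto
  ultimately show ?thesis
    by (intro exI[of _ "C * max 1 (absval (\<pi> * x))"]) simp
qed

text \<open>The hypothesis says that the q-th power of \<open>E k x\<close> is larger than \<theta>
  times \<open>E k x\<close>, so it dominates in \<open>E_pred\<close>. By
  \<open>less_power_mono\<close> the hypothesis is inherited by the next lower index.\<close>

lemma E_large:
  assumes "real q < absval (E k x) ^ (q - 1)"
  shows   "absval (E (k - 1) x) = absval (E k x) ^ q"
proof -
  have nz: "E k x \<noteq> 0"
    using assms q_gt_1 by (auto simp: power_0_left split: if_splits)
  have "absval (\<theta> * E k x) < absval (E k x) ^ (q - 1) * absval (E k x)"
    using assms nz by (simp add: absval_mult absval_theta)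
  also have "\<dots> = absval (E k x ^ q)"
    using q_gt_0 by (metis Suc_pred' absval_power power_Suc2)
  finally show ?thesis
    unfolding E_pred by (simp add: absval_add_eq_right absval_power)
qed

lemma less_power_mono:
  assumes "real q < x ^ (q - 1)" "x \<ge> 0"
  shows   "1 < x" "real q < (x ^ q) ^ (q - 1)"
proof -
  show 1: "1 < x"
  proof (rule ccontr)
    assume "\<not> 1 < x"
    hence "x ^ (q - 1) \<le> 1"
      using assms by (intro power_le_one) auto
    thus False
      using assms real_q_gt_1 by simp
  qed
  have "x ^ (q - 1) \<le> (x ^ q) ^ (q - 1)"
    using 1 q_gt_0 by (intro power_mono self_le_power) auto
  thus "real q < (x ^ q) ^ (q - 1)"
    using assms by simp
qed

text \<open>Beyond this threshold the sizes would stay beyond it as the index decreases, by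
  \<open>E_large\<close>; but at index 0 the value is zero.\<close>

lemma E_A_le:
  assumes "k \<ge> 0"
  shows   "absval (E k (A_emb \<iota> a)) ^ (q - 1) \<le> real q"
proof -
  have "absval (E (int n) (A_emb \<iota> a)) ^ (q - 1) \<le> real q" for n
  proof (induction n)
    case 0
    thus ?case using q_gt_1 by (simp add: power_0_left)
  next
    case (Suc n)
    show ?case
    proof (rule ccontr)
      assume "\<not> ?thesis"
      hence *: "real q < absval (E (int (Suc n)) (A_emb \<iota> a)) ^ (q - 1)"
        by simp
      show False
        using E_large[OF *] less_power_mono(2)[OF *] Suc by simp
    qed
  qed
  from this[of "nat k"] show ?thesis
    using assms by simp
qed

lemma E_A_le_q: "absval (E k (A_emb \<iota> a)) \<le> real q"
proof (cases "k \<ge> 0")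
  case True
  show ?thesis
  proof (rule ccontr)
    assume *: "\<not> ?thesis"
    hence "real q ^ 1 < absval (E k (A_emb \<iota> a)) ^ 1"
      by simp
    also have "\<dots> \<le> absval (E k (A_emb \<iota> a)) ^ (q - 1)"
      using * real_q_gt_1 q_gt_1 by (intro power_increasing) auto
    finally show False
      using E_A_le[OF True, of a] by simp
  qed
qed auto

subsection \<open>Test points\<close>

text \<open>
  The absolute value of a test point is not an integral power of \<open>q\<close>.  So no two terms of
  \<open>\<theta> E\<^sub>k + E\<^sub>k\<^sup>q\<close> have the same absolute value there, and the size of every \<open>E\<^sub>k\<close> is known exactly.
\<close>

definition eta :: 'c where "eta = (SOME x. x ^ (q + 1) = \<theta>)"

definition zt :: "nat \<Rightarrow> 'c" where "zt r = eta * \<theta> ^ r"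

text \<open>\<open>bet\<close> is the size of e_(r+1) at \<open>zt r\<close>, which does not depend
  on r. Each step to a lower index raises the size to the power q, so \<open>Q r\<close> is the size
  of e_0 there.\<close>

definition bet :: real where "bet = absval \<pi> * absval eta / real q"

definition Q :: "nat \<Rightarrow> real" where "Q r = bet ^ (q ^ (r + 1))"

lemma eta_power: "eta ^ (q + 1) = \<theta>"
proof -
  have "of_nat (q + 1) \<noteq> (0 :: 'c)"
    unfolding of_nat_add by simp
  hence "\<exists>x. x ^ (q + 1) = \<theta>"
    unfolding theta_def by (intro root_exists) auto
  thus ?thesis
    unfolding eta_def by (rule someI_ex)
qed

lemma absval_eta: "1 < absval eta" "absval eta < real q"
proof -
  have *: "absval eta ^ (q + 1) = real q"
    using eta_power by (metis absval_power absval_theta)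
  show "1 < absval eta"
  proof (rule ccontr)
    assume "\<not> ?thesis"
    hence "absval eta ^ (q + 1) \<le> 1"
      by (intro power_le_one) auto
    thus False using * real_q_gt_1 by simp
  qed
  show "absval eta < real q"
  proof (rule ccontr)
    assume "\<not> ?thesis"
    hence "real q ^ (q + 1) \<le> absval eta ^ (q + 1)"
      by (intro power_mono) auto
    moreover have "real q ^ 1 < real q ^ (q + 1)"
      using real_q_gt_1 q_gt_0 by (intro power_strict_increasing) auto
    ultimately show False using * by simp
  qed
qed

lemma absval_zt: "absval (zt r) = absval eta * real q ^ r"
  by (simp add: zt_def absval_mult absval_power absval_theta)

lemma beta_power: "bet ^ (q - 1) = real q * absval eta ^ (q - 1)"
proof -
  have "bet ^ (q - 1) = real q ^ q / real q ^ (q - 1) * absval eta ^ (q - 1)"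
    by (simp only: bet_def power_mult_distrib power_divide absval_pi) simp
  also have "real q ^ q / real q ^ (q - 1) = real q"
    using q_gt_0 by (simp add: power_diff)
  finally show ?thesis .
qed

text \<open>The strict inequality comes from |eta| > 1; for |eta| = 1 the value would lie exactly on
  the threshold, where the two terms of \<open>E_pred\<close> may cancel.\<close>

lemma beta_large: "real q < bet ^ (q - 1)"
  unfolding beta_power using absval_eta q_gt_1 real_q_pos by simp

lemma beta_gt_1: "1 < bet"
  using less_power_mono(1)[OF beta_large] by (simp add: bet_def)

lemma Q_gt_1: "1 < Q r"
  unfolding Q_def using beta_gt_1 q_gt_0 by (intro one_less_power) auto

lemma Q_at_top: "filterlim Q at_top sequentially"
proof (rule filterlim_at_top_mono)
  show "filterlim (\<lambda>r. bet ^ r) at_top sequentially"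
    using beta_gt_1 filterlim_realpow_sequentially_gt1[of bet]
    by (intro filterlim_at_infinity_imp_filterlim_at_top) auto
  have "bet ^ r \<le> Q r" for r
    unfolding Q_def using beta_gt_1 self_le_q_power[of "r + 1"] by (intro power_increasing) auto
  thus "eventually (\<lambda>r. bet ^ r \<le> Q r) sequentially"
    by simp
qed

lemma Q_powr: "Q r powr (real q powi (- (int r + 1 - int n))) = bet ^ (q ^ n)"
proof -
  have "Q r = bet powr (real q ^ (r + 1))"
    unfolding Q_def using beta_gt_1 by (subst powr_realpow[symmetric]) auto
  hence "Q r powr (real q powi (- (int r + 1 - int n))) = bet powr (real q ^ (r + 1) * real q powi (- (int r + 1 - int n)))"
    by (simp add: powr_powr)
  also have "real q ^ (r + 1) = real q powi (int r + 1)"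
    by (metis int_ops(4) of_nat_Suc power_int_of_nat Suc_eq_plus1 add.commute)
  also have "\<dots> * real q powi (- (int r + 1 - int n)) = real q powi (int n)"
    using real_q_pos by (subst power_int_add[symmetric]) auto
  also have "bet powr \<dots> = bet ^ (q ^ n)"
    using beta_gt_1 by (subst powr_realpow[symmetric]) auto
  finally show ?thesis .
qed

lemma absval_E_zt_large: "absval (E (int r + 1 + int y) (zt r)) = bet / real q ^ y"
proof -
  have eq: "real q powi (int r + 1 + int y) = real q ^ r * real q * real q ^ y"
    using real_q_pos by (simp add: power_int_add)
  have "absval (zt r) < real q powi (int r + 1 + int y)"
  proof -
    have "absval (zt r) < real q ^ r * real q * 1"
      unfolding absval_zt using absval_eta real_q_pos by simp
    also have "\<dots> \<le> real q ^ r * real q * real q ^ y"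
      using real_q_gt_1 real_q_pos by (intro mult_left_mono) auto
    finally show ?thesis unfolding eq .
  qed
  from absval_E[OF this] show ?thesis
    using real_q_pos unfolding eq bet_def absval_zt by simp
qed

lemma absval_E_zt:
  assumes "k \<le> int r + 1"
  shows   "absval (E k (zt r)) = Q r powr (real q powi (- k))"
proof -
  \<comment> \<open>The threshold of \<open>E_large\<close> is carried along, since it licenses each
    step down from the index r + 1.\<close>
  have "absval (E (int r + 1 - int n) (zt r)) = bet ^ (q ^ n)
      \<and> real q < absval (E (int r + 1 - int n) (zt r)) ^ (q - 1)" for n
  proof (induction n)
    case 0
    thus ?case using absval_E_zt_large[of r 0] beta_large by simp
  next
    case (Suc n)
    have "absval (E (int r + 1 - int n - 1) (zt r)) = (bet ^ (q ^ n)) ^ q"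
      using E_large[OF conjunct2[OF Suc]] conjunct1[OF Suc] by simp
    also have "\<dots> = bet ^ (q ^ Suc n)"
      by (simp add: mult.commute flip: power_mult)
    finally have eq: "absval (E (int r + 1 - int n - 1) (zt r)) = bet ^ (q ^ Suc n)" .
    have "real q < (absval (E (int r + 1 - int n) (zt r)) ^ q) ^ (q - 1)"
      using conjunct2[OF Suc] by (intro less_power_mono(2)) simp_all
    also have "absval (E (int r + 1 - int n) (zt r)) ^ q = bet ^ (q ^ Suc n)"
      using Suc by (simp add: mult.commute flip: power_mult)
    finally have "real q < (bet ^ (q ^ Suc n)) ^ (q - 1)" .
    moreover have "int r + 1 - int (Suc n) = int r + 1 - int n - 1"
      by simp
    ultimately show ?case
      by (simp only: eq)
  qed
  from this[of "nat (int r + 1 - k)"] show ?thesis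
    using assms Q_powr[of r "nat (int r + 1 - k)"] by simp
qed

text \<open>Above the index r + 1 the true size falls by the factor q at each step, while the bound
  is replaced by its q-th root. The new size x satisfies x^(q-1) <= q because |eta| < q, hence x^q
  <= q x, and q x is the previous size.\<close>

lemma absval_E_zt_le: "absval (E k (zt r)) \<le> Q r powr (real q powi (- k))"
proof (cases "k \<le> int r + 1")
  case True
  thus ?thesis using absval_E_zt by simp
next
  case False
  have step: "x \<le> b powr (1 / real q)" if "x ^ q \<le> b" "x \<ge> 0" for x b :: real
  proof -
    have "(x ^ q) powr (1 / real q) \<le> b powr (1 / real q)"
      using that by (intro powr_mono2) auto
    also have "(x ^ q) powr (1 / real q) = x"
      using that q_gt_0 by (cases "x = 0") (auto simp: powr_powr simp flip: powr_realpow)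
    finally show ?thesis .
  qed
  have *: "bet / real q ^ y \<le> Q r powr (real q powi (- (int r + 1 + int y)))" for y
  proof (induction y)
    case 0
    thus ?case using Q_powr[of r 0] by simp
  next
    case (Suc y)
    define x where "x = bet / real q ^ Suc y"
    have x0: "x \<ge> 0"
      using beta_gt_1 by (simp add: x_def)
    have "x \<le> bet / real q"
      unfolding x_def using beta_gt_1 real_q_gt_1 by (intro divide_left_mono) auto
    hence "x ^ (q - 1) \<le> (bet / real q) ^ (q - 1)"
      using x0 by (intro power_mono) auto
    also have "\<dots> = real q * (absval eta / real q) ^ (q - 1)"
      by (simp only: power_divide beta_power) simp
    also have "\<dots> \<le> real q * 1"
      using absval_eta real_q_pos by (intro mult_left_mono power_le_one) auto
    finally have "x ^ (q - 1) * x \<le> real q * x"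
      using x0 by (intro mult_right_mono) auto
    also have "x ^ (q - 1) * x = x ^ q"
      using q_gt_0 by (metis Suc_pred' power_Suc2)
    also have "real q * x = bet / real q ^ y"
      using real_q_pos by (simp add: x_def)
    also note Suc
    finally have "x \<le> (Q r powr (real q powi (- (int r + 1 + int y)))) powr (1 / real q)"
      using x0 by (intro step)
    also have "\<dots> = Q r powr (real q powi (- (int r + 1 + int (Suc y))))"
      unfolding powr_powr using real_q_pos
      by (simp add: power_int_add power_int_diff power_int_minus field_simps power2_eq_square)
    finally show ?case by (simp add: x_def)
  qed
  from *[of "nat (k - int r - 1)"] absval_E_zt_large[of r "nat (k - int r - 1)"] False
  show ?thesis by simp
qed

lemma absval_zt_minus_A: "absval (zt r) \<le> absval (zt r - A_emb \<iota> a)"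
proof -
  have "absval (zt r) \<noteq> absval (A_emb \<iota> a)"
  proof (cases "a = 0")
    case True
    thus ?thesis using absval_eta real_q_pos by (auto simp: absval_zt)
  next
    case False
    have "absval eta * real q ^ r \<noteq> real q ^ degree a"
    proof (cases "degree a \<le> r")
      case True
      hence "real q ^ degree a \<le> 1 * real q ^ r"
        using real_q_gt_1 by (simp add: power_increasing)
      also have "\<dots> < absval eta * real q ^ r"
        using absval_eta real_q_pos by (intro mult_strict_right_mono) auto
      finally show ?thesis by simp
    next
      case False
      have "absval eta * real q ^ r < real q * real q ^ r"
        using absval_eta real_q_pos by (intro mult_strict_right_mono) auto
      also have "\<dots> = real q ^ Suc r" by simp
      also have "\<dots> \<le> real q ^ degree a"
        using False real_q_gt_1 by (intro power_increasing) auto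
      finally show ?thesis by simp
    qed
    thus ?thesis
      using False by (simp add: absval_zt absval_A_emb)
  qed
  thus ?thesis
    using absval_diff_eq_left[of "A_emb \<iota> a" "zt r"] absval_diff_eq_right[of "zt r" "A_emb \<iota> a"]
    by (cases "absval (A_emb \<iota> a) < absval (zt r)") auto
qed

lemma zt_notin_A: "zt r \<notin> range (A_emb \<iota>)"
proof
  assume "zt r \<in> range (A_emb \<iota>)"
  then obtain a where "zt r = A_emb \<iota> a"
    by auto
  moreover have "absval (zt r) > 0"
    using absval_eta real_q_pos by (auto simp: absval_zt simp del: absval_pos_iff)
  ultimately show False
    using absval_zt_minus_A[of r a] by simp
qed

end

section \<open>Digits and multisets\<close>

text \<open>
  An exponent \<open>j\<close> is represented by the multiset of the indices of its digits: the monomial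
  \<open>\<langle>e\<rangle>\<^sup>j\<close> is the product of the \<open>e\<^sub>k\<close> over this multiset, and \<open>j\<close> is its weight.
\<close>

definition wt :: "nat \<Rightarrow> int multiset \<Rightarrow> real" where
  "wt q \<mu> = (\<Sum>k\<in>#\<mu>. real q powi (- k))"

definition base_reduced :: "nat \<Rightarrow> int multiset \<Rightarrow> bool" where
  "base_reduced q \<mu> \<longleftrightarrow> (\<forall>k. count \<mu> k < q)"

lemma wt_empty [simp]: "wt q {#} = 0"
  and wt_add_mset [simp]: "wt q (add_mset k \<mu>) = real q powi (- k) + wt q \<mu>"
  and wt_union: "wt q (\<mu> + \<nu>) = wt q \<mu> + wt q \<nu>"
  by (simp_all add: wt_def)

lemma wt_nonneg [simp]: "0 \<le> wt q \<mu>"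
  by (induction \<mu>) (auto simp: zero_le_power_int)

lemma wt_replicate: "wt q (replicate_mset n k) = real n * real q powi (- k)"
  by (induction n) (auto simp: algebra_simps)

lemma sum_mset_conv_sum_count:
  fixes g :: "'a \<Rightarrow> real"
  assumes "finite A" "set_mset \<mu> \<subseteq> A"
  shows   "(\<Sum>k\<in>#\<mu>. g k) = (\<Sum>k\<in>A. real (count \<mu> k) * g k)"
  using assms(2)
proof (induction \<mu>)
  case (add x \<mu>)
  have "(\<Sum>k\<in>A. real (count (add_mset x \<mu>) k) * g k)
      = (\<Sum>k\<in>A. real (count \<mu> k) * g k + (if k = x then g k else 0))"
    by (intro sum.cong) (auto simp: algebra_simps)
  also have "\<dots> = (\<Sum>k\<in>A. real (count \<mu> k) * g k) + g x"
    using add assms(1) by (simp add: sum.distrib)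
  finally show ?case
    using add by simp
qed auto

lemma base_reduced_subset: "base_reduced q \<mu> \<Longrightarrow> \<nu> \<subseteq># \<mu> \<Longrightarrow> base_reduced q \<nu>"
  unfolding base_reduced_def by (meson le_less_trans mset_subset_eq_count)

lemma finite_multisets_le:
  assumes "finite A"
  shows   "finite {\<mu>. size \<mu> \<le> L \<and> set_mset \<mu> \<subseteq> A}"
proof (rule finite_subset)
  show "{\<mu>. size \<mu> \<le> L \<and> set_mset \<mu> \<subseteq> A} \<subseteq> mset ` {xs. set xs \<subseteq> A \<and> length xs \<le> L}"
  proof
    fix \<mu> assume "\<mu> \<in> {\<mu>. size \<mu> \<le> L \<and> set_mset \<mu> \<subseteq> A}"
    moreover obtain xs where "mset xs = \<mu>"
      using ex_mset by blast
    ultimately show "\<mu> \<in> mset ` {xs. set xs \<subseteq> A \<and> length xs \<le> L}"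
      by (intro image_eqI[of _ _ xs]) auto
  qed
qed (intro finite_imageI finite_lists_length_le assms)

context
  fixes q :: nat
  assumes q: "q \<ge> 2"
begin

lemma powi_pos: "real q powi k > 0"
  using q by (intro zero_less_power_int) auto

lemma wt_carry: "wt q (replicate_mset q k) = real q powi (- (k - 1))"
  using q by (simp add: wt_replicate power_int_diff power_int_minus field_simps)

text \<open>Carrying: q equal entries \<open>k\<close> are traded for one entry \<open>k - 1\<close>
  of the same weight, and the size drops since q >= 2.\<close>

lemma exists_reduced:
  "\<exists>\<nu>. base_reduced q \<nu> \<and> wt q \<nu> = wt q \<mu> \<and> size \<nu> \<le> size \<mu>"
proof (induction "size \<mu>" arbitrary: \<mu> rule: less_induct)
  case less
  show ?case
  proof (cases "base_reduced q \<mu>")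
    case False
    then obtain k where "count \<mu> k \<ge> q"
      by (auto simp: base_reduced_def not_less)
    hence sub: "replicate_mset q k \<subseteq># \<mu>"
      by (rule iffD1[OF count_le_replicate_mset_subset_eq])
    define \<rho> where "\<rho> = \<mu> - replicate_mset q k"
    have \<rho>: "\<mu> = replicate_mset q k + \<rho>"
      using sub by (simp add: \<rho>_def subset_mset.add_diff_inverse)
    have "wt q (add_mset (k - 1) \<rho>) = wt q \<mu>"
      by (simp add: \<rho> wt_union wt_carry)
    moreover have "size (add_mset (k - 1) \<rho>) < size \<mu>"
      using q by (simp add: \<rho>)
    ultimately show ?thesis
      using less[of "add_mset (k - 1) \<rho>"] by (metis dual_order.trans less_imp_le)
  qed auto
qed

lemma wt_geometric:
  "(\<Sum>k\<in>{n<..n + int m}. (real q - 1) * real q powi (- k)) = real q powi (- n) - real q powi (- (n + int m))"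
proof (induction m)
  case (Suc m)
  have 1: "{n<..n + int (Suc m)} = insert (n + int m + 1) {n<..n + int m}"
    by auto
  have 2: "real q powi (- (n + int m + 1)) = real q powi (- (n + int m)) / real q"
    using q power_int_diff[of "real q" "- (n + int m)" 1]
    by (simp only: minus_add_distrib diff_conv_add_uminus) simp
  have 3: "n + int (Suc m) = n + int m + 1"
    by simp
  show ?case
    unfolding 1 by (subst sum.insert) (simp, simp, unfold 3 Suc 2, use q in \<open>simp add: field_simps\<close>)
qed auto

text \<open>The inequality is strict because a multiset has only finitely many entries: the
  geometric sum with all digits q - 1 stops short of its limit.\<close>

lemma wt_tail_less:
  assumes "base_reduced q \<mu>" "\<And>k. k \<in># \<mu> \<Longrightarrow> n < k"
  shows   "wt q \<mu> < real q powi (- n)"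
proof -
  obtain m where m: "\<And>k. k \<in># \<mu> \<Longrightarrow> k \<le> n + int m"
  proof
    fix k assume "k \<in># \<mu>"
    hence "k \<le> Max (insert n (set_mset \<mu>))" and "n \<le> Max (insert n (set_mset \<mu>))"
      by auto
    thus "k \<le> n + int (nat (Max (insert n (set_mset \<mu>)) - n))"
      by simp
  qed
  have "wt q \<mu> = (\<Sum>k\<in>{n<..n + int m}. real (count \<mu> k) * real q powi (- k))"
    unfolding wt_def using assms m by (intro sum_mset_conv_sum_count) auto
  also have "\<dots> \<le> (\<Sum>k\<in>{n<..n + int m}. (real q - 1) * real q powi (- k))"
  proof (intro sum_mono mult_right_mono)
    fix k
    have "count \<mu> k + 1 \<le> q"
      using assms(1) by (simp add: base_reduced_def Suc_le_eq)
    thus "real (count \<mu> k) \<le> real q - 1"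
      by linarith
  qed (auto simp: zero_le_power_int)
  also have "\<dots> < real q powi (- n)"
    unfolding wt_geometric using powi_pos[of "- (n + int m)"] by simp
  finally show ?thesis .
qed

lemma wt_head_multiple:
  assumes "\<And>i. i \<in># \<nu> \<Longrightarrow> i < k"
  shows   "\<exists>N::int. wt q \<nu> * real q powi k = real q * of_int N"
  using assms
proof (induction \<nu>)
  case (add i \<nu>)
  then obtain N :: int where N: "wt q \<nu> * real q powi k = real q * of_int N"
    by auto
  have "real q powi (- i) * real q powi k = real q powi (1 + int (nat (k - i - 1)))"
    using q add.prems[of i] by (subst power_int_add[symmetric]) auto
  also have "\<dots> = real q * real q ^ nat (k - i - 1)"
    using q by (subst power_int_add) (auto simp del: int_nat_eq)
  finally have "wt q (add_mset i \<nu>) * real q powi k = real q * of_int (int q ^ nat (k - i - 1) + N)"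
    by (simp add: N distrib_right distrib_left)
  thus ?case by blast
qed (auto intro: exI[of _ 0])

text \<open>After multiplication by q^k the entries below \<open>k\<close> contribute a multiple of
  q and those above \<open>k\<close> less than 1, so floor and remainder isolate the entries equal
  to \<open>k\<close>.\<close>

lemma digit_wt:
  assumes "base_reduced q \<mu>"
  shows   "digit q (wt q \<mu>) k = count \<mu> k"
proof -
  define a where "a = filter_mset (\<lambda>i. i < k) \<mu>"
  define b where "b = filter_mset (\<lambda>i. k < i) \<mu>"
  have "\<mu> = a + replicate_mset (count \<mu> k) k + b"
    by (rule multiset_eqI) (auto simp: a_def b_def)
  hence wt: "wt q \<mu> = wt q a + real (count \<mu> k) * real q powi (- k) + wt q b"
    by (metis wt_union wt_replicate)
  obtain N :: int where N: "wt q a * real q powi k = real q * of_int N"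
    using wt_head_multiple[of a k] by (auto simp: a_def)
  have "wt q b < real q powi (- k)"
    by (rule wt_tail_less) (auto simp: b_def intro: base_reduced_subset[OF assms])
  hence "wt q b * real q powi k < real q powi (- k) * real q powi k"
    using powi_pos by (intro mult_strict_right_mono) auto
  moreover have inv: "real q powi (- k) * real q powi k = 1"
    using powi_pos[of k] left_inverse[of "real q powi k"] by (metis less_irrefl power_int_minus)
  ultimately have b: "wt q b * real q powi k < 1"
    by linarith
  have "wt q \<mu> * real q powi k = of_int (int q * N + int (count \<mu> k)) + wt q b * real q powi k"
    using N by (simp add: wt ring_distribs inv mult.assoc del: power_int_mult_distrib)
  moreover have "0 \<le> wt q b * real q powi k"
    using powi_pos[of k] by (intro mult_nonneg_nonneg) auto
  ultimately have "\<lfloor>wt q \<mu> * real q powi k\<rfloor> = int q * N + int (count \<mu> k)"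
    using b by (intro floor_unique; linarith)
  moreover have "count \<mu> k < q"
    using assms by (simp add: base_reduced_def)
  ultimately show ?thesis
    by (simp add: digit_def)
qed

lemma wt_inj: "base_reduced q \<mu> \<Longrightarrow> base_reduced q \<nu> \<Longrightarrow> wt q \<mu> = wt q \<nu> \<Longrightarrow> \<mu> = \<nu>"
  by (metis digit_wt multiset_eqI)

lemma digits_wt:
  assumes "base_reduced q \<mu>"
  shows   "{k. digit q (wt q \<mu>) k \<noteq> 0} = set_mset \<mu>"
  by (auto simp: digit_wt[OF assms])

lemma digit_sum_wt:
  assumes "base_reduced q \<mu>"
  shows   "digit_sum q (wt q \<mu>) = size \<mu>"
  by (simp add: digit_sum_def digits_wt[OF assms] digit_wt[OF assms] size_multiset_overloaded_eq)

lemma digit_sum_wt_le: "digit_sum q (wt q \<mu>) \<le> size \<mu>"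
  using exists_reduced[of \<mu>] digit_sum_wt by metis

lemma tame_exponent_wt:
  assumes "q = p ^ e"
  shows   "wt q \<mu> \<in> tame_exponents p"
proof -
  have "\<exists>M N :: nat. wt q \<mu> = real N / real q ^ M"
  proof (induction \<mu>)
    case empty
    show ?case by (intro exI[of _ 0]) auto
  next
    case (add k \<mu>)
    then obtain M N where MN: "wt q \<mu> = real N / real q ^ M"
      by blast
    have "real q powi (- k) = real (q ^ nat (- k)) / real q ^ nat k"
      by (cases "k \<ge> 0") (auto simp: power_int_def divide_inverse power_inverse)
    hence "wt q (add_mset k \<mu>) = real (q ^ nat (- k) * q ^ M + N * q ^ nat k) / real q ^ (nat k + M)"
      using q by (simp add: MN power_add field_simps)
    thus ?case by blast
  qed
  then obtain M N where "wt q \<mu> = real N / real q ^ M"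
    by blast
  hence "wt q \<mu> = real N / real p ^ (e * M)"
    by (simp add: assms power_mult)
  thus ?thesis
    unfolding tame_exponents_def by blast
qed

lemma tame_exponent_cases:
  assumes "q = p ^ e" "j \<in> tame_exponents p"
  obtains \<mu> where "base_reduced q \<mu>" "wt q \<mu> = j"
proof -
  obtain a b where j: "j = real a / real p ^ b"
    using assms by (auto simp: tame_exponents_def)
  have e: "e > 0" and p: "p > 0"
    using assms q by (auto intro!: Nat.gr0I simp: power_0_left split: if_splits)
  \<comment> \<open>The denominator p^b is enlarged to q^b = p^(e b), which multiplies the numerator
    by p^(e b - b).\<close>
  have "wt q (replicate_mset (a * p ^ (e * b - b)) (int b)) = real a * real p ^ (e * b - b) / real p ^ (e * b)"
    by (simp add: wt_replicate power_int_minus assms(1) field_simps flip: power_mult)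
  also have "\<dots> = j"
    using e p by (simp add: j power_diff)
  finally show ?thesis
    using exists_reduced[of "replicate_mset (a * p ^ (e * b - b)) (int b)"] that by metis
qed

lemma bij_betw_wt:
  assumes "q = p ^ e"
  shows   "bij_betw (wt q) {\<mu>. base_reduced q \<mu>} (tame_exponents p)"
  unfolding bij_betw_def
proof
  show "inj_on (wt q) {\<mu>. base_reduced q \<mu>}"
    by (auto intro!: inj_onI wt_inj)
  show "wt q ` {\<mu>. base_reduced q \<mu>} = tame_exponents p"
    using tame_exponent_wt[OF assms] tame_exponent_cases[OF assms] by blast
qed

lemma digit_sum_nat_pred:
  assumes "digit_sum q (real n) = Suc r"
  obtains i where "q ^ i \<le> n" "digit_sum q (real (n - q ^ i)) = r"
proof -
  obtain \<mu> where \<mu>: "base_reduced q \<mu>" "wt q \<mu> = real n"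
    using exists_reduced[of "replicate_mset n 0"] by (auto simp: wt_replicate)
  hence size: "size \<mu> = Suc r"
    using digit_sum_wt assms by metis
  then obtain k where k: "k \<in># \<mu>"
    by (cases \<mu>) auto
  define \<nu> where "\<nu> = \<mu> - {#k#}"
  have eq: "\<mu> = add_mset k \<nu>"
    using k by (simp add: \<nu>_def)
  have red: "base_reduced q \<nu>"
    using \<mu>(1) by (rule base_reduced_subset) (simp add: \<nu>_def)
  \<comment> \<open>An integer has no digits after the point, so the chosen entry corresponds to a
    power of q that is a natural number.\<close>
  have "k \<le> 0"
  proof (rule ccontr)
    assume "\<not> k \<le> 0"
    then obtain j where "k = int (Suc j)"
      using zero_less_imp_eq_int[of k] by (auto simp: gr0_conv_Suc)
    hence "real n * real q powi k = of_int (int q * (int n * int q ^ j))"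
      by (simp del: of_nat_Suc add: power_int_of_nat)
    hence "\<lfloor>real n * real q powi k\<rfloor> = int q * (int n * int q ^ j)"
      by (simp only: floor_of_int)
    hence "digit q (real n) k = 0"
      by (simp add: digit_def)
    thus False
      using k digit_wt[OF \<mu>(1), of k] \<mu>(2) by (auto simp: count_eq_zero_iff)
  qed
  then obtain i where i: "k = - int i"
    by (elim nonpos_int_cases)
  have n: "real n = real (q ^ i) + wt q \<nu>"
    using \<mu>(2) by (simp add: eq i)
  hence "real (q ^ i) \<le> real n"
    by simp
  hence le: "q ^ i \<le> n"
    by (simp only: of_nat_le_iff)
  moreover have "real (n - q ^ i) = wt q \<nu>"
    using n le by (simp add: of_nat_diff)
  hence "digit_sum q (real (n - q ^ i)) = r"
    using digit_sum_wt[OF red] size by (simp add: eq)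
  ultimately show ?thesis using that by blast
qed

text \<open>
  Near \<open>c > 0\<close> only finitely many values of the largest summand are possible; this gives the induction
  step.
\<close>

lemma wt_left_isolated:
  "\<exists>\<delta>>0. \<forall>\<mu>. size \<mu> \<le> L \<longrightarrow> (\<forall>k\<in>#\<mu>. K \<le> k) \<longrightarrow> \<not> (c - \<delta> < wt q \<mu> \<and> wt q \<mu> < c)"
proof (induction L arbitrary: c)
  case 0
  show ?case
    by (intro exI[of _ "if c > 0 then c else 1"]) auto
next
  case (Suc L)
  show ?case
  proof (cases "c \<le> 0")
    case True
    thus ?thesis
      by (intro exI[of _ 1]) (auto simp: not_less intro: order_trans[OF _ wt_nonneg])
  next
    case False
    \<comment> \<open>At most L + 1 summands below \<open>d\<close> add up to at most c / 2. So a
      weight above c / 2 has a summand of size at least \<open>d\<close>, and only the finitely many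
      indices in \<open>I\<close> allow that.\<close>
    define d where "d = c / (2 * real (Suc L))"
    have d: "d > 0"
      using False by (simp add: d_def)
    obtain k1 :: nat where k1: "1 / d < real q ^ k1"
      using real_arch_pow[of "real q" "1 / d"] q by auto
    define I where "I = {K..int k1}"
    obtain \<delta> where \<delta>: "\<And>k. \<delta> k > 0"
      "\<And>k \<mu>. size \<mu> \<le> L \<Longrightarrow> (\<forall>i\<in>#\<mu>. K \<le> i) \<Longrightarrow>
        \<not> (c - real q powi (- k) - \<delta> k < wt q \<mu> \<and> wt q \<mu> < c - real q powi (- k))"
      using Suc.IH[of "c - real q powi (- k)" for k :: int] by metis
    define D where "D = Min (insert (c / 2) (\<delta> ` I))"
    have finI: "finite (insert (c / 2) (\<delta> ` I))"
      by (simp add: I_def)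
    have D: "D > 0"
      unfolding D_def using False \<delta>(1) Min_gr_iff[OF finI, of 0] by auto
    have D2: "D \<le> c / 2"
      unfolding D_def by (rule Min_le[OF finI]) simp
    have D3: "D \<le> \<delta> k" if "k \<in> I" for k
      unfolding D_def using that by (intro Min_le[OF finI]) auto
    have False if \<mu>: "size \<mu> \<le> Suc L" "\<forall>k\<in>#\<mu>. K \<le> k" "c - D < wt q \<mu>" "wt q \<mu> < c" for \<mu>
    proof -
      have "\<exists>k\<in>#\<mu>. d \<le> real q powi (- k)"
      proof (rule ccontr)
        assume *: "\<not> ?thesis"
        have "wt q \<mu> \<le> (\<Sum>k\<in>#\<mu>. d)"
          unfolding wt_def using * by (intro sum_mset_mono) auto
        also have "\<dots> = real (size \<mu>) * d"
          by simp
        also have "\<dots> \<le> real (Suc L) * d"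
          using \<mu>(1) d by (intro mult_right_mono) auto
        also have "\<dots> = c / 2"
          by (simp add: d_def field_simps)
        finally show False
          using \<mu>(3) D2 by simp
      qed
      then obtain k where k: "k \<in># \<mu>" "d \<le> real q powi (- k)"
        by blast
      have "k \<le> int k1"
      proof (rule ccontr)
        assume "\<not> k \<le> int k1"
        hence "real q powi (- k) \<le> real q powi (- int k1)"
          using q by (intro power_int_increasing) auto
        also have "\<dots> < d"
          using k1 d q by (simp add: power_int_minus field_simps)
        finally show False using k by simp
      qed
      hence kI: "k \<in> I"
        using \<mu>(2) k by (auto simp: I_def)
      define \<nu> where "\<nu> = \<mu> - {#k#}"
      have eq: "\<mu> = add_mset k \<nu>"
        using k by (simp add: \<nu>_def)
      show False
        using \<delta>(2)[of \<nu> k] \<mu> D3[OF kI] by (simp add: eq)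
    qed
    thus ?thesis
      using D by blast
  qed
qed

text \<open>Weights do not accumulate from below, so their supremum is attained.\<close>

lemma exists_max_wt:
  assumes "X \<noteq> {}" "\<And>\<mu>. \<mu> \<in> X \<Longrightarrow> size \<mu> \<le> L \<and> (\<forall>k\<in>#\<mu>. K \<le> k)"
  obtains \<mu> where "\<mu> \<in> X" "\<And>\<nu>. \<nu> \<in> X \<Longrightarrow> wt q \<nu> \<le> wt q \<mu>"
proof -
  have "wt q \<mu> \<le> real L * real q powi (- K)" if "\<mu> \<in> X" for \<mu>
  proof -
    have "wt q \<mu> \<le> (\<Sum>k\<in>#\<mu>. real q powi (- K))"
      unfolding wt_def using assms(2)[OF that] q by (intro sum_mset_mono power_int_increasing) auto
    also have "\<dots> = real (size \<mu>) * real q powi (- K)"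
      by simp
    also have "\<dots> \<le> real L * real q powi (- K)"
      using assms(2)[OF that] powi_pos by (intro mult_right_mono) (auto intro: less_imp_le)
    finally show ?thesis .
  qed
  hence bdd: "bdd_above (wt q ` X)"
    by (rule bdd_aboveI2)
  define c where "c = (SUP \<mu>\<in>X. wt q \<mu>)"
  have le: "wt q \<mu> \<le> c" if "\<mu> \<in> X" for \<mu>
    unfolding c_def using that bdd by (rule cSUP_upper)
  obtain \<delta> where \<delta>: "\<delta> > 0"
    "\<And>\<mu>. size \<mu> \<le> L \<Longrightarrow> (\<forall>k\<in>#\<mu>. K \<le> k) \<Longrightarrow> \<not> (c - \<delta> < wt q \<mu> \<and> wt q \<mu> < c)"
    using wt_left_isolated[of L K c] by blast
  obtain \<mu> where \<mu>: "\<mu> \<in> X" "c - \<delta> < wt q \<mu>"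
    using less_cSUP_iff[OF assms(1) bdd, of "c - \<delta>"] \<delta>(1) by (auto simp: c_def)
  hence "wt q \<mu> = c"
    using \<delta>(2)[of \<mu>] assms(2)[of \<mu>] le[of \<mu>] by force
  thus ?thesis
    using that \<mu> le by blast
qed

subsection \<open>The largest exponent below 1 with given digit sum\<close>

primrec full :: "nat \<Rightarrow> int multiset" where
  "full 0 = {#}"
| "full (Suc j) = full j + replicate_mset (q - 1) (int (Suc j))"

lemma size_full: "size (full j) = j * (q - 1)"
  by (induction j) auto

lemma count_full: "count (full j) k = (if 1 \<le> k \<and> k \<le> int j then q - 1 else 0)"
  by (induction j) auto

lemma wt_full: "wt q (full j) = 1 - real q powi (- int j)"
proof (induction j)
  case (Suc j)
  have "real q powi (- int (Suc j)) = real q powi (- int j) / real q"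
    using q power_int_diff[of "real q" "- int j" 1]
    by (simp only: minus_add_distrib diff_conv_add_uminus of_nat_Suc add.commute[of 1]) simp
  thus ?case
    using Suc q by (simp add: wt_union wt_replicate of_nat_diff field_simps)
qed auto

definition nustar :: "nat \<Rightarrow> nat \<Rightarrow> int multiset" where
  "nustar m l = full (m - 1) + replicate_mset l (int m)"

lemma size_nustar: "size (nustar m l) = (m - 1) * (q - 1) + l"
  by (simp add: nustar_def size_full)

lemma reduced_nustar: "m \<ge> 1 \<Longrightarrow> l < q \<Longrightarrow> base_reduced q (nustar m l)"
  using q by (auto simp: base_reduced_def nustar_def count_full of_nat_diff)

lemma in_full: "k \<in># full j \<longleftrightarrow> 1 \<le> k \<and> k \<le> int j"
  using q by (simp add: count_full flip: count_greater_zero_iff)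

lemma in_nustar: "m \<ge> 1 \<Longrightarrow> k \<in># nustar m l \<Longrightarrow> 1 \<le> k \<and> k \<le> int m"
  by (auto simp: nustar_def in_full split: if_splits)

lemma wt_nustar: "m \<ge> 1 \<Longrightarrow> wt q (nustar m l) = 1 - real q powi (1 - int m) + real l * real q powi (- int m)"
  by (simp add: nustar_def wt_union wt_full wt_replicate of_nat_diff)

text \<open>Every entry is charged q^(-m). The excess \<open>f\<close> of an index over this charge
  is nonnegative below m and nonpositive from m on, so the best choice is to fill all indices below
  m with q - 1 entries each.\<close>

lemma wt_le_nustar:
  assumes "base_reduced q \<nu>" "\<And>k. k \<in># \<nu> \<Longrightarrow> 1 \<le> k" "size \<nu> \<le> size (nustar m l)" "m \<ge> 1"
  shows   "wt q \<nu> \<le> wt q (nustar m l)"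
proof -
  define f where "f = (\<lambda>k. real q powi (- k) - real q powi (- int m))"
  have shift: "wt q \<mu> = (\<Sum>k\<in>#\<mu>. f k) + real (size \<mu>) * real q powi (- int m)" for \<mu>
    by (induction \<mu>) (auto simp: f_def algebra_simps)
  have f_nonneg: "f k \<ge> 0" if "k \<le> int m" for k
    using that q by (simp add: f_def power_int_increasing)
  have f_nonpos: "f k \<le> 0" if "k \<ge> int m" for k
    using that q by (simp add: f_def power_int_increasing)
  have "(\<Sum>k\<in>#\<nu>. f k) = (\<Sum>k\<in>set_mset \<nu>. real (count \<nu> k) * f k)"
    by (intro sum_mset_conv_sum_count) auto
  also have "\<dots> \<le> (\<Sum>k\<in>set_mset \<nu> \<inter> {1..<int m}. real (count \<nu> k) * f k)"
    using assms(2) f_nonpos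
    by (intro sum_mono2[where f = "\<lambda>k. - (real (count \<nu> k) * f k)", unfolded sum_negf neg_le_iff_le])
       (auto intro: mult_nonneg_nonpos)
  also have "\<dots> \<le> (\<Sum>k\<in>set_mset \<nu> \<inter> {1..<int m}. real (q - 1) * f k)"
  proof (intro sum_mono mult_right_mono)
    fix k
    have "count \<nu> k < q"
      using assms(1) by (simp add: base_reduced_def)
    thus "real (count \<nu> k) \<le> real (q - 1)"
      by linarith
  qed (use f_nonneg in auto)
  also have "\<dots> \<le> (\<Sum>k\<in>{1..<int m}. real (q - 1) * f k)"
    using f_nonneg by (intro sum_mono2) auto
  also have "\<dots> = (\<Sum>k\<in>{1..<int m}. real (count (full (m - 1)) k) * f k)"
    using assms(4) by (intro sum.cong) (auto simp: count_full of_nat_diff)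
  also have "\<dots> = (\<Sum>k\<in>#full (m - 1). f k)"
    using assms(4) by (intro sum_mset_conv_sum_count[symmetric]) (auto simp: in_full of_nat_diff)
  also have "\<dots> = (\<Sum>k\<in>#nustar m l. f k)"
    by (simp add: nustar_def f_def)
  finally have "(\<Sum>k\<in>#\<nu>. f k) \<le> (\<Sum>k\<in>#nustar m l. f k)" .
  moreover have "real (size \<nu>) * real q powi (- int m) \<le> real (size (nustar m l)) * real q powi (- int m)"
    using assms(3) powi_pos by (intro mult_right_mono) (auto intro: less_imp_le)
  ultimately show ?thesis
    unfolding shift[of \<nu>] shift[of "nustar m l"] by linarith
qed

end

section \<open>Tame series\<close>

locale carlitz_gauss = carlitz \<iota> \<pi> q
  for \<iota> :: "'f::{finite,field} fls \<Rightarrow> 'c::complete_ultrametric_field" and \<pi> :: 'c and q :: nat +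
  fixes \<kappa> :: "'c \<Rightarrow> 'k::complete_ultrametric_field"
    and t :: "nat \<Rightarrow> 'k"
    and S :: "nat set"
  assumes gauss: "gauss_completion S \<kappa> t"
begin

sublocale kap: field_embed \<kappa>
  using gauss by unfold_locales (auto simp: gauss_completion_def)

lemma absval_kappa: "absval (\<kappa> c) = absval c"
proof -
  have "Poly_Mapping.single 0 c \<in> (mpolys S :: ((nat \<Rightarrow>\<^sub>0 nat) \<Rightarrow>\<^sub>0 'c) set)"
    by (auto simp: mpolys_def)
  hence "absval (mpoly_eval \<kappa> t (Poly_Mapping.single 0 c)) = gauss_norm (Poly_Mapping.single (0 :: nat \<Rightarrow>\<^sub>0 nat) c)"
    using gauss by (auto simp: gauss_completion_def)
  thus ?thesis
    by (cases "c = 0") (auto simp: mpoly_eval_def gauss_norm_def)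
qed

lemma tendsto_kappa:
  assumes "(f \<longlongrightarrow> l) F"
  shows   "((\<lambda>x. \<kappa> (f x)) \<longlongrightarrow> \<kappa> l) F"
  using assms unfolding tendsto_ultrametric_iff kap.emb_diff[symmetric] absval_kappa .

lemma has_sum_kappa:
  assumes "(f has_sum s) A"
  shows   "((\<lambda>x. \<kappa> (f x)) has_sum \<kappa> s) A"
  using tendsto_kappa[OF assms[unfolded has_sum_def]] unfolding has_sum_def kap.emb_sum .

subsection \<open>Monomials\<close>

definition em :: "int multiset \<Rightarrow> 'c \<Rightarrow> 'c" where
  "em \<mu> z = (\<Prod>k\<in>#\<mu>. E k z)"

text \<open>Measures decay: the size of \<open>em \<mu> z\<close> is at most a constant times
  \<open>qm \<mu>\<close>, uniformly over multisets of bounded size with indices bounded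
  below.\<close>

definition qm :: "int multiset \<Rightarrow> real" where
  "qm \<mu> = (\<Prod>k\<in>#\<mu>. real q powi (- k))"

lemma em_empty [simp]: "em {#} z = 1"
  and em_add_mset [simp]: "em (add_mset k \<mu>) z = E k z * em \<mu> z"
  and em_union: "em (\<mu> + \<nu>) z = em \<mu> z * em \<nu> z"
  by (simp_all add: em_def)

lemma qm_empty [simp]: "qm {#} = 1"
  and qm_add_mset [simp]: "qm (add_mset k \<mu>) = real q powi (- k) * qm \<mu>"
  and qm_union: "qm (\<mu> + \<nu>) = qm \<mu> * qm \<nu>"
  by (simp_all add: qm_def)

lemma q_powi_pos: "0 < real q powi k"
  by (rule powi_pos[OF q_ge_2])

lemma qm_pos: "0 < qm \<mu>"
  by (induction \<mu>) (auto intro: mult_pos_pos q_powi_pos)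

lemma qm_le:
  assumes "\<And>k. k \<in># \<mu> \<Longrightarrow> K \<le> k" "size \<mu> \<le> L" "D = max 1 (real q powi (- K))"
  shows   "qm \<mu> \<le> D ^ L"
proof -
  have "qm \<mu> \<le> D ^ size \<mu>"
    using assms(1)
  proof (induction \<mu>)
    case (add k \<mu>)
    have "real q powi (- k) \<le> real q powi (- K)"
      using add.prems real_q_gt_1 by (intro power_int_increasing) auto
    hence "real q powi (- k) \<le> D"
      by (simp add: assms(3))
    thus ?case
      using add qm_pos[of \<mu>] q_powi_pos[of "-k"] by (auto intro!: mult_mono simp: less_imp_le)
  qed auto
  also have "\<dots> \<le> D ^ L"
    using assms by (intro power_increasing) auto
  finally show ?thesis .
qed

text \<open>A large index makes its own factor tiny, while the other factors contribute at most
  \<open>D ^ L\<close>. So the indices are bounded above as well as below.\<close>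

lemma finite_qm_ge:
  assumes "e > 0"
  shows   "finite {\<mu>. size \<mu> \<le> L \<and> (\<forall>k\<in>#\<mu>. K \<le> k) \<and> e \<le> qm \<mu>}"
proof -
  define D where "D = max 1 (real q powi (- K))"
  have D: "D \<ge> 1"
    by (simp add: D_def)
  obtain n where n: "D ^ L / e < real q ^ n"
    using real_arch_pow[OF real_q_gt_1] by blast
  have "k \<le> int n" if \<mu>: "size \<mu> \<le> L" "\<forall>k\<in>#\<mu>. K \<le> k" "e \<le> qm \<mu>" and k: "k \<in># \<mu>" for \<mu> k
  proof (rule ccontr)
    assume kn: "\<not> k \<le> int n"
    define \<nu> where "\<nu> = \<mu> - {#k#}"
    have eq: "\<mu> = add_mset k \<nu>"
      using k by (simp add: \<nu>_def)
    have "qm \<nu> \<le> D ^ L"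
      using \<mu> by (intro qm_le[of _ K]) (auto simp: eq D_def)
    have "real q powi (- k) \<le> real q powi (- int n)"
      using kn real_q_gt_1 by (intro power_int_increasing) auto
    hence "real q powi (- k) * qm \<nu> \<le> real q powi (- int n) * D ^ L"
      using \<open>qm \<nu> \<le> _\<close> qm_pos[of \<nu>] q_powi_pos by (intro mult_mono) (auto intro: less_imp_le)
    also have "\<dots> < e"
      using n assms real_q_pos by (simp add: power_int_minus field_simps)
    finally show False
      using \<mu>(3) by (simp add: eq)
  qed
  hence "{\<mu>. size \<mu> \<le> L \<and> (\<forall>k\<in>#\<mu>. K \<le> k) \<and> e \<le> qm \<mu>}
      \<subseteq> {\<mu>. size \<mu> \<le> L \<and> set_mset \<mu> \<subseteq> {K..int n}}"
    by auto
  thus ?thesis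
    by (rule finite_subset) (intro finite_multisets_le, simp)
qed

lemma em_bound: "\<exists>C\<ge>1. \<forall>\<mu>. (\<forall>k\<in>#\<mu>. K \<le> k) \<longrightarrow> size \<mu> \<le> L \<longrightarrow> absval (em \<mu> z) \<le> C * qm \<mu>"
proof -
  obtain C where C: "C \<ge> 1" "\<And>k. k \<ge> K \<Longrightarrow> absval (E k z) \<le> C * real q powi (- k)"
    using E_bound by blast
  have *: "absval (em \<mu> z) \<le> C ^ size \<mu> * qm \<mu>" if "\<forall>k\<in>#\<mu>. K \<le> k" for \<mu>
    using that
  proof (induction \<mu>)
    case (add k \<mu>)
    have "absval (E k z) * absval (em \<mu> z) \<le> (C * real q powi (- k)) * (C ^ size \<mu> * qm \<mu>)"
      using add C q_powi_pos[of "- k"] by (intro mult_mono) auto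
    thus ?case by (simp add: absval_mult mult_ac)
  qed auto
  have "absval (em \<mu> z) \<le> C ^ L * qm \<mu>" if "\<forall>k\<in>#\<mu>. K \<le> k" "size \<mu> \<le> L" for \<mu>
  proof -
    have "C ^ size \<mu> * qm \<mu> \<le> C ^ L * qm \<mu>"
      using C that qm_pos[of \<mu>] by (intro mult_right_mono power_increasing) auto
    thus ?thesis using *[of \<mu>] that by simp
  qed
  thus ?thesis
    using C(1) by (intro exI[of _ "C ^ L"]) auto
qed

lemma finite_em_ge:
  assumes "e > 0"
  shows   "finite {\<mu>. size \<mu> \<le> L \<and> (\<forall>k\<in>#\<mu>. K \<le> k) \<and> e \<le> absval (em \<mu> z)}"
proof -
  obtain C where C: "C \<ge> 1" "\<And>\<mu>. (\<forall>k\<in>#\<mu>. K \<le> k) \<Longrightarrow> size \<mu> \<le> L \<Longrightarrow> absval (em \<mu> z) \<le> C * qm \<mu>"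
    using em_bound[of K L z] by blast
  have "e / C \<le> qm \<mu>" if "size \<mu> \<le> L" "\<forall>k\<in>#\<mu>. K \<le> k" "e \<le> absval (em \<mu> z)" for \<mu>
    using C(2)[of \<mu>] C(1) that by (simp add: field_simps)
  hence "{\<mu>. size \<mu> \<le> L \<and> (\<forall>k\<in>#\<mu>. K \<le> k) \<and> e \<le> absval (em \<mu> z)}
      \<subseteq> {\<mu>. size \<mu> \<le> L \<and> (\<forall>k\<in>#\<mu>. K \<le> k) \<and> e / C \<le> qm \<mu>}"
    by blast
  thus ?thesis
    by (rule finite_subset[OF _ finite_qm_ge]) (use assms C(1) in simp)
qed

subsection \<open>Expansions indexed by multisets\<close>

definition bsupp :: "nat \<Rightarrow> int \<Rightarrow> (int multiset \<Rightarrow> 'k) \<Rightarrow> bool" where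
  "bsupp L K G \<longleftrightarrow> (\<forall>\<mu>. G \<mu> \<noteq> 0 \<longrightarrow> size \<mu> \<le> L \<and> (\<forall>k\<in>#\<mu>. K \<le> k))"

text \<open>An analogue of \<open>tame_expansion\<close> in which the multisets need not be reduced,
  so that products and regroupings stay inside the notion; reduction is done once, in
  \<open>reduce_expansion\<close>. The lower bound on the indices takes the place of the upper bound
  on the exponents.\<close>

definition mrep :: "('c \<Rightarrow> 'k) \<Rightarrow> (int multiset \<Rightarrow> 'k) \<Rightarrow> bool" where
  "mrep f G \<longleftrightarrow> (\<exists>L K. bsupp L K G) \<and> (\<exists>B. \<forall>\<mu>. absval (G \<mu>) \<le> B) \<and>
     (\<forall>z. ((\<lambda>\<mu>. G \<mu> * \<kappa> (em \<mu> z)) has_sum f z) UNIV)"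

lemma exists_max_supp:
  assumes "bsupp L K G" "G \<mu>' \<noteq> 0"
  obtains \<mu> where "G \<mu> \<noteq> 0" "\<And>\<nu>. G \<nu> \<noteq> 0 \<Longrightarrow> wt q \<nu> \<le> wt q \<mu>"
proof -
  have ne: "{\<mu>. G \<mu> \<noteq> 0} \<noteq> {}"
    using assms(2) by auto
  have bd: "size \<mu> \<le> L \<and> (\<forall>k\<in>#\<mu>. K \<le> k)" if "\<mu> \<in> {\<mu>. G \<mu> \<noteq> 0}" for \<mu>
    using assms(1) that by (auto simp: bsupp_def)
  obtain \<mu> where \<mu>: "\<mu> \<in> {\<mu>. G \<mu> \<noteq> 0}"
    and max: "\<And>\<nu>. \<nu> \<in> {\<mu>. G \<mu> \<noteq> 0} \<Longrightarrow> wt q \<nu> \<le> wt q \<mu>"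
    using exists_max_wt[OF q_ge_2 ne bd] by metis
  show ?thesis
    using that[of \<mu>] \<mu> max by simp
qed

lemma mrep_has_sum: "mrep f G \<Longrightarrow> ((\<lambda>\<mu>. G \<mu> * \<kappa> (em \<mu> z)) has_sum f z) UNIV"
  by (simp add: mrep_def)

lemma mrepE:
  assumes "mrep f G"
  obtains L K B where "bsupp L K G" "B \<ge> 1" "\<And>\<mu>. absval (G \<mu>) \<le> B"
proof -
  obtain L K B where "bsupp L K G" "\<And>\<mu>. absval (G \<mu>) \<le> B"
    using assms by (auto simp: mrep_def)
  thus ?thesis
    using that[of L K "max 1 B"] by (metis max.cobounded1 max.coboundedI2)
qed

text \<open>Only finitely many monomials of bounded size exceed a given value, and each of them is
  taken by finitely many indices.\<close>

lemma finite_fibre_family: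
  assumes "\<And>i. i \<in> I \<Longrightarrow> size (\<mu> i) \<le> L \<and> (\<forall>k\<in>#\<mu> i. K \<le> k)"
    and "\<And>i. i \<in> I \<Longrightarrow> absval (c i) \<le> B" "B > 0"
    and fin: "\<And>\<nu>. finite {i\<in>I. \<mu> i = \<nu>}"
    and e: "e > 0"
  shows "finite {i\<in>I. e \<le> absval (c i * \<kappa> (em (\<mu> i) z))}"
proof (rule finite_subset)
  let ?M = "{\<mu>. size \<mu> \<le> L \<and> (\<forall>k\<in>#\<mu>. K \<le> k) \<and> e / B \<le> absval (em \<mu> z)}"
  show "{i\<in>I. e \<le> absval (c i * \<kappa> (em (\<mu> i) z))} \<subseteq> (\<Union>\<nu>\<in>?M. {i\<in>I. \<mu> i = \<nu>})"
  proof safe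
    fix i assume i: "i \<in> I" "e \<le> absval (c i * \<kappa> (em (\<mu> i) z))"
    have "absval (c i) * absval (em (\<mu> i) z) \<le> B * absval (em (\<mu> i) z)"
      using assms(2) i by (intro mult_right_mono) auto
    hence "e / B \<le> absval (em (\<mu> i) z)"
      using i assms(3) by (simp add: absval_mult absval_kappa field_simps)
    thus "i \<in> (\<Union>\<nu>\<in>?M. {i\<in>I. \<mu> i = \<nu>})"
      using assms(1)[of i] i by auto
  qed
  show "finite (\<Union>\<nu>\<in>?M. {i\<in>I. \<mu> i = \<nu>})"
    using e assms(3) by (intro finite_UN_I finite_em_ge fin) auto
qed

lemma mrep_finite:
  assumes "bsupp L K G" "\<And>\<mu>. absval (G \<mu>) \<le> B" "B > 0" "e > 0"
  shows   "finite {\<mu>. e \<le> absval (G \<mu> * \<kappa> (em \<mu> z))}"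
proof -
  have "{\<mu>. e \<le> absval (G \<mu> * \<kappa> (em \<mu> z))} \<subseteq> {\<mu>\<in>{\<mu>. G \<mu> \<noteq> 0}. e \<le> absval (G \<mu> * \<kappa> (em \<mu> z))}"
    using assms(4) by auto
  also have "finite \<dots>"
    using assms by (intro finite_fibre_family[where \<mu> = "\<lambda>\<mu>. \<mu>" and L = L and K = K and B = B])
      (auto simp: bsupp_def)
  finally (finite_subset) show ?thesis .
qed

text \<open>Collects the terms with equal monomial. The fibres may be infinite, hence the inner
  infinite sums.\<close>

lemma mrep_family:
  assumes supp: "\<And>i. i \<in> I \<Longrightarrow> size (\<mu> i) \<le> L \<and> (\<forall>k\<in>#\<mu> i. K \<le> k)"
    and bdd: "\<And>i. i \<in> I \<Longrightarrow> absval (c i) \<le> B" "B \<ge> 0"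
    and sum: "\<And>z. ((\<lambda>i. c i * \<kappa> (em (\<mu> i) z)) has_sum f z) I"
    and fibre: "\<And>\<nu>. c summable_on {i\<in>I. \<mu> i = \<nu>}"
  shows "mrep f (\<lambda>\<nu>. \<Sum>\<^sub>\<infinity>i\<in>{i\<in>I. \<mu> i = \<nu>}. c i)"
  unfolding mrep_def
proof (intro conjI allI)
  let ?G = "\<lambda>\<nu>. \<Sum>\<^sub>\<infinity>i\<in>{i\<in>I. \<mu> i = \<nu>}. c i"
  have G: "(c has_sum ?G \<nu>) {i\<in>I. \<mu> i = \<nu>}" for \<nu>
    using fibre by (rule has_sum_infsum)
  have "bsupp L K ?G"
    unfolding bsupp_def
  proof (intro allI impI)
    fix \<nu> assume "?G \<nu> \<noteq> 0"
    hence "{i\<in>I. \<mu> i = \<nu>} \<noteq> {}"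
      by (metis infsum_empty)
    thus "size \<nu> \<le> L \<and> (\<forall>k\<in>#\<nu>. K \<le> k)"
      using supp by auto
  qed
  thus "\<exists>L K. bsupp L K ?G"
    by blast
  show "\<exists>B. \<forall>\<nu>. absval (?G \<nu>) \<le> B"
    using has_sum_absval_le[OF G] bdd by (intro exI[of _ B]) auto
  fix z
  have "bij_betw snd (Sigma UNIV (\<lambda>\<nu>. {i\<in>I. \<mu> i = \<nu>})) I"
    by (auto simp: bij_betw_def inj_on_def image_iff)
  hence "((\<lambda>x. c (snd x) * \<kappa> (em (\<mu> (snd x)) z)) has_sum f z) (Sigma UNIV (\<lambda>\<nu>. {i\<in>I. \<mu> i = \<nu>}))"
    using sum[of z] by (subst has_sum_reindex_bij_betw) auto
  thus "((\<lambda>\<nu>. ?G \<nu> * \<kappa> (em \<nu> z)) has_sum f z) UNIV"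
  proof (rule has_sum_SigmaD)
    fix \<nu>
    have "((\<lambda>i. c i * \<kappa> (em \<nu> z)) has_sum (?G \<nu> * \<kappa> (em \<nu> z))) {i\<in>I. \<mu> i = \<nu>}"
      by (rule has_sum_cmult_left[OF G])
    also have "?this \<longleftrightarrow> ((\<lambda>i. c (snd (\<nu>, i)) * \<kappa> (em (\<mu> (snd (\<nu>, i))) z)) has_sum (?G \<nu> * \<kappa> (em \<nu> z))) {i\<in>I. \<mu> i = \<nu>}"
      by (intro has_sum_cong) auto
    finally show "((\<lambda>i. c (snd (\<nu>, i)) * \<kappa> (em (\<mu> (snd (\<nu>, i))) z)) has_sum (?G \<nu> * \<kappa> (em \<nu> z))) {i\<in>I. \<mu> i = \<nu>}" .
  qed
qed

lemma mrep_add: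
  assumes "mrep f F" "mrep g G"
  shows   "mrep (\<lambda>z. f z + g z) (\<lambda>\<mu>. F \<mu> + G \<mu>)"
proof -
  obtain L K B where 1: "bsupp L K F" "\<And>\<mu>. absval (F \<mu>) \<le> B"
    using mrepE[OF assms(1)] by metis
  obtain L' K' B' where 2: "bsupp L' K' G" "\<And>\<mu>. absval (G \<mu>) \<le> B'"
    using mrepE[OF assms(2)] by metis
  have "bsupp (max L L') (min K K') (\<lambda>\<mu>. F \<mu> + G \<mu>)"
    unfolding bsupp_def
  proof (intro allI impI)
    fix \<mu> assume "F \<mu> + G \<mu> \<noteq> 0"
    hence "F \<mu> \<noteq> 0 \<or> G \<mu> \<noteq> 0"
      by auto
    thus "size \<mu> \<le> max L L' \<and> (\<forall>k\<in>#\<mu>. min K K' \<le> k)"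
      using 1(1) 2(1) unfolding bsupp_def by (force simp: le_max_iff_disj min_le_iff_disj)
  qed
  moreover have "absval (F \<mu> + G \<mu>) \<le> max B B'" for \<mu>
    using absval_add_le[of "F \<mu>" "G \<mu>"] 1(2)[of \<mu>] 2(2)[of \<mu>] by auto
  ultimately show ?thesis
    unfolding mrep_def
    using has_sum_add[OF mrep_has_sum[OF assms(1)] mrep_has_sum[OF assms(2)]]
    by (auto simp: distrib_right)
qed

lemma mrep_cmult:
  assumes "mrep f F"
  shows   "mrep (\<lambda>z. c * f z) (\<lambda>\<mu>. c * F \<mu>)"
proof -
  obtain L K B where 1: "bsupp L K F" "\<And>\<mu>. absval (F \<mu>) \<le> B"
    using mrepE[OF assms(1)] by metis
  have "bsupp L K (\<lambda>\<mu>. c * F \<mu>)"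
    using 1 by (auto simp: bsupp_def)
  moreover have "absval (c * F \<mu>) \<le> absval c * B" for \<mu>
    using 1(2) by (simp add: absval_mult mult_left_mono)
  ultimately show ?thesis
    unfolding mrep_def
    using has_sum_cmult_right[OF mrep_has_sum[OF assms(1)], of c]
    by (auto simp: mult.assoc)
qed

lemma mrep_diff:
  assumes "mrep f F" "mrep g G"
  shows   "mrep (\<lambda>z. f z - g z) (\<lambda>\<mu>. F \<mu> - G \<mu>)"
  using mrep_add[OF assms(1) mrep_cmult[OF assms(2), of "-1"]] by simp

lemma mrep_monomial: "mrep (\<lambda>z. \<kappa> (em \<mu> z)) (\<lambda>\<nu>. if \<nu> = \<mu> then 1 else 0)"
  unfolding mrep_def
proof (intro conjI allI)
  have "bsupp (size \<mu>) (Min (insert 0 (set_mset \<mu>))) (\<lambda>\<nu>. if \<nu> = \<mu> then 1 else 0)"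
    by (auto simp: bsupp_def)
  thus "\<exists>L K. bsupp L K (\<lambda>\<nu>. if \<nu> = \<mu> then 1 else 0)"
    by blast
  show "\<exists>B. \<forall>\<nu>. absval (if \<nu> = \<mu> then 1 else 0 :: 'k) \<le> B"
    by (intro exI[of _ 1]) auto
  fix z
  have "((\<lambda>\<nu>. (if \<nu> = \<mu> then 1 else 0) * \<kappa> (em \<nu> z)) has_sum \<kappa> (em \<mu> z)) {\<mu>}"
    using has_sum_finite[of "{\<mu>}" "\<lambda>\<nu>. (if \<nu> = \<mu> then 1 else 0) * \<kappa> (em \<nu> z)"] by simp
  thus "((\<lambda>\<nu>. (if \<nu> = \<mu> then 1 else 0) * \<kappa> (em \<nu> z)) has_sum \<kappa> (em \<mu> z)) UNIV"
    by (rule iffD1[OF has_sum_cong_neutral, rotated -1]) auto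
qed

lemma mrep_mult:
  assumes "mrep f F" "mrep g G"
  shows   "\<exists>H. mrep (\<lambda>z. f z * g z) H"
proof -
  obtain L K B where 1: "bsupp L K F" "B \<ge> 1" "\<And>\<mu>. absval (F \<mu>) \<le> B"
    using mrepE[OF assms(1)] by metis
  obtain L' K' B' where 2: "bsupp L' K' G" "B' \<ge> 1" "\<And>\<mu>. absval (G \<mu>) \<le> B'"
    using mrepE[OF assms(2)] by metis
  define I where "I = {\<mu>. F \<mu> \<noteq> 0} \<times> {\<mu>. G \<mu> \<noteq> 0}"
  define c where "c = (\<lambda>(\<alpha>, \<beta>). F \<alpha> * G \<beta>)"
  define \<mu> where "\<mu> = (\<lambda>(\<alpha>, \<beta>). \<alpha> + \<beta> :: int multiset)"
  have A: "size (\<mu> i) \<le> L + L' \<and> (\<forall>k\<in>#\<mu> i. min K K' \<le> k)" if "i \<in> I" for i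
    using that 1(1) 2(1) unfolding I_def \<mu>_def bsupp_def by (fastforce simp: min_le_iff_disj)
  have B: "absval (c i) \<le> B * B'" for i
    using 1 2 by (cases i) (auto simp: c_def absval_mult intro!: mult_mono order_trans[OF absval_nonneg])
  \<comment> \<open>Both summands of \<open>\<nu>\<close> are sub-multisets of it.\<close>
  have C: "finite {i\<in>I. \<mu> i = \<nu>}" for \<nu>
  proof -
    have "finite {\<alpha>. size \<alpha> \<le> size \<nu> \<and> set_mset \<alpha> \<subseteq> set_mset \<nu>}"
      by (rule finite_multisets_le) auto
    moreover have "{i\<in>I. \<mu> i = \<nu>} \<subseteq> {\<alpha>. size \<alpha> \<le> size \<nu> \<and> set_mset \<alpha> \<subseteq> set_mset \<nu>}
        \<times> {\<alpha>. size \<alpha> \<le> size \<nu> \<and> set_mset \<alpha> \<subseteq> set_mset \<nu>}"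
      by (auto simp: \<mu>_def)
    ultimately show ?thesis
      by (meson finite_SigmaI finite_subset)
  qed
  have "1 * 1 \<le> B * B'"
    using 1 2 by (intro mult_mono) auto
  hence BB: "B * B' > 0"
    by simp
  have fin: "finite {i\<in>I. e \<le> absval (c i * \<kappa> (em (\<mu> i) z))}" if "e > 0" for e z
    using A B BB C that by (rule finite_fibre_family)
  have "((\<lambda>i. c i * \<kappa> (em (\<mu> i) z)) has_sum (f z * g z)) I" for z
    unfolding I_def
  proof (rule has_sum_SigmaI)
    fix \<alpha>
    have "((\<lambda>\<beta>. G \<beta> * \<kappa> (em \<beta> z)) has_sum g z) {\<mu>. G \<mu> \<noteq> 0}"
      using mrep_has_sum[OF assms(2), of z] by (rule iffD1[OF has_sum_cong_neutral, rotated -1]) auto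
    from has_sum_cmult_right[OF this, of "F \<alpha> * \<kappa> (em \<alpha> z)"]
    show "((\<lambda>\<beta>. c (\<alpha>, \<beta>) * \<kappa> (em (\<mu> (\<alpha>, \<beta>)) z)) has_sum (F \<alpha> * \<kappa> (em \<alpha> z) * g z)) {\<mu>. G \<mu> \<noteq> 0}"
      by (simp add: c_def \<mu>_def em_union kap.emb_mult mult_ac)
  next
    have "((\<lambda>\<beta>. F \<beta> * \<kappa> (em \<beta> z)) has_sum f z) {\<mu>. F \<mu> \<noteq> 0}"
      using mrep_has_sum[OF assms(1), of z] by (rule iffD1[OF has_sum_cong_neutral, rotated -1]) auto
    thus "((\<lambda>\<alpha>. F \<alpha> * \<kappa> (em \<alpha> z) * g z) has_sum (f z * g z)) {\<mu>. F \<mu> \<noteq> 0}"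
      by (rule has_sum_cmult_left)
    show "(\<lambda>i. c i * \<kappa> (em (\<mu> i) z)) summable_on {\<mu>. F \<mu> \<noteq> 0} \<times> {\<mu>. G \<mu> \<noteq> 0}"
      using fin by (intro summable_on_ultrametricI) (auto simp: I_def)
  qed
  moreover have "c summable_on {i\<in>I. \<mu> i = \<nu>}" for \<nu>
    using C by (rule summable_on_finite)
  ultimately show ?thesis
    using mrep_family[of I \<mu> "L + L'" "min K K'" c "B * B'" "\<lambda>z. f z * g z"] A B BB
    by (auto intro: less_imp_le)
qed

subsection \<open>Reduction of digits\<close>

text \<open>
  A monomial containing \<open>e\<^sub>k\<^sup>q\<close> is rewritten with \<open>e\<^sub>k\<^sup>q = e\<^sub>k\<^sub>-\<^sub>1 - \<theta> e\<^sub>k\<close>, which lowers its degree by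
  \<open>q - 1\<close>.  So coefficients in the top degree are not affected.
\<close>

lemma reduce_expansion:
  assumes "mrep f G" "\<And>\<mu>. G \<mu> \<noteq> 0 \<Longrightarrow> size \<mu> \<le> L"
  shows   "\<exists>F. mrep f F \<and> (\<forall>\<mu>. F \<mu> \<noteq> 0 \<longrightarrow> base_reduced q \<mu> \<and> size \<mu> \<le> L) \<and>
             (\<forall>\<mu>. base_reduced q \<mu> \<longrightarrow> size \<mu> = L \<longrightarrow> F \<mu> = G \<mu>)"
  using assms
proof (induction L arbitrary: f G rule: less_induct)
  case (less L f G)
  obtain L0 K B where G: "bsupp L0 K G" "B \<ge> 1" "\<And>\<mu>. absval (G \<mu>) \<le> B"
    using mrepE[OF less.prems(1)] by metis
  have GK: "size \<mu> \<le> L" "k \<in># \<mu> \<Longrightarrow> K \<le> k" if "G \<mu> \<noteq> 0" for \<mu> k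
    using that G(1) less.prems(2) by (auto simp: bsupp_def)
  define I where "I = {\<mu>. G \<mu> \<noteq> 0 \<and> \<not> base_reduced q \<mu>}"
  show ?case
  proof (cases "I = {}")
    case True
    thus ?thesis
      using less.prems by (intro exI[of _ G]) (auto simp: I_def)
  next
    case False
    define kk :: "int multiset \<Rightarrow> int" where "kk = (\<lambda>\<mu>. SOME k. q \<le> count \<mu> k)"
    define \<rho> where "\<rho> = (\<lambda>\<mu>. \<mu> - replicate_mset q (kk \<mu>))"
    have \<rho>: "\<mu> = replicate_mset q (kk \<mu>) + \<rho> \<mu>" if "\<mu> \<in> I" for \<mu>
    proof -
      have "\<exists>k. q \<le> count \<mu> k"
        using that by (auto simp: I_def base_reduced_def not_less)
      hence "q \<le> count \<mu> (kk \<mu>)"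
        unfolding kk_def by (rule someI_ex)
      hence "replicate_mset q (kk \<mu>) \<subseteq># \<mu>"
        by (rule iffD1[OF count_le_replicate_mset_subset_eq])
      thus ?thesis
        by (simp add: \<rho>_def subset_mset.add_diff_inverse)
    qed
    have kkin: "kk \<mu> \<in># \<mu>" if "\<mu> \<in> I" for \<mu>
      using q_gt_0 by (subst \<rho>[OF that]) auto
    have size: "size (\<rho> \<mu>) + q = size \<mu>" if "\<mu> \<in> I" for \<mu>
      using arg_cong[OF \<rho>[OF that], of size] by simp
    define L' where "L' = L - (q - 1)"
    have Lq: "q \<le> L"
    proof -
      from False obtain \<mu> where "\<mu> \<in> I" by blast
      thus ?thesis using size[of \<mu>] GK(1)[of \<mu>] by (auto simp: I_def)
    qed
    have L': "L' < L" "L = L' + (q - 1)"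
      using Lq q_gt_1 by (auto simp: L'_def)
    define \<alpha> where "\<alpha> = (\<lambda>\<mu>. add_mset (kk \<mu> - 1) (\<rho> \<mu>))"
    define \<beta> where "\<beta> = (\<lambda>\<mu>. add_mset (kk \<mu>) (\<rho> \<mu>))"
    have em: "em \<mu> z = em (\<alpha> \<mu>) z - \<theta> * em (\<beta> \<mu>) z" if "\<mu> \<in> I" for \<mu> z
    proof -
      have "em (replicate_mset n k) z = E k z ^ n" for n k
        by (induction n) auto
      hence "em \<mu> z = E (kk \<mu>) z ^ q * em (\<rho> \<mu>) z"
        by (subst \<rho>[OF that]) (simp add: em_union)
      also have "E (kk \<mu>) z ^ q = E (kk \<mu> - 1) z - \<theta> * E (kk \<mu>) z"
        by (simp add: E_pred)
      finally show ?thesis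
        by (simp add: \<alpha>_def \<beta>_def algebra_simps)
    qed
    have sub: "k \<in># \<rho> \<mu> \<Longrightarrow> k \<in># \<mu>" for k \<mu>
      by (auto simp: \<rho>_def dest: in_diffD)
    have A: "size (\<alpha> \<mu>) \<le> L' \<and> (\<forall>k\<in>#\<alpha> \<mu>. K - 1 \<le> k)"
         "size (\<beta> \<mu>) \<le> L' \<and> (\<forall>k\<in>#\<beta> \<mu>. K - 1 \<le> k)" if "\<mu> \<in> I" for \<mu>
    proof -
      have "G \<mu> \<noteq> 0"
        using that by (auto simp: I_def)
      from GK[OF this] show "size (\<alpha> \<mu>) \<le> L' \<and> (\<forall>k\<in>#\<alpha> \<mu>. K - 1 \<le> k)"
         "size (\<beta> \<mu>) \<le> L' \<and> (\<forall>k\<in>#\<beta> \<mu>. K - 1 \<le> k)"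
        using size[OF that] kkin[OF that] sub[of _ \<mu>] L' by (fastforce simp: \<alpha>_def \<beta>_def)+
    qed
    have B: "absval (G \<mu>) \<le> B" for \<mu>
      by (rule G(3))
    have B0: "B > 0"
      using G(2) by simp
    \<comment> \<open>A multiset of \<open>I\<close> can be recovered from its image and the index
      at which the carry took place.\<close>
    have C\<alpha>: "finite {\<mu>\<in>I. \<alpha> \<mu> = \<nu>}" for \<nu>
    proof (rule finite_subset)
      show "{\<mu>\<in>I. \<alpha> \<mu> = \<nu>} \<subseteq> (\<lambda>k. replicate_mset q (k + 1) + (\<nu> - {#k#})) ` set_mset \<nu>"
      proof safe
        fix \<mu> assume "\<mu> \<in> I"
        thus "\<mu> \<in> (\<lambda>k. replicate_mset q (k + 1) + (\<alpha> \<mu> - {#k#})) ` set_mset (\<alpha> \<mu>)"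
          using \<rho> by (intro image_eqI[of _ _ "kk \<mu> - 1"]) (auto simp: \<alpha>_def)
      qed
    qed auto
    have C\<beta>: "finite {\<mu>\<in>I. \<beta> \<mu> = \<nu>}" for \<nu>
    proof (rule finite_subset)
      show "{\<mu>\<in>I. \<beta> \<mu> = \<nu>} \<subseteq> (\<lambda>k. replicate_mset q k + (\<nu> - {#k#})) ` set_mset \<nu>"
      proof safe
        fix \<mu> assume "\<mu> \<in> I"
        thus "\<mu> \<in> (\<lambda>k. replicate_mset q k + (\<beta> \<mu> - {#k#})) ` set_mset (\<beta> \<mu>)"
          using \<rho> by (intro image_eqI[of _ _ "kk \<mu>"]) (auto simp: \<beta>_def)
      qed
    qed auto
    have summable: "(\<lambda>\<mu>. G \<mu> * \<kappa> (em (\<alpha> \<mu>) z)) summable_on I" "(\<lambda>\<mu>. G \<mu> * \<kappa> (em (\<beta> \<mu>) z)) summable_on I" for z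
      by (rule summable_on_ultrametricI, rule finite_fibre_family[OF A(1) B B0 C\<alpha>], assumption+)
         (rule summable_on_ultrametricI, rule finite_fibre_family[OF A(2) B B0 C\<beta>], assumption+)
    define fa where "fa = (\<lambda>z. \<Sum>\<^sub>\<infinity>\<mu>\<in>I. G \<mu> * \<kappa> (em (\<alpha> \<mu>) z))"
    define fb where "fb = (\<lambda>z. \<Sum>\<^sub>\<infinity>\<mu>\<in>I. G \<mu> * \<kappa> (em (\<beta> \<mu>) z))"
    have fa: "((\<lambda>\<mu>. G \<mu> * \<kappa> (em (\<alpha> \<mu>) z)) has_sum fa z) I"
      and fb: "((\<lambda>\<mu>. G \<mu> * \<kappa> (em (\<beta> \<mu>) z)) has_sum fb z) I" for z
      using summable unfolding fa_def fb_def by (auto intro: has_sum_infsum)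
    define Ga where "Ga = (\<lambda>\<nu>. \<Sum>\<^sub>\<infinity>\<mu>\<in>{\<mu>\<in>I. \<alpha> \<mu> = \<nu>}. G \<mu>)"
    define Gb where "Gb = (\<lambda>\<nu>. \<Sum>\<^sub>\<infinity>\<mu>\<in>{\<mu>\<in>I. \<beta> \<mu> = \<nu>}. G \<mu>)"
    have Ga: "mrep fa Ga"
      unfolding Ga_def using A(1) B less_imp_le[OF B0] fa summable_on_finite[OF C\<alpha>] by (rule mrep_family)
    have Gb: "mrep fb Gb"
      unfolding Gb_def using A(2) B less_imp_le[OF B0] fb summable_on_finite[OF C\<beta>] by (rule mrep_family)
    define G2 where "G2 = (\<lambda>\<nu>. Ga \<nu> - \<kappa> \<theta> * Gb \<nu>)"
    define f2 where "f2 = (\<lambda>z. fa z - \<kappa> \<theta> * fb z)"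
    have G2: "mrep f2 G2"
      unfolding G2_def f2_def by (intro mrep_diff mrep_cmult Ga Gb)
    have "size \<nu> \<le> L'" if "G2 \<nu> \<noteq> 0" for \<nu>
    proof (rule ccontr)
      assume *: "\<not> ?thesis"
      hence "{\<mu>\<in>I. \<alpha> \<mu> = \<nu>} = {}" "{\<mu>\<in>I. \<beta> \<mu> = \<nu>} = {}"
        using A by auto
      hence "Ga \<nu> = 0" "Gb \<nu> = 0"
        unfolding Ga_def Gb_def by (metis infsum_empty)+
      thus False
        using that by (simp add: G2_def)
    qed
    from less.IH[OF L'(1) G2 this] obtain F2 where F2: "mrep f2 F2"
      "\<And>\<mu>. F2 \<mu> \<noteq> 0 \<Longrightarrow> base_reduced q \<mu> \<and> size \<mu> \<le> L'"
      by blast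
    \<comment> \<open>The reduced part of \<open>G\<close> is kept as it is. The rest sums to
      \<open>f2\<close>, whose expansion has size at most L' < L, so the induction hypothesis
      handles it without touching size L.\<close>
    define G1 where "G1 = (\<lambda>\<mu>. if base_reduced q \<mu> then G \<mu> else 0)"
    have G1: "mrep (\<lambda>z. f z - f2 z) G1"
      unfolding mrep_def
    proof (intro conjI allI)
      have "bsupp L0 K G1"
        using G(1) by (auto simp: bsupp_def G1_def)
      thus "\<exists>L K. bsupp L K G1" by blast
      have "absval (G1 \<mu>) \<le> B" for \<mu>
        using G(2,3) by (simp add: G1_def)
      thus "\<exists>B. \<forall>\<mu>. absval (G1 \<mu>) \<le> B" by blast
      fix z
      have "((\<lambda>\<mu>. G \<mu> * \<kappa> (em (\<alpha> \<mu>) z) + - (\<kappa> \<theta> * (G \<mu> * \<kappa> (em (\<beta> \<mu>) z)))) has_sum (fa z + - (\<kappa> \<theta> * fb z))) I"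
        by (intro has_sum_add has_sum_uminusI has_sum_cmult_right fa fb)
      also have "fa z + - (\<kappa> \<theta> * fb z) = f2 z"
        by (simp add: f2_def)
      also have "((\<lambda>\<mu>. G \<mu> * \<kappa> (em (\<alpha> \<mu>) z) + - (\<kappa> \<theta> * (G \<mu> * \<kappa> (em (\<beta> \<mu>) z)))) has_sum f2 z) I
          \<longleftrightarrow> ((\<lambda>\<mu>. (if \<mu> \<in> I then G \<mu> else 0) * \<kappa> (em \<mu> z)) has_sum f2 z) UNIV"
        by (rule has_sum_cong_neutral) (auto simp: em kap.emb_diff kap.emb_mult algebra_simps)
      finally have "((\<lambda>\<mu>. G \<mu> * \<kappa> (em \<mu> z) + - ((if \<mu> \<in> I then G \<mu> else 0) * \<kappa> (em \<mu> z))) has_sum (f z + - f2 z)) UNIV"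
        by (intro has_sum_add has_sum_uminusI mrep_has_sum[OF less.prems(1)])
      also have "?this \<longleftrightarrow> ((\<lambda>\<mu>. G1 \<mu> * \<kappa> (em \<mu> z)) has_sum (f z + - f2 z)) UNIV"
        by (rule has_sum_cong) (auto simp: G1_def I_def)
      finally show "((\<lambda>\<mu>. G1 \<mu> * \<kappa> (em \<mu> z)) has_sum (f z - f2 z)) UNIV"
        by simp
    qed
    have "mrep (\<lambda>z. f z - f2 z + f2 z) (\<lambda>\<mu>. G1 \<mu> + F2 \<mu>)"
      by (intro mrep_add G1 F2)
    hence "mrep f (\<lambda>\<mu>. G1 \<mu> + F2 \<mu>)"
      by simp
    moreover have "base_reduced q \<mu> \<and> size \<mu> \<le> L" if "G1 \<mu> + F2 \<mu> \<noteq> 0" for \<mu>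
    proof (cases "F2 \<mu> = 0")
      case True
      thus ?thesis using that less.prems(2) by (auto simp: G1_def split: if_splits)
    next
      case False
      thus ?thesis using F2(2)[of \<mu>] L' by auto
    qed
    moreover have "G1 \<mu> + F2 \<mu> = G \<mu>" if "base_reduced q \<mu>" "size \<mu> = L" for \<mu>
    proof -
      have "F2 \<mu> = 0"
        using F2(2)[of \<mu>] L' that by force
      thus ?thesis using that by (simp add: G1_def)
    qed
    ultimately show ?thesis
      by blast
  qed
qed

subsection \<open>Growth along the test points\<close>

text \<open>
  At the test points the monomial of weight \<open>j\<close> has the size of \<open>Q r\<close> to the power \<open>j\<close>, so growth
  determines the leading exponent of a tame function.
\<close>

definition grow :: "('c \<Rightarrow> 'k) \<Rightarrow> real \<Rightarrow> bool" where
  "grow f w \<longleftrightarrow> (\<exists>c>0. eventually (\<lambda>r. absval (f (zt r)) = c * Q r powr w) sequentially)"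

lemma Q_pos: "0 < Q r"
  using Q_gt_1[of r] by simp

lemma Q_nz [simp]: "Q r \<noteq> 0"
  using Q_gt_1[of r] by simp

lemma absval_em_zt_le: "absval (em \<mu> (zt r)) \<le> Q r powr wt q \<mu>"
proof (induction \<mu>)
  case (add k \<mu>)
  have "absval (E k (zt r)) * absval (em \<mu> (zt r)) \<le> Q r powr (real q powi (- k)) * Q r powr wt q \<mu>"
    using add absval_E_zt_le by (intro mult_mono) auto
  thus ?case
    by (simp add: absval_mult powr_add)
qed (use Q_pos in auto)

lemma absval_em_zt: "(\<And>k. k \<in># \<mu> \<Longrightarrow> k \<le> int r + 1) \<Longrightarrow> absval (em \<mu> (zt r)) = Q r powr wt q \<mu>"
  using Q_pos[of r] by (induction \<mu>) (auto simp: absval_mult powr_add absval_E_zt)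

lemma Q_powr_neg_tendsto: "\<delta> > 0 \<Longrightarrow> (\<lambda>r. Q r powr (- \<delta>)) \<longlonglongrightarrow> 0"
  using Q_at_top by (intro tendsto_neg_powr) auto

lemma mrep_grow:
  assumes "mrep f G" "\<And>\<mu>. G \<mu> \<noteq> 0 \<Longrightarrow> base_reduced q \<mu>" "G \<mu>\<^sub>0 \<noteq> 0"
    and max: "\<And>\<mu>. G \<mu> \<noteq> 0 \<Longrightarrow> wt q \<mu> \<le> wt q \<mu>\<^sub>0"
  shows   "grow f (wt q \<mu>\<^sub>0)"
proof -
  let ?w = "wt q \<mu>\<^sub>0"
  obtain L K B where G: "bsupp L K G" "B \<ge> 1" "\<And>\<mu>. absval (G \<mu>) \<le> B"
    using mrepE[OF assms(1)] by metis
  obtain \<delta> where \<delta>: "\<delta> > 0"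
    "\<And>\<mu>. size \<mu> \<le> L \<Longrightarrow> (\<forall>k\<in>#\<mu>. K \<le> k) \<Longrightarrow> \<not> (?w - \<delta> < wt q \<mu> \<and> wt q \<mu> < ?w)"
    using wt_left_isolated[OF q_ge_2, of L K ?w] by blast
  \<comment> \<open>Distinct reduced multisets have distinct weights, so
    \<open>\<mu>\<^sub>0\<close> alone has the maximal weight, and the isolation constant
    \<open>\<delta>\<close> serves for all other monomials at once.\<close>
  have less: "wt q \<mu> \<le> ?w - \<delta>" if "G \<mu> \<noteq> 0" "\<mu> \<noteq> \<mu>\<^sub>0" for \<mu>
  proof -
    have "wt q \<mu> \<noteq> ?w"
      using wt_inj[OF q_ge_2] assms(2,3) that by blast
    hence "wt q \<mu> < ?w"
      using max[OF that(1)] by simp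
    thus ?thesis
      using \<delta>(2)[of \<mu>] G(1) that(1) by (auto simp: bsupp_def)
  qed
  \<comment> \<open>From r = m on, all indices of \<open>\<mu>\<^sub>0\<close> are at most r + 1,
    where the sizes at \<open>zt r\<close> are known exactly and not merely bounded.\<close>
  define m where "m = nat (Max (insert 0 (set_mset \<mu>\<^sub>0)))"
  have "k \<le> Max (insert 0 (set_mset \<mu>\<^sub>0))" if "k \<in># \<mu>\<^sub>0" for k
    using that by (intro Max_ge) auto
  hence m: "k \<le> int r + 1" if "k \<in># \<mu>\<^sub>0" "r \<ge> m" for k r
    using that nat_le_iff[of "Max (insert 0 (set_mset \<mu>\<^sub>0))" r] by (fastforce simp: m_def)
  have "(\<lambda>r. B * Q r powr (- \<delta>)) \<longlonglongrightarrow> B * 0"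
    by (intro tendsto_mult Q_powr_neg_tendsto \<delta> tendsto_const)
  hence "eventually (\<lambda>r. B * Q r powr (- \<delta>) < absval (G \<mu>\<^sub>0)) sequentially"
    using assms(3) by (intro order_tendstoD(2)[where a = "absval (G \<mu>\<^sub>0)"]) auto
  hence "eventually (\<lambda>r. absval (f (zt r)) = absval (G \<mu>\<^sub>0) * Q r powr ?w) sequentially"
    using eventually_ge_at_top[of m]
  proof eventually_elim
    case (elim r)
    let ?T = "\<lambda>\<mu>. G \<mu> * \<kappa> (em \<mu> (zt r))"
    have "(?T has_sum (f (zt r) - ?T \<mu>\<^sub>0)) (UNIV - {\<mu>\<^sub>0})"
      using has_sum_finite[of "{\<mu>\<^sub>0}" ?T] by (intro has_sum_Diff[OF mrep_has_sum[OF assms(1)]]) auto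
    hence "absval (f (zt r) - ?T \<mu>\<^sub>0) \<le> B * Q r powr (?w - \<delta>)"
    proof (rule has_sum_absval_le)
      fix \<mu> assume \<mu>: "\<mu> \<in> UNIV - {\<mu>\<^sub>0}"
      show "absval (?T \<mu>) \<le> B * Q r powr (?w - \<delta>)"
      proof (cases "G \<mu> = 0")
        case False
        have "absval (em \<mu> (zt r)) \<le> Q r powr wt q \<mu>"
          by (rule absval_em_zt_le)
        also have "\<dots> \<le> Q r powr (?w - \<delta>)"
          using less[OF False] \<mu> Q_gt_1[of r] by (intro powr_mono) auto
        finally show ?thesis
          using G(2,3) by (auto simp: absval_mult absval_kappa intro!: mult_mono)
      qed (use G(2) in auto)
    qed (use G(2) in auto)
    also have "\<dots> = B * Q r powr (- \<delta>) * Q r powr ?w"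
      by (simp add: powr_add[symmetric])
    also have "\<dots> < absval (G \<mu>\<^sub>0) * Q r powr ?w"
      using elim Q_pos[of r] by (intro mult_strict_right_mono) auto
    also have eq: "absval (G \<mu>\<^sub>0) * Q r powr ?w = absval (?T \<mu>\<^sub>0)"
      using m elim by (simp add: absval_mult absval_kappa absval_em_zt)
    finally show ?case
      unfolding eq by (intro absval_eq_of_diff_less) (simp add: absval_minus_commute)
  qed
  thus ?thesis
    unfolding grow_def using assms(3) by (intro exI[of _ "absval (G \<mu>\<^sub>0)"]) auto
qed

lemma grow_unique:
  assumes "grow f w" "grow f w'"
  shows   "w = w'"
proof -
  have *: False if w: "grow f w" "grow f w'" "w < w'" for w w'
  proof -
    obtain c c' where c: "c > 0" "c' > 0" and
      ev: "eventually (\<lambda>r. absval (f (zt r)) = c * Q r powr w) sequentially"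
          "eventually (\<lambda>r. absval (f (zt r)) = c' * Q r powr w') sequentially"
      using w by (auto simp: grow_def)
    have "(\<lambda>r. c * Q r powr (- (w' - w))) \<longlonglongrightarrow> c * 0"
      using w by (intro tendsto_mult Q_powr_neg_tendsto tendsto_const) auto
    moreover have "eventually (\<lambda>r. c * Q r powr (- (w' - w)) = c') sequentially"
      using ev
    proof eventually_elim
      case (elim r)
      have "c * Q r powr (- (w' - w)) = c * Q r powr w * Q r powr (- w')"
        by (simp add: mult.assoc flip: powr_add)
      also have "\<dots> = c' * (Q r powr w' * Q r powr (- w'))"
        using elim by simp
      also have "Q r powr w' * Q r powr (- w') = 1"
        using Q_pos[of r] by (simp flip: powr_add)
      finally show ?case by simp
    qed
    ultimately have "(\<lambda>r::nat. c') \<longlonglongrightarrow> 0"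
      using Lim_transform_eventually[of "\<lambda>r. c * Q r powr (- (w' - w))" "c * 0" sequentially "\<lambda>_. c'"] by simp
    thus False
      using c by (simp add: LIMSEQ_const_iff)
  qed
  show ?thesis
    using *[OF assms] *[OF assms(2,1)] by (cases w w' rule: linorder_cases) auto
qed

lemma grow_mult:
  assumes "grow f w" "grow g w'"
  shows   "grow (\<lambda>z. f z * g z) (w + w')"
proof -
  obtain c c' where c: "c > 0" "c' > 0" and
    ev: "eventually (\<lambda>r. absval (f (zt r)) = c * Q r powr w) sequentially"
        "eventually (\<lambda>r. absval (g (zt r)) = c' * Q r powr w') sequentially"
    using assms by (auto simp: grow_def)
  have "eventually (\<lambda>r. absval (f (zt r) * g (zt r)) = (c * c') * Q r powr (w + w')) sequentially"
    using ev by eventually_elim (simp add: absval_mult powr_add mult_ac)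
  thus ?thesis
    using c unfolding grow_def by (intro exI[of _ "c * c'"]) auto
qed

lemma grow_nonzero: "grow f w \<Longrightarrow> f \<noteq> (\<lambda>_. 0)"
proof
  assume "grow f w" "f = (\<lambda>_. 0)"
  then obtain c where "c > 0" "eventually (\<lambda>r. 0 = c * Q r powr w) sequentially"
    by (auto simp: grow_def)
  then obtain r where "0 = c * Q r powr w"
    by (auto simp: eventually_sequentially)
  thus False
    using \<open>c > 0\<close> Q_pos[of r] by simp
qed

lemma grow_of_diff_less:
  assumes "grow f w" "f = g \<or> (grow (\<lambda>z. f z - g z) w' \<and> w' < w)"
  shows   "grow g w"
proof (cases "f = g")
  case False
  hence w': "grow (\<lambda>z. f z - g z) w'" "w' < w"
    using assms by auto
  obtain c c' where c: "c > 0" "c' > 0" and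
    ev: "eventually (\<lambda>r. absval (f (zt r)) = c * Q r powr w) sequentially"
        "eventually (\<lambda>r. absval (f (zt r) - g (zt r)) = c' * Q r powr w') sequentially"
    using assms(1) w' by (auto simp: grow_def)
  have "(\<lambda>r. c' * Q r powr (- (w - w'))) \<longlonglongrightarrow> c' * 0"
    using w' by (intro tendsto_mult Q_powr_neg_tendsto tendsto_const) auto
  hence "eventually (\<lambda>r. c' * Q r powr (- (w - w')) < c) sequentially"
    using c by (intro order_tendstoD(2)[where a = c]) auto
  with ev have "eventually (\<lambda>r. absval (g (zt r)) = c * Q r powr w) sequentially"
  proof eventually_elim
    case (elim r)
    have "c' * Q r powr w' = c' * Q r powr (- (w - w')) * Q r powr w"
      by (simp add: mult.assoc flip: powr_add)
    also have "\<dots> < c * Q r powr w"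
      using elim Q_pos[of r] by (intro mult_strict_right_mono) auto
    finally have "absval (f (zt r) - g (zt r)) < absval (f (zt r))"
      using elim by simp
    thus ?case
      using absval_eq_of_diff_less elim by metis
  qed
  thus ?thesis
    using c by (auto simp: grow_def)
qed (use assms in simp)

subsection \<open>Tame functions\<close>

abbreviation tame :: "('c \<Rightarrow> 'k) set" where "tame \<equiv> tame_functions \<iota> \<pi> \<kappa>"

lemma q_power_p: obtains e where "q = CHAR('f) ^ e"
  using finite_field_card_eq_power_CHAR[where 'a = 'f] q_def by auto

lemma e_monomial_wt: "base_reduced q \<mu> \<Longrightarrow> e_monomial \<iota> \<pi> (wt q \<mu>) z = em \<mu> z"
  unfolding e_monomial_def em_def q_def[symmetric]
  by (simp add: digits_wt[OF q_ge_2] digit_wt[OF q_ge_2] image_prod_mset_multiplicity)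

definition toM :: "(real \<Rightarrow> 'k) \<Rightarrow> int multiset \<Rightarrow> 'k" where
  "toM F \<mu> = (if base_reduced q \<mu> then F (wt q \<mu>) else 0)"

lemma has_sum_toM_iff:
  "((\<lambda>\<mu>. toM F \<mu> * \<kappa> (em \<mu> z)) has_sum s) UNIV \<longleftrightarrow>
   ((\<lambda>j. F j * \<kappa> (e_monomial \<iota> \<pi> j z)) has_sum s) (tame_exponents CHAR('f))"
proof -
  obtain e where e: "q = CHAR('f) ^ e"
    by (rule q_power_p)
  have "((\<lambda>j. F j * \<kappa> (e_monomial \<iota> \<pi> j z)) has_sum s) (tame_exponents CHAR('f)) \<longleftrightarrow>
        ((\<lambda>\<mu>. F (wt q \<mu>) * \<kappa> (e_monomial \<iota> \<pi> (wt q \<mu>) z)) has_sum s) {\<mu>. base_reduced q \<mu>}"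
    by (rule has_sum_reindex_bij_betw[OF bij_betw_wt[OF q_ge_2 e], symmetric])
  also have "\<dots> \<longleftrightarrow> ((\<lambda>\<mu>. toM F \<mu> * \<kappa> (em \<mu> z)) has_sum s) UNIV"
    by (rule has_sum_cong_neutral) (auto simp: toM_def e_monomial_wt)
  finally show ?thesis ..
qed

lemma tame_expansion_imp_mrep:
  assumes "tame_expansion \<iota> \<pi> \<kappa> f F"
  shows   "mrep f (toM F)"
  unfolding mrep_def
proof (intro conjI allI)
  obtain L M where L: "\<And>j. F j \<noteq> 0 \<Longrightarrow> digit_sum q j \<le> L" and M: "\<And>j. F j \<noteq> 0 \<Longrightarrow> j \<le> M"
    using assms unfolding tame_expansion_def q_def by metis
  \<comment> \<open>An entry k contributes q^(-k) to the weight, so an upper bound on the exponents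
    bounds the entries below by -n.\<close>
  obtain n where n: "M < real q ^ n"
    using real_arch_pow[OF real_q_gt_1] by blast
  have "bsupp L (- int n) (toM F)"
    unfolding bsupp_def
  proof (intro allI impI conjI ballI)
    fix \<mu> assume nz: "toM F \<mu> \<noteq> 0"
    hence red: "base_reduced q \<mu>" and F: "F (wt q \<mu>) \<noteq> 0"
      by (auto simp: toM_def split: if_splits)
    show "size \<mu> \<le> L"
      using L[OF F] by (simp add: digit_sum_wt[OF q_ge_2 red])
    fix k assume k: "k \<in># \<mu>"
    then obtain \<nu> where "\<mu> = add_mset k \<nu>"
      using multi_member_split by metis
    hence "real q powi (- k) \<le> wt q \<mu>"
      by simp
    also have "\<dots> < real q powi (int n)"
      using M[OF F] n by simp
    finally have "- k < int n"
      using real_q_gt_1 power_int_increasing[of "int n" "- k" "real q"] by force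
    thus "- int n \<le> k"
      by simp
  qed
  thus "\<exists>L K. bsupp L K (toM F)" by blast
  obtain B where B: "\<And>j. absval (F j) \<le> B"
    using assms by (auto simp: tame_expansion_def)
  have "absval (toM F \<mu>) \<le> B" for \<mu>
    using B[of "wt q \<mu>"] B[of 0] order_trans[OF absval_nonneg, of _ B] by (auto simp: toM_def)
  thus "\<exists>B. \<forall>\<mu>. absval (toM F \<mu>) \<le> B" by blast
  fix z
  show "((\<lambda>\<mu>. toM F \<mu> * \<kappa> (em \<mu> z)) has_sum f z) UNIV"
    using assms by (simp add: has_sum_toM_iff tame_expansion_def)
qed

lemma mrep_imp_tame_expansion:
  assumes "mrep f G" "\<And>\<mu>. G \<mu> \<noteq> 0 \<Longrightarrow> base_reduced q \<mu>"
  obtains F where "tame_expansion \<iota> \<pi> \<kappa> f F" "toM F = G"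
proof -
  obtain e where e: "q = CHAR('f) ^ e"
    by (rule q_power_p)
  define F where "F = (\<lambda>j. if j \<in> tame_exponents CHAR('f)
      then G (the_inv_into {\<mu>. base_reduced q \<mu>} (wt q) j) else 0)"
  have inj: "inj_on (wt q) {\<mu>. base_reduced q \<mu>}"
    using bij_betw_wt[OF q_ge_2 e] by (simp add: bij_betw_def)
  have F_wt: "F (wt q \<mu>) = G \<mu>" if "base_reduced q \<mu>" for \<mu>
    using the_inv_into_f_f[OF inj] that tame_exponent_wt[OF q_ge_2 e] by (simp add: F_def)
  have toM: "toM F = G"
    using assms(2) by (force simp: toM_def fun_eq_iff F_wt)
  have F_nz: "\<exists>\<mu>. base_reduced q \<mu> \<and> j = wt q \<mu> \<and> G \<mu> \<noteq> 0" if "F j \<noteq> 0" for j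
  proof -
    have "j \<in> tame_exponents CHAR('f)"
      using that by (auto simp: F_def split: if_splits)
    then obtain \<mu> where "base_reduced q \<mu>" "wt q \<mu> = j"
      by (rule tame_exponent_cases[OF q_ge_2 e])
    thus ?thesis
      using that F_wt by metis
  qed
  obtain L K B where G: "bsupp L K G" "B \<ge> 1" "\<And>\<mu>. absval (G \<mu>) \<le> B"
    using mrepE[OF assms(1)] by metis
  have "tame_expansion \<iota> \<pi> \<kappa> f F"
    unfolding tame_expansion_def
  proof (intro conjI allI impI)
    fix j assume "F j \<noteq> 0"
    thus "j \<in> tame_exponents CHAR('f)"
      by (auto simp: F_def split: if_splits)
  next
    have "digit_sum q j \<le> L" if "F j \<noteq> 0" for j
      using F_nz[OF that] G(1) by (auto simp: bsupp_def digit_sum_wt[OF q_ge_2])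
    thus "\<exists>L. \<forall>j. F j \<noteq> 0 \<longrightarrow> digit_sum CARD('f) j \<le> L"
      unfolding q_def by blast
  next
    show "\<exists>M. \<forall>j. F j \<noteq> 0 \<longrightarrow> j \<le> M"
    proof (cases "{\<mu>. G \<mu> \<noteq> 0} = {}")
      case True
      thus ?thesis using F_nz by auto
    next
      case False
      then obtain \<mu>' where "G \<mu>' \<noteq> 0"
        by auto
      with G(1) obtain \<mu> where "G \<mu> \<noteq> 0" "\<And>\<nu>. G \<nu> \<noteq> 0 \<Longrightarrow> wt q \<nu> \<le> wt q \<mu>"
        by (rule exists_max_supp) blast
      thus ?thesis using F_nz by metis
    qed
  next
    have "absval (F j) \<le> B" for j
      using F_nz[of j] G(2,3) F_wt by (cases "F j = 0") auto
    thus "\<exists>B. \<forall>j. absval (F j) \<le> B" by blast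
  next
    fix z
    show "((\<lambda>j. F j * \<kappa> (e_monomial \<iota> \<pi> j z)) has_sum f z) (tame_exponents CHAR('f))"
      using mrep_has_sum[OF assms(1), of z] unfolding toM[symmetric] has_sum_toM_iff .
  qed
  thus ?thesis
    using that toM by blast
qed

lemma tame_iff_mrep: "f \<in> tame \<longleftrightarrow> (\<exists>G. mrep f G)"
proof
  assume "f \<in> tame"
  thus "\<exists>G. mrep f G"
    using tame_expansion_imp_mrep by (auto simp: tame_functions_def)
next
  assume "\<exists>G. mrep f G"
  then obtain G where G: "mrep f G"
    by blast
  obtain L K B where "bsupp L K G"
    using mrepE[OF G] by metis
  hence "\<And>\<mu>. G \<mu> \<noteq> 0 \<Longrightarrow> size \<mu> \<le> L"
    by (auto simp: bsupp_def)
  from reduce_expansion[OF G this] obtain F where "mrep f F" "\<And>\<mu>. F \<mu> \<noteq> 0 \<Longrightarrow> base_reduced q \<mu>"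
    by blast
  then obtain F' where "tame_expansion \<iota> \<pi> \<kappa> f F'"
    using mrep_imp_tame_expansion by blast
  thus "f \<in> tame"
    by (auto simp: tame_functions_def)
qed

lemma tame_add: "f \<in> tame \<Longrightarrow> g \<in> tame \<Longrightarrow> (\<lambda>z. f z + g z) \<in> tame"
  and tame_diff: "f \<in> tame \<Longrightarrow> g \<in> tame \<Longrightarrow> (\<lambda>z. f z - g z) \<in> tame"
  and tame_mult: "f \<in> tame \<Longrightarrow> g \<in> tame \<Longrightarrow> (\<lambda>z. f z * g z) \<in> tame"
  and tame_cmult: "f \<in> tame \<Longrightarrow> (\<lambda>z. c * f z) \<in> tame"
  unfolding tame_iff_mrep using mrep_add mrep_diff mrep_mult mrep_cmult by blast+

lemma tame_0: "(\<lambda>_. 0) \<in> tame"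
  unfolding tame_iff_mrep using mrep_cmult[OF mrep_monomial[of "{#}"], of 0] by auto

lemma tame_1: "(\<lambda>_. 1) \<in> tame"
  unfolding tame_iff_mrep using mrep_monomial[of "{#}"] by auto

lemma tame_E: "(\<lambda>z. \<kappa> (E k z)) \<in> tame"
  unfolding tame_iff_mrep using mrep_monomial[of "{#k#}"] by auto

lemma tame_power: "f \<in> tame \<Longrightarrow> (\<lambda>z. f z ^ n) \<in> tame"
  by (induction n) (auto intro: tame_1 tame_mult)

lemma tame_sum: "(\<And>i. i \<in> A \<Longrightarrow> f i \<in> tame) \<Longrightarrow> (\<lambda>z. \<Sum>i\<in>A. f i z) \<in> tame"
  by (induction A rule: infinite_finite_induct) (auto intro: tame_0 tame_add)

text \<open>The difference of two expansions represents the zero function; a largest monomial in it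
  would give that function a growth exponent.\<close>

lemma tame_expansion_unique:
  assumes "tame_expansion \<iota> \<pi> \<kappa> f F" "tame_expansion \<iota> \<pi> \<kappa> f F'"
  shows   "F = F'"
proof -
  define G where "G = (\<lambda>\<mu>. toM F \<mu> - toM F' \<mu>)"
  have G: "mrep (\<lambda>z. f z - f z) G"
    unfolding G_def by (intro mrep_diff tame_expansion_imp_mrep assms)
  have red: "base_reduced q \<mu>" if "G \<mu> \<noteq> 0" for \<mu>
    using that by (auto simp: G_def toM_def split: if_splits)
  obtain L K B where "bsupp L K G"
    using mrepE[OF G] by metis
  have "{\<mu>. G \<mu> \<noteq> 0} = {}"
  proof (rule ccontr)
    assume "{\<mu>. G \<mu> \<noteq> 0} \<noteq> {}"
    then obtain \<mu>' where "G \<mu>' \<noteq> 0"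
      by auto
    with \<open>bsupp L K G\<close> obtain \<mu> where "G \<mu> \<noteq> 0" "\<And>\<nu>. G \<nu> \<noteq> 0 \<Longrightarrow> wt q \<nu> \<le> wt q \<mu>"
      by (rule exists_max_supp) blast
    from mrep_grow[OF G red this] show False
      using grow_nonzero by fastforce
  qed
  hence eq: "toM F \<mu> = toM F' \<mu>" for \<mu>
    by (auto simp: G_def)
  obtain e where e: "q = CHAR('f) ^ e"
    by (rule q_power_p)
  show ?thesis
  proof
    fix j
    show "F j = F' j"
    proof (cases "j \<in> tame_exponents CHAR('f)")
      case True
      then obtain \<mu> where "base_reduced q \<mu>" "wt q \<mu> = j"
        by (rule tame_exponent_cases[OF q_ge_2 e])
      thus ?thesis
        using eq[of \<mu>] by (simp add: toM_def)
    next
      case False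
      thus ?thesis
        using assms unfolding tame_expansion_def by metis
    qed
  qed
qed

lemma tame_val_grow:
  assumes "f \<in> tame" "f \<noteq> (\<lambda>_. 0)"
  obtains w where "grow f w" "tame_val \<iota> \<pi> \<kappa> f = - ereal w"
proof -
  obtain F where F: "tame_expansion \<iota> \<pi> \<kappa> f F"
    using assms by (auto simp: tame_functions_def)
  have coeffs: "tame_coeffs \<iota> \<pi> \<kappa> f = F"
    unfolding tame_coeffs_def by (intro the_equality F tame_expansion_unique[OF _ F])
  have G: "mrep f (toM F)"
    by (rule tame_expansion_imp_mrep[OF F])
  have red: "base_reduced q \<mu>" if "toM F \<mu> \<noteq> 0" for \<mu>
    using that by (auto simp: toM_def split: if_splits)
  obtain L K B where bs: "bsupp L K (toM F)"
    using mrepE[OF G] by metis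
  have "{\<mu>. toM F \<mu> \<noteq> 0} \<noteq> {}"
  proof
    assume "{\<mu>. toM F \<mu> \<noteq> 0} = {}"
    hence hs: "((\<lambda>_. 0) has_sum f z) (UNIV :: int multiset set)" for z
      using mrep_has_sum[OF G, of z] by (simp add: Collect_empty_eq)
    have "f z = 0" for z
      using hs[of z] by (rule has_sum_unique) simp
    thus False
      using assms by auto
  qed
  then obtain \<mu>' where "toM F \<mu>' \<noteq> 0"
    by auto
  with bs obtain \<mu> where \<mu>: "toM F \<mu> \<noteq> 0" "\<And>\<nu>. toM F \<nu> \<noteq> 0 \<Longrightarrow> wt q \<nu> \<le> wt q \<mu>"
    by (rule exists_max_supp) blast
  obtain e where e: "q = CHAR('f) ^ e"
    by (rule q_power_p)
  have "(GREATEST j. F j \<noteq> 0) = wt q \<mu>"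
  proof (rule Greatest_equality)
    show "F (wt q \<mu>) \<noteq> 0"
      using \<mu>(1) by (auto simp: toM_def split: if_splits)
    fix j assume j: "F j \<noteq> 0"
    hence "j \<in> tame_exponents CHAR('f)"
      using F by (auto simp: tame_expansion_def)
    then obtain \<nu> where "base_reduced q \<nu>" "wt q \<nu> = j"
      by (rule tame_exponent_cases[OF q_ge_2 e])
    thus "j \<le> wt q \<mu>"
      using \<mu>(2)[of \<nu>] j by (auto simp: toM_def)
  qed
  thus ?thesis
    using that[of "wt q \<mu>"] mrep_grow[OF G red \<mu>] assms(2) by (auto simp: tame_val_def coeffs)
qed

end

context carlitz_gauss
begin

section \<open>Valuations of fractions\<close>

lemma grow_cong: "(\<And>r. f (zt r) = g (zt r)) \<Longrightarrow> grow f w = grow g w"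
  by (simp add: grow_def)

lemma tame_grow_ex: "f \<in> tame \<Longrightarrow> f \<noteq> (\<lambda>_. 0) \<Longrightarrow> \<exists>w. grow f w"
  using tame_val_grow by metis

lemma tame_val_eq: "f \<in> tame \<Longrightarrow> grow f w \<Longrightarrow> tame_val \<iota> \<pi> \<kappa> f = - ereal w"
  using tame_val_grow[of f] grow_nonzero grow_unique by metis

lemma tame_val_0: "tame_val \<iota> \<pi> \<kappa> (\<lambda>_. 0) = \<infinity>"
  by (simp add: tame_val_def)

lemma tame_mult_nonzero:
  assumes "f \<in> tame" "g \<in> tame" "f \<noteq> (\<lambda>_. 0)" "g \<noteq> (\<lambda>_. 0)"
  shows   "(\<lambda>z. f z * g z) \<noteq> (\<lambda>_. 0)"
  using tame_grow_ex[OF assms(1,3)] tame_grow_ex[OF assms(2,4)] grow_mult grow_nonzero by metis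

abbreviation FP :: "(('c \<Rightarrow> 'k) \<times> ('c \<Rightarrow> 'k)) set" where "FP \<equiv> tame_frac_pairs \<iota> \<pi> \<kappa>"
abbreviation FR where "FR \<equiv> tame_frac_rel \<iota> \<pi> \<kappa>"

lemma P_iff: "(f, g) \<in> FP \<longleftrightarrow> f \<in> tame \<and> g \<in> tame \<and> g \<noteq> (\<lambda>_. 0)"
  by (auto simp: tame_frac_pairs_def)

lemma R_iff: "((f, g), (f', g')) \<in> FR \<longleftrightarrow> (f, g) \<in> FP \<and> (f', g') \<in> FP \<and> (\<forall>z. f z * g' z = f' z * g z)"
  by (simp add: tame_frac_rel_def)

lemma equiv_R: "equiv FP FR"
proof (rule equivI)
  show "FR \<subseteq> FP \<times> FP"
    by (auto simp: R_iff)
  show "refl_on FP FR"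
    by (auto simp: refl_on_def R_iff)
  show "sym FR"
    by (auto simp: sym_def R_iff)
  show "trans FR"
  proof (rule transI, clarify)
    fix f g f' g' f'' g''
    assume 1: "((f, g), (f', g')) \<in> FR" and 2: "((f', g'), (f'', g'')) \<in> FR"
    \<comment> \<open>Transitivity amounts to cancelling g', which is possible since growth
      exponents add and so products of nonzero tame functions are nonzero.\<close>
    define d where "d = (\<lambda>z. f z * g'' z - f'' z * g z)"
    have "d \<in> tame"
      using 1 2 unfolding d_def R_iff P_iff by (intro tame_diff tame_mult) auto
    moreover have "(\<lambda>z. d z * g' z) = (\<lambda>_. 0)"
    proof
      fix z
      have "f z * g' z = f' z * g z" "f' z * g'' z = f'' z * g' z"
        using 1 2 by (auto simp: R_iff)
      hence "f z * g'' z * g' z = f'' z * g z * g' z"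
        by (metis mult.assoc mult.commute)
      thus "d z * g' z = 0"
        by (simp add: d_def algebra_simps)
    qed
    ultimately have "d = (\<lambda>_. 0)"
      using tame_mult_nonzero[of d g'] 1 by (auto simp: R_iff P_iff)
    hence "\<forall>z. f z * g'' z = f'' z * g z"
      by (auto simp: d_def fun_eq_iff)
    thus "((f, g), (f'', g'')) \<in> FR"
      using 1 2 by (simp add: R_iff)
  qed
qed

abbreviation fr where "fr \<equiv> tame_frac \<iota> \<pi> \<kappa>"
abbreviation fval where "fval \<equiv> frac_val \<iota> \<pi> \<kappa>"

lemma fr_self: "(f, g) \<in> FP \<Longrightarrow> (f, g) \<in> fr f g"
  unfolding tame_frac_def by (rule equiv_class_self[OF equiv_R])

lemma fr_eqI: "(f, g) \<in> FP \<Longrightarrow> (f', g') \<in> FP \<Longrightarrow> (\<And>z. f z * g' z = f' z * g z) \<Longrightarrow> fr f g = fr f' g'"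
  unfolding tame_frac_def by (rule equiv_class_eq[OF equiv_R]) (simp add: R_iff)

lemma fr_cases:
  assumes "x \<in> tame_fracs \<iota> \<pi> \<kappa>"
  obtains f g where "(f, g) \<in> FP" "x = fr f g"
  using assms unfolding tame_fracs_def tame_frac_def by (auto elim!: quotientE)

lemma fr_in: "(f, g) \<in> FP \<Longrightarrow> fr f g \<in> tame_fracs \<iota> \<pi> \<kappa>"
  unfolding tame_fracs_def tame_frac_def by (rule quotientI)

text \<open>\<open>frac_val\<close> is a \<open>the_elem\<close> over all representatives. They
  agree because the equation between cross products becomes one between sums of growth exponents; a
  zero numerator is treated apart.\<close>

lemma fval_fr:
  assumes "(f, g) \<in> FP"
  shows   "fval (fr f g) = tame_val \<iota> \<pi> \<kappa> f - tame_val \<iota> \<pi> \<kappa> g"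
proof -
  let ?h = "\<lambda>(f, g). tame_val \<iota> \<pi> \<kappa> f - tame_val \<iota> \<pi> \<kappa> g"
  have "?h y = ?h (f, g)" if "y \<in> fr f g" for y
  proof -
    obtain f' g' where y: "y = (f', g')"
      by force
    have FR: "(f', g') \<in> FP" "\<And>z. f z * g' z = f' z * g z"
      using that by (auto simp: y tame_frac_def R_iff)
    obtain w where w: "grow g w" 
      using tame_grow_ex assms by (auto simp: P_iff)
    obtain w' where w': "grow g' w'"
      using tame_grow_ex FR by (auto simp: P_iff)
    have vals: "tame_val \<iota> \<pi> \<kappa> g = - ereal w" "tame_val \<iota> \<pi> \<kappa> g' = - ereal w'"
      using tame_val_eq w w' assms FR by (auto simp: P_iff)
    show ?thesis
    proof (cases "f = (\<lambda>_. 0)")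
      case True
      hence "(\<lambda>z. f' z * g z) = (\<lambda>_. 0)"
        using FR(2) by (simp add: fun_eq_iff)
      hence "f' = (\<lambda>_. 0)"
        using tame_mult_nonzero[of f' g] FR assms by (auto simp: P_iff)
      thus ?thesis
        using True by (simp add: y vals tame_val_0)
    next
      case False
      then obtain v where v: "grow f v"
        using tame_grow_ex assms by (auto simp: P_iff)
      have *: "grow (\<lambda>z. f' z * g z) (v + w')"
        using grow_mult[OF v w'] FR(2) by (simp add: fun_eq_iff cong: grow_cong)
      have "f' \<noteq> (\<lambda>_. 0)"
        using grow_nonzero[OF *] by auto
      then obtain v' where v': "grow f' v'"
        using tame_grow_ex FR by (auto simp: P_iff)
      have "v' + w = v + w'"
        using grow_unique[OF grow_mult[OF v' w] *] .
      thus ?thesis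
        using tame_val_eq[OF _ v] tame_val_eq[OF _ v'] assms FR by (auto simp: P_iff y vals)
    qed
  qed
  moreover have "fr f g \<noteq> {}"
    using fr_self[OF assms] by auto
  ultimately have "the_elem (?h ` fr f g) = ?h (f, g)"
    by (intro the_elem_image_unique) auto
  thus ?thesis
    by (simp add: frac_val_def)
qed

lemma fval_grow:
  assumes "(f, g) \<in> FP" "grow f w" "grow g w'"
  shows   "fval (fr f g) = ereal (w' - w)"
  using fval_fr[OF assms(1)] tame_val_eq[OF _ assms(2)] tame_val_eq[OF _ assms(3)] assms(1)
  by (simp add: P_iff)

lemma fval_0:
  assumes "((\<lambda>_. 0), g) \<in> FP"
  shows   "fval (fr (\<lambda>_. 0) g) = \<infinity>"
proof -
  obtain w where "grow g w" 
    using tame_grow_ex assms by (auto simp: P_iff)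
  thus ?thesis
    using fval_fr[OF assms] tame_val_eq[of g w] assms by (simp add: P_iff tame_val_0)
qed

lemma diff_in_P:
  assumes "(f, g) \<in> FP" "(f', g') \<in> FP"
  shows   "((\<lambda>z. f z * g' z - f' z * g z), (\<lambda>z. g z * g' z)) \<in> FP"
  using assms tame_mult_nonzero unfolding P_iff by (auto intro!: tame_diff tame_mult)

text \<open>\<open>frac_diff\<close> is a union over all pairs of representatives; it is a single
  class because all these differences are equivalent.\<close>

lemma frac_diff_fr:
  assumes "(f, g) \<in> FP" "(f', g') \<in> FP"
  shows   "frac_diff \<iota> \<pi> \<kappa> (fr f g) (fr f' g') = fr (\<lambda>z. f z * g' z - f' z * g z) (\<lambda>z. g z * g' z)"
    (is "_ = ?C")
proof -
  have "fr (\<lambda>z. f1 z * g1' z - f1' z * g1 z) (\<lambda>z. g1 z * g1' z) = ?C"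
    if "(f1, g1) \<in> fr f g" "(f1', g1') \<in> fr f' g'" for f1 g1 f1' g1'
  proof (rule fr_eqI)
    have 1: "(f1, g1) \<in> FP" "\<And>z. f z * g1 z = f1 z * g z"
      and 2: "(f1', g1') \<in> FP" "\<And>z. f' z * g1' z = f1' z * g' z"
      using that by (auto simp: tame_frac_def R_iff)
    show "((\<lambda>z. f1 z * g1' z - f1' z * g1 z), (\<lambda>z. g1 z * g1' z)) \<in> FP"
      by (rule diff_in_P[OF 1(1) 2(1)])
    show "((\<lambda>z. f z * g' z - f' z * g z), (\<lambda>z. g z * g' z)) \<in> FP"
      by (rule diff_in_P[OF assms])
    fix z
    have "(f1 z * g1' z - f1' z * g1 z) * (g z * g' z)
        = (f1 z * g z) * (g1' z * g' z) - (f1' z * g' z) * (g1 z * g z)"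
      by (simp add: algebra_simps)
    also have "\<dots> = (f z * g1 z) * (g1' z * g' z) - (f' z * g1' z) * (g1 z * g z)"
      by (simp add: 1 2)
    also have "\<dots> = (f z * g' z - f' z * g z) * (g1 z * g1' z)"
      by (simp add: algebra_simps)
    finally show "(f1 z * g1' z - f1' z * g1 z) * (g z * g' z) = (f z * g' z - f' z * g z) * (g1 z * g1' z)" .
  qed
  note * = this
  have ne: "fr f g \<noteq> {}" "fr f' g' \<noteq> {}"
    using fr_self[OF assms(1)] fr_self[OF assms(2)] by auto
  show ?thesis
    unfolding frac_diff_def
  proof (rule SUP_eq_const[OF ne(1)], clarify)
    fix f1 g1 assume 1: "(f1, g1) \<in> fr f g"
    show "(\<Union>(f1', g1')\<in>fr f' g'. fr (\<lambda>z. f1 z * g1' z - f1' z * g1 z) (\<lambda>z. g1 z * g1' z)) = ?C"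
      by (rule SUP_eq_const[OF ne(2)], clarify, rule *[OF 1])
  qed
qed

lemma frac_diff_self:
  assumes "(f, g) \<in> FP"
  shows   "fval (frac_diff \<iota> \<pi> \<kappa> (fr f g) (fr f g)) = \<infinity>"
  using fval_0[of "\<lambda>z. g z * g z"] diff_in_P[OF assms assms] by (simp add: frac_diff_fr[OF assms assms])

lemma const_cauchy:
  assumes "(f, g) \<in> FP"
  shows   "(\<lambda>_. fr f g) \<in> frac_cauchy \<iota> \<pi> \<kappa>"
  using fr_in[OF assms] frac_diff_self[OF assms] by (auto simp: frac_cauchy_def)

lemma completion_of_fr_in:
  assumes "(f, g) \<in> FP"
  shows   "completion_of_frac \<iota> \<pi> \<kappa> (fr f g) \<in> tame_completion \<iota> \<pi> \<kappa>"
  unfolding completion_of_frac_def tame_completion_def by (rule quotientI[OF const_cauchy[OF assms]])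

text \<open>A difference of larger valuation does not change the valuation of a fraction. Here this
  is read off from growth, after clearing denominators.\<close>

lemma fval_eq_of_close:
  assumes fg: "(f, g) \<in> FP" "grow f w" "grow g w'" and x: "x \<in> tame_fracs \<iota> \<pi> \<kappa>"
    and close: "ereal (w' - w) < fval (frac_diff \<iota> \<pi> \<kappa> (fr f g) x)"
  shows "fval x = ereal (w' - w)"
proof -
  obtain f1 g1 where fg1: "(f1, g1) \<in> FP" and x: "x = fr f1 g1"
    using x by (rule fr_cases)
  obtain w1' where w1': "grow g1 w1'"
    using tame_grow_ex fg1 by (auto simp: P_iff)
  define d where "d = (\<lambda>z. f z * g1 z - f1 z * g z)"
  have dP: "(d, \<lambda>z. g z * g1 z) \<in> FP"
    unfolding d_def by (rule diff_in_P[OF fg(1) fg1])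
  have close': "ereal (w' - w) < fval (fr d (\<lambda>z. g z * g1 z))"
    using close unfolding x frac_diff_fr[OF fg(1) fg1] d_def .
  have "grow (\<lambda>z. f1 z * g z) (w + w1')"
  proof (cases "d = (\<lambda>_. 0)")
    case True
    hence "(\<lambda>z. f z * g1 z) = (\<lambda>z. f1 z * g z)"
      by (auto simp: d_def fun_eq_iff)
    thus ?thesis
      using grow_mult[OF fg(2) w1'] by simp
  next
    case False
    then obtain wd where wd: "grow d wd"
      using tame_grow_ex dP by (auto simp: P_iff)
    have "fval (fr d (\<lambda>z. g z * g1 z)) = ereal ((w' + w1') - wd)"
      by (rule fval_grow[OF dP wd grow_mult[OF fg(3) w1']])
    hence "wd < w + w1'"
      using close' by simp
    thus ?thesis
      using grow_of_diff_less[OF grow_mult[OF fg(2) w1'], of "\<lambda>z. f1 z * g z" wd] wd by (simp add: d_def)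
  qed
  note * = this
  have "f1 \<noteq> (\<lambda>_. 0)"
    using grow_nonzero[OF *] by auto
  then obtain w1 where w1: "grow f1 w1"
    using tame_grow_ex fg1 by (auto simp: P_iff)
  have "w1 + w' = w + w1'"
    using grow_unique[OF grow_mult[OF w1 fg(3)] *] .
  moreover have "fval x = ereal (w1' - w1)"
    unfolding x by (rule fval_grow[OF fg1 w1 w1'])
  ultimately show ?thesis
    by (simp add: algebra_simps)
qed

text \<open>In every Cauchy sequence of the class the valuations are eventually constant, so all the
  limits in \<open>completion_val\<close> coincide.\<close>

lemma completion_val_fr:
  assumes "(f, g) \<in> FP" "grow f w" "grow g w'"
  shows   "completion_val \<iota> \<pi> \<kappa> (completion_of_frac \<iota> \<pi> \<kappa> (fr f g)) = ereal (w' - w)"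
proof -
  let ?xi = "completion_of_frac \<iota> \<pi> \<kappa> (fr f g)"
  have lim: "lim (\<lambda>n. fval (X n)) = ereal (w' - w)" if "X \<in> ?xi" for X
  proof -
    have X: "range X \<subseteq> tame_fracs \<iota> \<pi> \<kappa>" "(\<lambda>n. fval (frac_diff \<iota> \<pi> \<kappa> (fr f g) (X n))) \<longlonglongrightarrow> \<infinity>"
      using that by (auto simp: completion_of_frac_def completion_rel_def frac_cauchy_def)
    have "eventually (\<lambda>n. ereal (w' - w) < fval (frac_diff \<iota> \<pi> \<kappa> (fr f g) (X n))) sequentially"
      using X(2) by (rule order_tendstoD) simp
    hence "eventually (\<lambda>n. fval (X n) = ereal (w' - w)) sequentially"
      by eventually_elim (use X(1) in \<open>auto intro!: fval_eq_of_close[OF assms]\<close>)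
    thus ?thesis
      by (intro limI tendsto_eventually)
  qed
  have "(\<lambda>_. fr f g) \<in> ?xi"
    using const_cauchy[OF assms(1)] frac_diff_self[OF assms(1)]
    by (simp add: completion_of_frac_def completion_rel_def)
  hence "the_elem ((\<lambda>X. lim (\<lambda>n. fval (X n))) ` ?xi) = ereal (w' - w)"
    using lim by (intro the_elem_image_unique) auto
  thus ?thesis
    by (simp add: completion_val_def)
qed

lemma E_0_zt: "absval (E 0 (zt r)) = Q r"
  using absval_E_zt[of 0 r] Q_pos[of r] by simp

lemma grow_E_0_power: "grow (\<lambda>z. \<kappa> (E 0 z) ^ N) (real N)"
  unfolding grow_def using Q_pos
  by (intro exI[of _ 1]) (simp add: absval_power absval_kappa E_0_zt powr_realpow)

lemma u_polynomial_in_P: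
  assumes "\<And>i. i \<le> N \<Longrightarrow> g i \<in> tame"
  shows   "((\<lambda>z. \<Sum>i\<le>N. g i z * \<kappa> (E 0 z) ^ (N - i)), (\<lambda>z. \<kappa> (E 0 z) ^ N)) \<in> FP"
  unfolding P_iff
proof (intro conjI)
  show "(\<lambda>z. \<Sum>i\<le>N. g i z * \<kappa> (E 0 z) ^ (N - i)) \<in> tame"
    using assms by (intro tame_sum tame_mult tame_power tame_E) auto
  show "(\<lambda>z. \<kappa> (E 0 z) ^ N) \<in> tame"
    by (intro tame_power tame_E)
  show "(\<lambda>z. \<kappa> (E 0 z) ^ N) \<noteq> (\<lambda>_. 0)"
    by (rule grow_nonzero[OF grow_E_0_power])
qed

lemma u_fun_conv: "u_fun \<iota> \<pi> z = inverse (E 0 z)"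
  by (simp add: u_fun_def e_fun_def)

lemma u_polynomial_represents_ex:
  assumes "\<And>i. i \<le> N \<Longrightarrow> g i \<in> tame"
    and "\<And>z. z \<notin> range (A_emb \<iota>) \<Longrightarrow> h z = (\<Sum>i\<le>N. g i z * \<kappa> (u_fun \<iota> \<pi> z) ^ i)"
  shows "\<exists>\<xi>\<in>tame_completion \<iota> \<pi> \<kappa>. u_polynomial_represents \<iota> \<pi> \<kappa> h \<xi>"
proof
  let ?xi = "completion_of_frac \<iota> \<pi> \<kappa> (fr (\<lambda>z. \<Sum>i\<le>N. g i z * \<kappa> (E 0 z) ^ (N - i)) (\<lambda>z. \<kappa> (E 0 z) ^ N))"
  show "?xi \<in> tame_completion \<iota> \<pi> \<kappa>"
    by (intro completion_of_fr_in u_polynomial_in_P assms)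
  show "u_polynomial_represents \<iota> \<pi> \<kappa> h ?xi"
    unfolding u_polynomial_represents_def using assms by blast
qed

text \<open>The test points avoid A, so the values of \<open>h\<close> there determine the growth of
  the numerator for every choice of the polynomial in u.\<close>

lemma completion_val_represents:
  assumes "u_polynomial_represents \<iota> \<pi> \<kappa> h \<xi>" "grow h w"
  shows   "completion_val \<iota> \<pi> \<kappa> \<xi> = ereal (- w)"
proof -
  obtain N g where g: "\<And>i. i \<le> N \<Longrightarrow> g i \<in> tame"
    and h: "\<And>z. z \<notin> range (A_emb \<iota>) \<Longrightarrow> h z = (\<Sum>i\<le>N. g i z * \<kappa> (u_fun \<iota> \<pi> z) ^ i)"
    and xi: "\<xi> = completion_of_frac \<iota> \<pi> \<kappa> (fr (\<lambda>z. \<Sum>i\<le>N. g i z * \<kappa> (E 0 z) ^ (N - i)) (\<lambda>z. \<kappa> (E 0 z) ^ N))"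
    using assms(1) unfolding u_polynomial_represents_def by blast
  have "h (zt r) * \<kappa> (E 0 (zt r)) ^ N = (\<Sum>i\<le>N. g i (zt r) * \<kappa> (E 0 (zt r)) ^ (N - i))" for r
  proof -
    have nz: "\<kappa> (E 0 (zt r)) \<noteq> 0"
      using zt_notin_A by (simp add: E_0_eq_0_iff)
    show ?thesis
      unfolding h[OF zt_notin_A] sum_distrib_right u_fun_conv kap.emb_inverse
      using nz by (intro sum.cong) (auto simp: power_diff field_simps)
  qed
  hence "grow (\<lambda>z. \<Sum>i\<le>N. g i z * \<kappa> (E 0 z) ^ (N - i)) (w + real N)"
    using grow_mult[OF assms(2) grow_E_0_power[of N]]
    by (subst grow_cong[where g = "\<lambda>z. h z * \<kappa> (E 0 z) ^ N"]) auto
  hence "completion_val \<iota> \<pi> \<kappa> \<xi> = ereal (real N - (w + real N))"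
    unfolding xi by (intro completion_val_fr u_polynomial_in_P g grow_E_0_power)
  thus ?thesis by simp
qed

end

section \<open>Interpolation at the division points of the Carlitz module\<close>

text \<open>Coefficientwise convergence with respect to the absolute value of the field, as opposed
  to the X-adic metric on power series.\<close>

definition fconv :: "(nat \<Rightarrow> 'a :: complete_ultrametric_field fps) \<Rightarrow> 'a fps \<Rightarrow> bool" where
  "fconv F G \<longleftrightarrow> (\<forall>m. (\<lambda>d. fps_nth (F d) m) \<longlonglongrightarrow> fps_nth G m)"

lemma fconv_const: "fconv (\<lambda>_. G) G"
  by (simp add: fconv_def)

lemma fconv_add: "fconv F G \<Longrightarrow> fconv F' G' \<Longrightarrow> fconv (\<lambda>d. F d + F' d) (G + G')"
  by (auto simp: fconv_def intro: tendsto_add)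

lemma fconv_mult: "fconv F G \<Longrightarrow> fconv F' G' \<Longrightarrow> fconv (\<lambda>d. F d * F' d) (G * G')"
  by (auto simp: fconv_def fps_mult_nth intro!: tendsto_sum tendsto_mult)

lemma fconv_prod_mset:
  assumes "\<And>k. k \<in># \<mu> \<Longrightarrow> fconv (\<lambda>d. F d k) (G k)"
  shows   "fconv (\<lambda>d. \<Prod>k\<in>#\<mu>. F d k) (\<Prod>k\<in>#\<mu>. G k)"
  using assms by (induction \<mu>) (auto intro: fconv_const fconv_mult)

lemma fconv_unique:
  assumes "fconv F G" "fconv F' G'" "eventually (\<lambda>d. F d = F' d) sequentially"
  shows   "G = G'"
proof (rule fps_ext)
  fix m
  have ev: "eventually (\<lambda>d. fps_nth (F d) m = fps_nth (F' d) m) sequentially"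
    using assms(3) by eventually_elim simp
  have "(\<lambda>d. fps_nth (F d) m) \<longlonglongrightarrow> fps_nth G m"
    using assms(1) by (simp add: fconv_def)
  hence "(\<lambda>d. fps_nth (F' d) m) \<longlonglongrightarrow> fps_nth G m"
    using ev by (rule Lim_transform_eventually)
  thus "fps_nth G m = fps_nth G' m"
    using assms(2) unfolding fconv_def by (blast intro: LIMSEQ_unique)
qed

text \<open>The geometric series of 1 / (\<alpha> + X).\<close>

definition geom :: "'a :: field \<Rightarrow> 'a fps" where
  "geom \<alpha> = Abs_fps (\<lambda>n. (- 1) ^ n * inverse \<alpha> ^ Suc n)"

lemma geom_inverse:
  assumes "\<alpha> \<noteq> 0"
  shows   "(fps_const \<alpha> + fps_X) * geom \<alpha> = 1"
proof (rule fps_ext)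
  fix n
  show "fps_nth ((fps_const \<alpha> + fps_X) * geom \<alpha>) n = fps_nth 1 n"
    using assms by (cases n) (simp_all add: distrib_right geom_def)
qed

lemma fps_const_prod_mset: "(\<Prod>k\<in>#\<mu>. fps_const (f k)) = fps_const (\<Prod>k\<in>#\<mu>. f k)"
  by (induction \<mu>) auto

context carlitz_gauss
begin

lemma CHAR_fps: "CHAR('c fps) = CHAR('f)"
  by (simp add: CHAR_C)

lemmas fps_frob_sum = frobenius_sum[where 'f = 'f, OF CHAR_fps, folded q_def]
lemmas fps_frob_add = frobenius_add[where 'f = 'f, OF CHAR_fps, folded q_def]

text \<open>
  \<open>cc n i\<close> is the coefficient of \<open>X\<close> to the power \<open>q\<^sup>i\<close> in the polynomial by which \<open>\<theta>\<^sup>n\<close> acts on the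
  Carlitz module.
\<close>

primrec cc :: "nat \<Rightarrow> nat \<Rightarrow> 'c" where
  "cc 0 i = (if i = 0 then 1 else 0)"
| "cc (Suc n) i = \<theta> * cc n i + (if i = 0 then 0 else cc n (i - 1) ^ q)"

lemma cc_eq_0: "n < i \<Longrightarrow> cc n i = 0"
  using q_gt_0 by (induction n arbitrary: i) (auto simp: power_0_left)

lemma cc_diag: "cc n n = 1"
  by (induction n) (auto simp: cc_eq_0)

lemma cc_n_0: "cc n 0 = \<theta> ^ n"
  by (induction n) auto

definition Cl :: "nat \<Rightarrow> 'c fps \<Rightarrow> 'c fps" where
  "Cl n Y = (\<Sum>i\<le>n. fps_const (cc n i) * Y ^ (q ^ i))"

lemma Cl_Suc: "Cl (Suc n) Y = fps_const \<theta> * Cl n Y + Cl n Y ^ q"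
proof -
  have "Cl n Y ^ q = (\<Sum>i\<le>n. (fps_const (cc n i) * Y ^ (q ^ i)) ^ q)"
    unfolding Cl_def using fps_frob_sum[of _ _ 1] by simp
  also have "\<dots> = (\<Sum>i\<le>n. fps_const (cc n i ^ q) * Y ^ (q ^ Suc i))"
    by (simp add: power_mult_distrib fps_const_power mult.commute flip: power_mult)
  finally have 1: "Cl n Y ^ q = (\<Sum>i\<le>n. fps_const (cc n i ^ q) * Y ^ (q ^ Suc i))" .
  have "Cl (Suc n) Y = (\<Sum>i\<le>Suc n. fps_const (\<theta> * cc n i) * Y ^ (q ^ i))
      + (\<Sum>i\<le>Suc n. fps_const (if i = 0 then 0 else cc n (i - 1) ^ q) * Y ^ (q ^ i))"
    unfolding Cl_def sum.distrib[symmetric]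
    by (intro sum.cong) (simp_all add: algebra_simps flip: fps_const_add)
  also have "(\<Sum>i\<le>Suc n. fps_const (\<theta> * cc n i) * Y ^ (q ^ i)) = fps_const \<theta> * Cl n Y"
    by (simp add: Cl_def cc_eq_0 sum_distrib_left mult.assoc flip: fps_const_mult)
  also have "(\<Sum>i\<le>Suc n. fps_const (if i = 0 then 0 else cc n (i - 1) ^ q) * Y ^ (q ^ i)) = Cl n Y ^ q"
    unfolding 1 by (subst sum.atMost_Suc_shift) simp
  finally show ?thesis .
qed

lemma Cl_0 [simp]: "Cl 0 Y = Y"
  by (simp add: Cl_def)

lemma Cl_add: "Cl n (X + Y) = Cl n X + Cl n Y"
  by (simp add: Cl_def fps_frob_add distrib_left sum.distrib)

lemma Cl_E: "Cl n (fps_const (E k z)) = fps_const (E (k - int n) z)"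
proof (induction n)
  case (Suc n)
  have "k - int (Suc n) = (k - int n) - 1"
    by simp
  thus ?case
    by (simp only: Cl_Suc Suc E_pred) (simp add: fps_const_power)
qed auto

text \<open>The coefficients are power series because the polynomial is evaluated at e_d(z) + y /
  \<theta>^d with a formal y.\<close>

definition CP :: "nat \<Rightarrow> 'c fps poly" where
  "CP n = (\<Sum>i\<le>n. monom (fps_const (cc n i)) (q ^ i))"

lemma poly_CP: "poly (CP n) Y = Cl n Y"
  by (simp add: CP_def Cl_def poly_sum poly_monom)

lemma degree_CP_le: "degree (CP n) \<le> q ^ n"
  unfolding CP_def
  by (intro degree_sum_le order_trans[OF degree_monom_le]) (use q_gt_0 in \<open>auto intro: power_increasing\<close>)

lemma q_power_inj [simp]: "q ^ i = q ^ j \<longleftrightarrow> i = j"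
  using q_gt_1 by (simp add: power_inject_exp)

lemma coeff_CP: "coeff (CP n) (q ^ n) = 1"
  by (simp add: CP_def coeff_sum cc_diag)

lemma pderiv_sum: "pderiv (sum f A) = (\<Sum>x\<in>A. pderiv (f x))"
  by (induction A rule: infinite_finite_induct) (auto simp: pderiv_add)

text \<open>All exponents except q^0 vanish in characteristic p. Because the derivative is constant,
  all Lagrange denominators equal \<theta>^d.\<close>

lemma pderiv_CP: "pderiv (CP n) = [:fps_const (\<theta> ^ n):]"
proof -
  have 0: "of_nat (q ^ i) = (0 :: 'c fps)" if "i > 0" for i
    using that of_nat_q by (simp add: fps_of_nat[symmetric])
  have "pderiv (CP n) = (\<Sum>i\<le>n. if i = 0 then [:fps_const (\<theta> ^ n):] else 0)"
    unfolding CP_def pderiv_sum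
    by (intro sum.cong) (use 0 in \<open>auto simp: pderiv_monom cc_n_0 monom_0 simp del: of_nat_power\<close>)
  thus ?thesis by simp
qed

text \<open>Zero is listed separately because its degree is 0 by convention; this makes
  \<open>Ad 0\<close> the set {0}, of cardinality q^0.\<close>

definition Ad :: "nat \<Rightarrow> 'f poly set" where
  "Ad d = {a. a = 0 \<or> degree a < d}"

lemma Ad_Suc: "Ad (Suc d) = (\<lambda>(c, a). pCons c a) ` (UNIV \<times> Ad d)"
proof safe
  fix a assume a: "a \<in> Ad (Suc d)"
  obtain c b where "a = pCons c b"
    by (rule pCons_cases)
  thus "a \<in> (\<lambda>(c, a). pCons c a) ` (UNIV \<times> Ad d)"
    using a by (intro image_eqI[of _ _ "(c, b)"]) (auto simp: Ad_def split: if_splits)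
qed (auto simp: Ad_def)

lemma card_Ad: "finite (Ad d) \<and> card (Ad d) = q ^ d"
proof (induction d)
  case 0
  have "Ad 0 = {0}" by (auto simp: Ad_def)
  thus ?case by simp
next
  case (Suc d)
  have "inj_on (\<lambda>(c, a). pCons c a) (UNIV \<times> Ad d)"
    by (auto simp: inj_on_def)
  thus ?case
    using Suc by (simp add: Ad_Suc card_image card_cartesian_product q_def)
qed

lemmas finite_Ad = card_Ad[THEN conjunct1]

lemma Ad_iff: "a \<in> Ad d \<longleftrightarrow> absval (A_emb \<iota> a) < real q ^ d"
  using real_q_gt_1 by (cases "a = 0") (auto simp: Ad_def absval_A_emb)

lemma Ad_diff: "a \<in> Ad d \<Longrightarrow> b \<in> Ad d \<Longrightarrow> a - b \<in> Ad d"
  using absval_diff_le[of "A_emb \<iota> a" "A_emb \<iota> b"] by (auto simp: Ad_iff A_emb_diff)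

definition xp :: "nat \<Rightarrow> 'f poly \<Rightarrow> 'c fps" where
  "xp d a = fps_const (E (int d) (A_emb \<iota> a))"

lemma inj_xp: "inj_on (xp d) (Ad d)"
proof (rule inj_onI)
  fix a b assume ab: "a \<in> Ad d" "b \<in> Ad d" "xp d a = xp d b"
  hence "E (int d) (A_emb \<iota> (a - b)) = 0"
    by (simp add: xp_def E_diff A_emb_diff)
  then obtain c where c: "A_emb \<iota> (a - b) = \<theta> ^ d * A_emb \<iota> c"
    by (auto simp: E_nat_eq_0_iff)
  have "c = 0"
  proof (rule ccontr)
    assume "c \<noteq> 0"
    hence "real q ^ d * 1 \<le> real q ^ d * absval (A_emb \<iota> c)"
      by (intro mult_left_mono absval_A_emb_ge_1) auto
    also have "\<dots> = absval (A_emb \<iota> (a - b))"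
      by (simp add: c absval_mult absval_power absval_theta)
    also have "\<dots> < real q ^ d"
      using Ad_diff[OF ab(1,2)] by (simp add: Ad_iff)
    finally show False by simp
  qed
  thus "a = b"
    using c by simp
qed

lemma card_xp: "card (xp d ` Ad d) = q ^ d"
  using card_image[OF inj_xp] card_Ad by simp

lemma Cl_xp: "Cl d (xp d a) = 0"
  by (simp add: xp_def Cl_E)

lemma degree_prod_linear: "degree (\<Prod>a\<in>A. [:- f a, 1:]) = card A" "lead_coeff (\<Prod>a\<in>A. [:- f a, 1:]) = 1"
  for f :: "'i \<Rightarrow> 'r :: idom"
  by (subst degree_prod_eq_sum_degree; simp) (simp add: lead_coeff_prod)

text \<open>Both sides are monic of degree q^d and vanish at the q^d distinct division
  points.\<close>

lemma CP_factor: "CP d = (\<Prod>a\<in>Ad d. [:- xp d a, 1:])"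
proof (rule poly_eqI_degree_lead_coeff[where A = "xp d ` Ad d" and n = "q ^ d"])
  have deg: "degree (\<Prod>a\<in>Ad d. [:- xp d a, 1:]) = q ^ d"
    using card_Ad by (simp add: degree_prod_linear)
  thus "degree (\<Prod>a\<in>Ad d. [:- xp d a, 1:]) \<le> q ^ d"
    by simp
  show "coeff (CP d) (q ^ d) = coeff (\<Prod>a\<in>Ad d. [:- xp d a, 1:]) (q ^ d)"
    using degree_prod_linear(2)[of "xp d" "Ad d"] unfolding deg by (simp add: coeff_CP)
  fix x assume "x \<in> xp d ` Ad d"
  then obtain a where a: "a \<in> Ad d" "x = xp d a"
    by auto
  have "(\<Prod>b\<in>Ad d. poly [:- xp d b, 1:] x) = 0"
    using a finite_Ad by (intro prod_zero bexI[of _ a]) auto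
  thus "poly (CP d) x = poly (\<Prod>a\<in>Ad d. [:- xp d a, 1:]) x"
    by (simp add: a poly_CP Cl_xp poly_prod)
qed (use card_xp degree_CP_le in auto)

lemma prod_xp_diff:
  assumes "a \<in> Ad d"
  shows   "(\<Prod>b\<in>Ad d - {a}. xp d a - xp d b) = fps_const (\<theta> ^ d)"
proof -
  have "fps_const (\<theta> ^ d) = poly (pderiv (\<Prod>b\<in>Ad d. [:- xp d b, 1:])) (xp d a)"
    unfolding CP_factor[symmetric] pderiv_CP by simp
  also have "\<dots> = (\<Sum>c\<in>Ad d. \<Prod>b\<in>Ad d - {c}. xp d a - xp d b)"
    by (simp add: pderiv_prod poly_sum poly_prod pderiv_pCons)
  also have "\<dots> = (\<Sum>c\<in>{a}. \<Prod>b\<in>Ad d - {c}. xp d a - xp d b)"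
  proof (rule sum.mono_neutral_right[OF finite_Ad])
    show "\<forall>c\<in>Ad d - {a}. (\<Prod>b\<in>Ad d - {c}. xp d a - xp d b) = 0"
      using assms finite_Ad by (auto intro!: prod_zero bexI[of _ a])
  qed (use assms in auto)
  finally show ?thesis by simp
qed

lemma lagrange:
  assumes "degree p < q ^ d"
  shows   "fps_const (\<theta> ^ d) * poly p \<xi> = (\<Sum>a\<in>Ad d. poly p (xp d a) * (\<Prod>b\<in>Ad d - {a}. \<xi> - xp d b))"
proof -
  define L where "L = (\<Sum>a\<in>Ad d. smult (poly p (xp d a)) (\<Prod>b\<in>Ad d - {a}. [:- xp d b, 1:]))"
  have pos: "0 < q ^ d"
    using q_gt_0 by simp
  have "smult (fps_const (\<theta> ^ d)) p = L"
  proof (rule poly_eqI_degree[where A = "xp d ` Ad d"])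
    fix x assume "x \<in> xp d ` Ad d"
    then obtain a where a: "a \<in> Ad d" "x = xp d a"
      by auto
    have "poly L x = (\<Sum>c\<in>Ad d. poly p (xp d c) * (\<Prod>b\<in>Ad d - {c}. xp d a - xp d b))"
      by (simp add: L_def poly_sum poly_prod a)
    also have "\<dots> = (\<Sum>c\<in>{a}. poly p (xp d c) * (\<Prod>b\<in>Ad d - {c}. xp d a - xp d b))"
    proof (rule sum.mono_neutral_right[OF finite_Ad])
      have "(\<Prod>b\<in>Ad d - {c}. xp d a - xp d b) = 0" if "c \<in> Ad d - {a}" for c
        using a that finite_Ad by (auto intro!: prod_zero bexI[of _ a])
      thus "\<forall>c\<in>Ad d - {a}. poly p (xp d c) * (\<Prod>b\<in>Ad d - {c}. xp d a - xp d b) = 0"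
        by simp
    qed (use a in auto)
    also have "\<dots> = poly (smult (fps_const (\<theta> ^ d)) p) x"
      using a by (simp add: prod_xp_diff)
    finally show "poly (smult (fps_const (\<theta> ^ d)) p) x = poly L x" ..
  next
    show "degree (smult (fps_const (\<theta> ^ d)) p) < card (xp d ` Ad d)"
      using assms by (simp add: card_xp)
    have "degree L \<le> q ^ d - 1"
      unfolding L_def
    proof (intro degree_sum_le finite_Ad order_trans[OF degree_smult_le])
      fix a assume "a \<in> Ad d"
      thus "degree (\<Prod>b\<in>Ad d - {a}. [:- xp d b, 1:]) \<le> q ^ d - 1"
        using card_Ad[of d] by (simp add: degree_prod_linear)
    qed
    hence "degree L < q ^ d"
      using pos by linarith
    thus "degree L < card (xp d ` Ad d)"
      by (simp add: card_xp)
  qed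
  hence "poly (smult (fps_const (\<theta> ^ d)) p) \<xi> = poly L \<xi>"
    by simp
  thus ?thesis
    by (simp add: L_def poly_sum poly_prod)
qed

text \<open>Each factor of index k costs q^(d-k) in the degree, so the total degree is at most q^d
  times the weight.\<close>

lemma degree_prod_CP:
  assumes "\<And>k. k \<in># \<mu> \<Longrightarrow> k \<le> int d" "wt q \<mu> < 1"
  shows   "degree (\<Prod>k\<in>#\<mu>. CP (nat (int d - k))) < q ^ d"
proof -
  have "real (degree (\<Prod>k\<in>#\<mu>. CP (nat (int d - k)))) \<le> real q ^ d * wt q \<mu>"
    using assms(1)
  proof (induction \<mu>)
    case (add k \<mu>)
    have "real (degree (\<Prod>k\<in>#add_mset k \<mu>. CP (nat (int d - k))))
        \<le> real (degree (CP (nat (int d - k)))) + real (degree (\<Prod>k\<in>#\<mu>. CP (nat (int d - k))))"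
      using degree_mult_le[of "CP (nat (int d - k))" "\<Prod>k\<in>#\<mu>. CP (nat (int d - k))"]
      by (simp flip: of_nat_add)
    also have "real (degree (CP (nat (int d - k)))) \<le> real (q ^ nat (int d - k))"
      using degree_CP_le by (simp only: of_nat_le_iff)
    also have "real (q ^ nat (int d - k)) = real q powi (int d - k)"
      using add.prems by (simp add: power_int_def)
    also have "\<dots> = real q ^ d * real q powi (- k)"
      using power_int_add[of "real q" "int d" "- k"] q_gt_0 by simp
    finally show ?case
      using add by (simp add: distrib_left)
  qed auto
  also have "\<dots> < real q ^ d * 1"
    using assms(2) real_q_pos by (intro mult_strict_left_mono) auto
  finally have "real (degree (\<Prod>k\<in>#\<mu>. CP (nat (int d - k)))) < real (q ^ d)"
    by simp
  thus ?thesis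
    by (simp only: of_nat_less_iff)
qed

text \<open>With this scaling the coefficients of \<open>Cl d (yv d)\<close> are cc d i /
  \<theta>^(d q^i), which tend to 1 / d_i; so y plays the role of an increment of \<pi> z.\<close>

definition yv :: "nat \<Rightarrow> 'c fps" where
  "yv d = fps_const (inverse (\<theta> ^ d)) * fps_X"

text \<open>Tends to \<pi> w as d grows. For w = z - a it is the constant term of \<theta>^d times
  the linear factor e_d(z) + y / \<theta>^d - e_d(a).\<close>

definition av :: "nat \<Rightarrow> 'c \<Rightarrow> 'c" where
  "av d w = \<theta> ^ d * E (int d) w"

text \<open>
  The \<open>e\<^sub>d(a)\<close> with \<open>deg a < d\<close> are the roots of the polynomial of \<open>\<theta>\<^sup>d\<close>, which maps \<open>e\<^sub>d\<close> to \<open>e\<^sub>0\<close>.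
  Lagrange interpolation at these points is applied at \<open>e\<^sub>d(z) + y / \<theta>\<^sup>d\<close> with a formal variable \<open>y\<close>, so
  that the coefficients in \<open>y\<close> give all the powers \<open>(z - a)\<close> to the \<open>-1 - n\<close> in the limit.
\<close>

lemma partial_fractions_level:
  assumes "\<And>k. k \<in># \<mu> \<Longrightarrow> k \<le> int d" "wt q \<mu> < 1" and z: "z \<notin> range (A_emb \<iota>)"
  shows "(\<Prod>k\<in>#\<mu>. fps_const (E k z) + Cl (nat (int d - k)) (yv d))
     = (fps_const (E 0 z) + Cl d (yv d)) * (\<Sum>a\<in>Ad d. fps_const (em \<mu> (A_emb \<iota> a)) * geom (av d (z - A_emb \<iota> a)))"
proof -
  define p where "p = (\<Prod>k\<in>#\<mu>. CP (nat (int d - k)))"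
  define \<xi> where "\<xi> = fps_const (E (int d) z) + yv d"
  have Cl_\<xi>: "Cl n \<xi> = fps_const (E (int d - int n) z) + Cl n (yv d)" for n
    by (simp add: \<xi>_def Cl_add Cl_E)
  have poly_p: "poly p x = (\<Prod>k\<in>#\<mu>. Cl (nat (int d - k)) x)" for x
    unfolding p_def by (induction \<mu>) (auto simp: poly_CP)
  have p_xi: "poly p \<xi> = (\<Prod>k\<in>#\<mu>. fps_const (E k z) + Cl (nat (int d - k)) (yv d))"
    unfolding poly_p by (intro arg_cong[where f = prod_mset] image_mset_cong) (use assms(1) in \<open>simp add: Cl_\<xi>\<close>)
  have p_xp: "poly p (xp d a) = fps_const (em \<mu> (A_emb \<iota> a))" for a
  proof -
    have "poly p (xp d a) = (\<Prod>k\<in>#\<mu>. fps_const (E k (A_emb \<iota> a)))"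
      unfolding poly_p
      by (intro arg_cong[where f = prod_mset] image_mset_cong) (use assms(1) in \<open>simp add: xp_def Cl_E\<close>)
    thus ?thesis
      by (simp add: fps_const_prod_mset em_def)
  qed
  have factor: "fps_const (\<theta> ^ d) * (\<xi> - xp d a) = fps_const (av d (z - A_emb \<iota> a)) + fps_X" for a
    by (simp add: \<xi>_def xp_def yv_def av_def E_diff algebra_simps flip: fps_const_sub fps_const_mult)
  have nz: "av d (z - A_emb \<iota> a) \<noteq> 0" for a
  proof
    assume "av d (z - A_emb \<iota> a) = 0"
    then obtain b where "z - A_emb \<iota> a = \<theta> ^ d * A_emb \<iota> b"
      by (auto simp: av_def E_nat_eq_0_iff)
    moreover have "\<exists>c. \<theta> ^ d * A_emb \<iota> b = A_emb \<iota> c"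
    proof (induction d)
      case (Suc d)
      then obtain c where "\<theta> ^ d * A_emb \<iota> b = A_emb \<iota> c" by blast
      thus ?case
        by (intro exI[of _ "pCons 0 c"]) (simp add: A_emb_pCons mult.assoc)
    qed auto
    ultimately obtain c where "z - A_emb \<iota> a = A_emb \<iota> c"
      by metis
    hence "z = A_emb \<iota> (c + a)"
      by (simp add: A_emb_add algebra_simps)
    thus False using z by blast
  qed
  have prod_all: "(\<Prod>b\<in>Ad d. \<xi> - xp d b) = Cl d \<xi>"
    unfolding poly_CP[symmetric] CP_factor by (simp add: poly_prod)
  have prod_but: "(\<Prod>b\<in>Ad d - {a}. \<xi> - xp d b) = Cl d \<xi> * fps_const (\<theta> ^ d) * geom (av d (z - A_emb \<iota> a))"
    if a: "a \<in> Ad d" for a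
  proof -
    have "Cl d \<xi> = (\<xi> - xp d a) * (\<Prod>b\<in>Ad d - {a}. \<xi> - xp d b)"
      unfolding prod_all[symmetric] using a finite_Ad by (rule prod.remove[rotated])
    hence "Cl d \<xi> * fps_const (\<theta> ^ d) * geom (av d (z - A_emb \<iota> a))
       = (fps_const (\<theta> ^ d) * (\<xi> - xp d a) * geom (av d (z - A_emb \<iota> a))) * (\<Prod>b\<in>Ad d - {a}. \<xi> - xp d b)"
      by (simp add: mult_ac)
    also have "fps_const (\<theta> ^ d) * (\<xi> - xp d a) * geom (av d (z - A_emb \<iota> a)) = 1"
      unfolding factor by (rule geom_inverse[OF nz])
    finally show ?thesis by simp
  qed
  have "fps_const (\<theta> ^ d) * poly p \<xi> = (\<Sum>a\<in>Ad d. poly p (xp d a) * (\<Prod>b\<in>Ad d - {a}. \<xi> - xp d b))"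
    unfolding p_def by (intro lagrange degree_prod_CP assms)
  also have "\<dots> = fps_const (\<theta> ^ d) * (Cl d \<xi> * (\<Sum>a\<in>Ad d. fps_const (em \<mu> (A_emb \<iota> a)) * geom (av d (z - A_emb \<iota> a))))"
    unfolding sum_distrib_left by (intro sum.cong) (simp_all add: p_xp prod_but mult_ac)
  finally have "poly p \<xi> = Cl d \<xi> * (\<Sum>a\<in>Ad d. fps_const (em \<mu> (A_emb \<iota> a)) * geom (av d (z - A_emb \<iota> a)))"
    by simp
  thus ?thesis
    unfolding p_xi Cl_\<xi> by simp
qed

subsection \<open>Passage to the limit\<close>

text \<open>The factor \<theta>^d in \<open>av\<close> has to be compensated: the argument has size
  of order q^(-d), and a quadratic error leaves a power of q to spare.\<close>

lemma exp_quadratic: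
  assumes "absval X \<le> 1"
  shows   "absval (cexp X - X) \<le> absval X ^ 2"
proof (rule has_sum_absval_le[OF exp_minus_id_has_sum])
  fix i :: nat assume i: "i \<in> {0<..}"
  have "2 \<le> q ^ i"
    using i q_ge_2 self_le_power[of q i] by simp
  have "absval (X ^ q ^ i / cd i) \<le> absval X ^ (q ^ i) / 1"
    unfolding absval_divide absval_power absval_cd using real_q_gt_1 by (intro divide_left_mono) auto
  also have "\<dots> \<le> absval X ^ 2"
    using assms \<open>2 \<le> q ^ i\<close> by (auto intro: power_decreasing)
  finally show "absval (X ^ q ^ i / cd i) \<le> absval X ^ 2" .
qed auto

lemma inverse_q_power_tendsto: "(\<lambda>d. c * inverse (real q ^ d)) \<longlonglongrightarrow> 0"
proof -
  have "(\<lambda>d. inverse (real q) ^ d) \<longlonglongrightarrow> 0"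
    using real_q_gt_1 by (intro LIMSEQ_power_zero) (simp add: inverse_less_1_iff)
  from tendsto_mult[OF tendsto_const[of c] this] show ?thesis
    by (simp add: power_inverse)
qed

lemma av_tendsto: "(\<lambda>d. av d w) \<longlonglongrightarrow> \<pi> * w"
proof -
  have "eventually (\<lambda>d. absval (\<pi> * w) * inverse (real q ^ d) < 1) sequentially"
    using inverse_q_power_tendsto by (rule order_tendstoD) simp
  hence "eventually (\<lambda>d. absval (av d w - \<pi> * w) \<le> absval (\<pi> * w) ^ 2 * inverse (real q ^ d)) sequentially"
  proof eventually_elim
    case (elim d)
    define X where "X = \<pi> * w / \<theta> ^ d"
    have X: "absval X = absval (\<pi> * w) * inverse (real q ^ d)"
      by (simp add: X_def absval_mult absval_inverse absval_power absval_theta divide_inverse)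
    have "av d w - \<pi> * w = \<theta> ^ d * (cexp X - X)"
      by (simp add: av_def e_fun_def X_def right_diff_distrib)
    hence "absval (av d w - \<pi> * w) = real q ^ d * absval (cexp X - X)"
      by (simp add: absval_mult absval_power absval_theta)
    also have "\<dots> \<le> real q ^ d * absval X ^ 2"
      using elim by (intro mult_left_mono exp_quadratic) (auto simp: X)
    also have "\<dots> = absval (\<pi> * w) ^ 2 * inverse (real q ^ d)"
      using real_q_pos by (simp add: X power_mult_distrib power2_eq_square)
    finally show ?case .
  qed
  hence "(\<lambda>d. absval (av d w - \<pi> * w)) \<longlonglongrightarrow> 0"
    by (intro Lim_null_comparison[OF _ inverse_q_power_tendsto[of "absval (\<pi> * w) ^ 2"]]) simp
  hence "(\<lambda>d. av d w - \<pi> * w) \<longlonglongrightarrow> 0"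
    by (rule tendsto_absval_0I)
  from tendsto_add[OF this tendsto_const[of "\<pi> * w"]] show ?thesis
    by simp
qed

lemma absval_av:
  assumes "absval w < real q ^ d"
  shows   "absval (av d w) = absval (\<pi> * w)"
  using absval_E[of w "int d"] assms real_q_pos
  by (simp add: av_def absval_mult absval_power absval_theta)

text \<open>The series of exp_C(y / \<theta>^k) in y, that is, of e_k(y / \<pi>). So
  \<open>fps_const (E k z) + eps k\<close> stands for e_k(z + y / \<pi>).\<close>

definition eps :: "int \<Rightarrow> 'c fps" where
  "eps k = Abs_fps (\<lambda>m. \<Sum>i | i \<le> m \<and> q ^ i = m. \<theta> powi (- (k * int m)) / cd i)"

lemma eps_nth_power: "fps_nth (eps k) (q ^ i) = \<theta> powi (- (k * int (q ^ i))) / cd i"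
proof -
  have "{j. j \<le> q ^ i \<and> q ^ j = q ^ i} = {i}"
    using self_le_q_power by auto
  thus ?thesis by (simp add: eps_def)
qed

lemma eps_nth_other:
  assumes "\<And>i. m \<noteq> q ^ i"
  shows   "fps_nth (eps k) m = 0"
proof -
  have "{j. j \<le> m \<and> q ^ j = m} = {}"
    using assms by auto
  thus ?thesis by (simp only: eps_def fps_nth_Abs_fps sum.empty)
qed

text \<open>Passing from n to n + 1 replaces the scaled coefficient b_i by (\<theta> b_i +
  b_(i-1)^q) / \<theta>^(q^i), and the numbers 1 / d_i are fixed by this rule. As Frobenius is
  additive, the errors obey it too, and each step divides their bound by q.\<close>

lemma cc_limit: "absval (cc n i / \<theta> ^ (n * q ^ i) - 1 / cd i) \<le> inverse (real q ^ n)"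
proof (induction n arbitrary: i)
  case 0
  show ?case
  proof (cases "i = 0")
    case False
    thus ?thesis
      using real_q_gt_1 by (simp add: absval_divide absval_cd field_simps)
  qed auto
next
  case (Suc n)
  define b where "b = (\<lambda>n i. cc n i / \<theta> ^ (n * q ^ i))"
  define \<delta> where "\<delta> = (\<lambda>n i. b n i - 1 / cd i)"
  have IH: "absval (\<delta> n i) \<le> inverse (real q ^ n)" for i
    using Suc by (simp add: \<delta>_def b_def)
  have "absval (\<delta> (Suc n) i) \<le> inverse (real q ^ Suc n)"
  proof (cases i)
    case 0
    have "\<delta> (Suc n) 0 = 0"
      unfolding \<delta>_def b_def cc_n_0 by simp
    thus ?thesis using 0 by simp
  next
    case (Suc j)
    have 1: "b (Suc n) i = \<theta> * b n i / \<theta> ^ (q ^ i) + b n j ^ q / \<theta> ^ (q ^ i)"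
    proof -
      have "(\<theta> ^ (n * q ^ j)) ^ q = \<theta> ^ (n * q ^ i)"
        by (simp add: Suc mult_ac flip: power_mult)
      moreover have "\<theta> ^ (Suc n * q ^ i) = \<theta> ^ (n * q ^ i) * \<theta> ^ (q ^ i)"
        by (simp add: power_add)
      ultimately show ?thesis
        using Suc by (simp add: b_def power_divide add_divide_distrib)
    qed
    have 2: "1 / cd i = \<theta> * (1 / cd i) / \<theta> ^ (q ^ i) + (1 / cd j) ^ q / \<theta> ^ (q ^ i)"
    proof -
      have "\<theta> ^ q ^ i - \<theta> \<noteq> 0"
        using absval_theta_diff[of 0 i] Suc real_q_pos
        by (metis absval_0 order_less_irrefl power_0 power_one_right zero_less_Suc zero_less_power)
      have "(\<theta> ^ q ^ i - \<theta>) * (1 / cd i) = (1 / cd j) ^ q"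
        using \<open>\<theta> ^ q ^ i - \<theta> \<noteq> 0\<close> by (simp add: Suc cd_Suc power_divide)
      hence "\<theta> ^ q ^ i * (1 / cd i) = \<theta> * (1 / cd i) + (1 / cd j) ^ q"
        by (simp add: algebra_simps)
      hence "1 / cd i = (\<theta> * (1 / cd i) + (1 / cd j) ^ q) / \<theta> ^ (q ^ i)"
        by (metis nonzero_mult_div_cancel_left power_not_zero theta_nz)
      thus ?thesis
        by (simp only: add_divide_distrib)
    qed
    have "b n j ^ q - (1 / cd j) ^ q = \<delta> n j ^ q"
      using frob_diff[of "b n j" "1 / cd j" 1] by (simp add: \<delta>_def)
    moreover have "\<delta> (Suc n) i = \<theta> * \<delta> n i / \<theta> ^ (q ^ i) + (b n j ^ q - (1 / cd j) ^ q) / \<theta> ^ (q ^ i)"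
      unfolding \<delta>_def 1 by (subst 2) (simp only: right_diff_distrib diff_divide_distrib add_diff_add)
    ultimately have "\<delta> (Suc n) i = \<theta> * \<delta> n i / \<theta> ^ (q ^ i) + \<delta> n j ^ q / \<theta> ^ (q ^ i)"
      by simp
    hence eq: "absval (\<delta> (Suc n) i) \<le> max (absval (\<theta> * \<delta> n i / \<theta> ^ (q ^ i))) (absval (\<delta> n j ^ q / \<theta> ^ (q ^ i)))"
      by (metis absval_add_le)
    have "q \<le> q ^ i"
      unfolding Suc using q_gt_0 by simp
    with q_ge_2 have qi: "2 \<le> q ^ i"
      by (rule order_trans)
    have "absval (\<theta> * \<delta> n i / \<theta> ^ (q ^ i)) = real q * absval (\<delta> n i) / real q ^ (q ^ i)"
      by (simp add: absval_divide absval_mult absval_power absval_theta)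
    also have "\<dots> \<le> real q * inverse (real q ^ n) / real q ^ 2"
      using IH[of i] qi real_q_gt_1 by (intro frac_le mult_left_mono power_increasing) auto
    also have "\<dots> = inverse (real q ^ Suc n)"
      using real_q_pos by (simp add: power2_eq_square field_simps)
    finally have A: "absval (\<theta> * \<delta> n i / \<theta> ^ (q ^ i)) \<le> inverse (real q ^ Suc n)" .
    have "absval (\<delta> n j) ^ q \<le> absval (\<delta> n j) ^ 1"
    proof (rule power_decreasing)
      show "absval (\<delta> n j) \<le> 1"
        using IH[of j] real_q_gt_1 by (meson inverse_le_1_iff order_trans one_le_power less_imp_le)
    qed (use q_gt_0 in auto)
    hence le: "absval (\<delta> n j) ^ q \<le> inverse (real q ^ n)"
      using IH[of j] by simp
    have "absval (\<delta> n j ^ q / \<theta> ^ (q ^ i)) = absval (\<delta> n j) ^ q / real q ^ (q ^ i)"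
      by (simp add: absval_divide absval_power absval_theta)
    also have "\<dots> \<le> inverse (real q ^ n) / real q ^ 1"
      using le qi real_q_gt_1 by (intro frac_le power_increasing) auto
    also have "\<dots> = inverse (real q ^ Suc n)"
      using real_q_pos by (simp add: field_simps)
    finally show ?thesis
      using A eq by simp
  qed
  thus ?case
    by (simp add: \<delta>_def b_def)
qed

lemma cc_tendsto: "(\<lambda>n. cc n i / \<theta> ^ (n * q ^ i)) \<longlonglongrightarrow> 1 / cd i"
proof -
  have "(\<lambda>n. absval (cc n i / \<theta> ^ (n * q ^ i) - 1 / cd i)) \<longlonglongrightarrow> 0"
    using cc_limit[of _ i]
    by (intro Lim_null_comparison[OF _ inverse_q_power_tendsto[of 1]]) simp
  hence "(\<lambda>n. cc n i / \<theta> ^ (n * q ^ i) - 1 / cd i) \<longlonglongrightarrow> 0"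
    by (rule tendsto_absval_0I)
  from tendsto_add[OF this tendsto_const[of "1 / cd i"]] show ?thesis
    by simp
qed

lemma Cl_yv_nth_power: "fps_nth (Cl n (yv d)) (q ^ i) = cc n i / \<theta> ^ (d * q ^ i)"
  and Cl_yv_nth_other: "(\<And>i. m \<noteq> q ^ i) \<Longrightarrow> fps_nth (Cl n (yv d)) m = 0"
proof -
  have *: "fps_nth (Cl n (yv d)) m = (\<Sum>j\<le>n. if q ^ j = m then cc n j / \<theta> ^ (d * m) else 0)" for m
    unfolding Cl_def yv_def fps_sum_nth
    by (intro sum.cong)
       (auto simp: power_mult_distrib fps_const_power power_mult divide_inverse power_inverse)
  show "fps_nth (Cl n (yv d)) (q ^ i) = cc n i / \<theta> ^ (d * q ^ i)"
    unfolding * by (simp add: cc_eq_0)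
  show "fps_nth (Cl n (yv d)) m = 0" if "\<And>i. m \<noteq> q ^ i"
    unfolding * using that by (intro sum.neutral) (metis (mono_tags))
qed

lemma fconv_Cl:
  assumes "k \<ge> 0"
  shows   "fconv (\<lambda>d. Cl (nat (int d - k)) (yv d)) (eps k)"
  unfolding fconv_def
proof
  fix m
  show "(\<lambda>d. fps_nth (Cl (nat (int d - k)) (yv d)) m) \<longlonglongrightarrow> fps_nth (eps k) m"
  proof (cases "\<exists>i. m = q ^ i")
    case True
    then obtain i where m: "m = q ^ i" by blast
    obtain k' where k: "k = int k'"
      using assms by (metis nonneg_int_cases)
    have "(\<lambda>n. cc n i / \<theta> ^ (n * q ^ i) * (1 / \<theta> ^ (k' * q ^ i))) \<longlonglongrightarrow> 1 / cd i * (1 / \<theta> ^ (k' * q ^ i))"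
      by (intro tendsto_mult cc_tendsto tendsto_const)
    also have "(\<lambda>n. cc n i / \<theta> ^ (n * q ^ i) * (1 / \<theta> ^ (k' * q ^ i))) = (\<lambda>n. fps_nth (Cl (nat (int (n + k') - k)) (yv (n + k'))) m)"
      by (simp add: fun_eq_iff m k Cl_yv_nth_power add_mult_distrib power_add)
    also have "1 / cd i * (1 / \<theta> ^ (k' * q ^ i)) = fps_nth (eps k) m"
      unfolding m eps_nth_power k power_int_minus of_nat_mult[symmetric] power_int_of_nat
      by (simp add: divide_inverse mult.commute)
    finally show ?thesis
      by (rule LIMSEQ_offset)
  next
    case False
    thus ?thesis
      by (simp add: Cl_yv_nth_other eps_nth_other)
  qed
qed

text \<open>The series in y of the sum over a of e^\<mu>(a) / (\<pi> (z - a) + y).\<close>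

definition Qf :: "int multiset \<Rightarrow> 'c \<Rightarrow> 'c fps" where
  "Qf \<mu> z = Abs_fps (\<lambda>n. (- 1) ^ n * (\<Sum>\<^sub>\<infinity>a. em \<mu> (A_emb \<iota> a) * inverse (\<pi> * (z - A_emb \<iota> a)) ^ Suc n))"

lemma absval_em_A_le: "absval (em \<mu> (A_emb \<iota> a)) \<le> real q ^ size \<mu>"
proof (induction \<mu>)
  case (add k \<mu>)
  have "absval (E k (A_emb \<iota> a)) * absval (em \<mu> (A_emb \<iota> a)) \<le> real q * real q ^ size \<mu>"
    using add E_A_le_q by (intro mult_mono) auto
  thus ?case by (simp add: absval_mult)
qed auto

lemma finite_inverse_A_ge:
  assumes "e > 0"
  shows   "finite {a. e \<le> c * inverse (absval (\<pi> * (z - A_emb \<iota> a))) ^ Suc n}"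
proof (cases "c > 0")
  case True
  \<comment> \<open>Taking \<open>B\<close> at least 1 makes B <= B^(n+1), so the bound passes from
    the power to its base.\<close>
  define B where "B = max 1 (c / e)"
  have "absval (A_emb \<iota> a) \<le> max (absval z) (B / absval \<pi>)"
    if a: "e \<le> c * inverse (absval (\<pi> * (z - A_emb \<iota> a))) ^ Suc n" for a
  proof -
    let ?x = "absval (\<pi> * (z - A_emb \<iota> a))"
    have "?x \<noteq> 0"
      using a assms by (intro notI) auto
    hence x: "?x > 0"
      by (simp add: less_le)
    have "?x ^ Suc n \<le> c / e"
      using a x assms True by (simp add: field_simps power_inverse)
    also have "\<dots> \<le> B"
      by (simp add: B_def)
    also have "B \<le> B ^ Suc n"
      using self_le_power[of B "Suc n"] by (simp add: B_def)
    finally have "?x \<le> B"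
      by (rule power_le_imp_le_base) (simp add: B_def)
    hence "absval (z - A_emb \<iota> a) \<le> B / absval \<pi>"
      unfolding absval_mult by (simp add: pos_le_divide_eq mult.commute)
    thus ?thesis
      using absval_diff_le[of z "z - A_emb \<iota> a"] by auto
  qed
  hence "{a. e \<le> c * inverse (absval (\<pi> * (z - A_emb \<iota> a))) ^ Suc n}
      \<subseteq> {a. absval (A_emb \<iota> a) \<le> max (absval z) (B / absval \<pi>)}"
    by (intro Collect_mono impI)
  thus ?thesis
    by (rule finite_subset) (rule finite_A_le)
next
  case False
  have "c * inverse (absval (\<pi> * (z - A_emb \<iota> a))) ^ Suc n \<le> 0" for a
    using False by (intro mult_nonpos_nonneg) auto
  hence "{a. e \<le> c * inverse (absval (\<pi> * (z - A_emb \<iota> a))) ^ Suc n} = {}"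
    using assms by (auto simp: not_le intro: le_less_trans)
  thus ?thesis by simp
qed

lemma Qf_has_sum:
  "((\<lambda>a. em \<mu> (A_emb \<iota> a) * inverse (\<pi> * (z - A_emb \<iota> a)) ^ Suc n)
     has_sum ((- 1) ^ n * fps_nth (Qf \<mu> z) n)) UNIV"
proof -
  have "(\<lambda>a. em \<mu> (A_emb \<iota> a) * inverse (\<pi> * (z - A_emb \<iota> a)) ^ Suc n) summable_on UNIV"
  proof (rule summable_on_ultrametricI)
    fix e :: real assume e: "e > 0"
    have "absval (em \<mu> (A_emb \<iota> a) * inverse (\<pi> * (z - A_emb \<iota> a)) ^ Suc n)
        \<le> real q ^ size \<mu> * inverse (absval (\<pi> * (z - A_emb \<iota> a))) ^ Suc n" for a
      unfolding absval_mult[of "em _ _"] absval_power absval_inverse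
      by (intro mult_right_mono absval_em_A_le) auto
    hence "{a \<in> UNIV. e \<le> absval (em \<mu> (A_emb \<iota> a) * inverse (\<pi> * (z - A_emb \<iota> a)) ^ Suc n)}
        \<subseteq> {a. e \<le> real q ^ size \<mu> * inverse (absval (\<pi> * (z - A_emb \<iota> a))) ^ Suc n}"
      by (auto intro: order_trans)
    thus "finite {a \<in> UNIV. e \<le> absval (em \<mu> (A_emb \<iota> a) * inverse (\<pi> * (z - A_emb \<iota> a)) ^ Suc n)}"
      by (rule finite_subset) (rule finite_inverse_A_ge[OF e])
  qed
  from has_sum_infsum[OF this] show ?thesis
    by (simp add: Qf_def mult.assoc[symmetric] flip: power_mult_distrib)
qed

lemma fconv_Qf:
  assumes z: "z \<notin> range (A_emb \<iota>)"
  shows "fconv (\<lambda>d. \<Sum>a\<in>Ad d. fps_const (em \<mu> (A_emb \<iota> a)) * geom (av d (z - A_emb \<iota> a))) (Qf \<mu> z)"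
  unfolding fconv_def
proof
  fix n
  define g where "g = (\<lambda>a. real q ^ size \<mu> * inverse (absval (\<pi> * (z - A_emb \<iota> a))) ^ Suc n)"
  define f where "f = (\<lambda>d a. if a \<in> Ad d then em \<mu> (A_emb \<iota> a) * inverse (av d (z - A_emb \<iota> a)) ^ Suc n else 0)"
  define s where "s = (\<lambda>d. \<Sum>a\<in>Ad d. em \<mu> (A_emb \<iota> a) * inverse (av d (z - A_emb \<iota> a)) ^ Suc n)"
  have "s \<longlonglongrightarrow> (- 1) ^ n * fps_nth (Qf \<mu> z) n"
  proof (rule has_sum_tendsto_dominated[where A = UNIV and g = g and f = f])
    show "finite {a \<in> UNIV. e \<le> g a}" if "e > 0" for e
      using finite_inverse_A_ge[OF that] by (simp add: g_def)
    \<comment> \<open>For d >= N and a in \<open>Ad d\<close> the points z - a lie where e_d scales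
      sizes exactly, so \<open>av d (z - A_emb \<iota> a)\<close> has the size of its limit, and
      \<open>g\<close> is a majorant independent of d.\<close>
    obtain N where N: "absval z < real q ^ N"
      using real_arch_pow[OF real_q_gt_1] by blast
    have "absval (f d a) \<le> g a" if d: "d \<ge> N" for d a
    proof (cases "a \<in> Ad d")
      case True
      have "real q ^ N \<le> real q ^ d"
        using d real_q_gt_1 by (intro power_increasing) auto
      hence "absval (z - A_emb \<iota> a) < real q ^ d"
        using N True absval_diff_le[of z "A_emb \<iota> a"] by (auto simp: Ad_iff)
      hence "absval (f d a) = absval (em \<mu> (A_emb \<iota> a)) * inverse (absval (\<pi> * (z - A_emb \<iota> a))) ^ Suc n"
        using True by (simp add: f_def absval_mult[of "em _ _"] absval_mult[of "inverse _"] absval_power absval_inverse absval_av del: power_Suc)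
      also have "\<dots> \<le> g a"
        unfolding g_def by (intro mult_right_mono absval_em_A_le) auto
      finally show ?thesis .
    qed (auto simp: f_def g_def)
    thus "eventually (\<lambda>d. \<forall>a\<in>UNIV. absval (f d a) \<le> g a) sequentially"
      by (auto simp: eventually_sequentially)
    fix a
    have nz: "\<pi> * (z - A_emb \<iota> a) \<noteq> 0"
      using z by auto
    have "(\<lambda>d. em \<mu> (A_emb \<iota> a) * inverse (av d (z - A_emb \<iota> a)) ^ Suc n)
        \<longlonglongrightarrow> em \<mu> (A_emb \<iota> a) * inverse (\<pi> * (z - A_emb \<iota> a)) ^ Suc n"
      by (intro tendsto_mult tendsto_const tendsto_power_strong tendsto_inverse_ultrametric av_tendsto nz)
    moreover have "eventually (\<lambda>d. em \<mu> (A_emb \<iota> a) * inverse (av d (z - A_emb \<iota> a)) ^ Suc n = f d a) sequentially"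
      using eventually_gt_at_top[of "degree a"] by eventually_elim (simp add: f_def Ad_def)
    ultimately show "(\<lambda>d. f d a) \<longlonglongrightarrow> em \<mu> (A_emb \<iota> a) * inverse (\<pi> * (z - A_emb \<iota> a)) ^ Suc n"
      by (rule Lim_transform_eventually)
  next
    fix d
    have "((\<lambda>a. em \<mu> (A_emb \<iota> a) * inverse (av d (z - A_emb \<iota> a)) ^ Suc n) has_sum s d) (Ad d)"
      unfolding s_def by (rule has_sum_finite[OF finite_Ad])
    thus "(f d has_sum s d) UNIV"
      by (rule iffD1[OF has_sum_cong_neutral, rotated -1]) (auto simp: f_def)
  next
    show "((\<lambda>a. em \<mu> (A_emb \<iota> a) * inverse (\<pi> * (z - A_emb \<iota> a)) ^ Suc n)
     has_sum ((- 1) ^ n * fps_nth (Qf \<mu> z) n)) UNIV"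
      by (rule Qf_has_sum)
  qed
  from tendsto_mult[OF tendsto_const[of "(- 1) ^ n"] this]
  have "(\<lambda>d. (- 1) ^ n * s d) \<longlonglongrightarrow> fps_nth (Qf \<mu> z) n"
    by (simp add: mult.assoc[symmetric] flip: power_mult_distrib)
  also have "(\<lambda>d. (- 1) ^ n * s d) = (\<lambda>d. fps_nth (\<Sum>a\<in>Ad d. fps_const (em \<mu> (A_emb \<iota> a)) * geom (av d (z - A_emb \<iota> a))) n)"
    by (simp add: s_def fps_sum_nth geom_def sum_distrib_left mult_ac)
  finally show "(\<lambda>d. fps_nth (\<Sum>a\<in>Ad d. fps_const (em \<mu> (A_emb \<iota> a)) * geom (av d (z - A_emb \<iota> a))) n) \<longlonglongrightarrow> fps_nth (Qf \<mu> z) n" .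
qed

text \<open>The limit of \<open>partial_fractions_level\<close> as d grows. It writes e^\<mu>(z + y
  / \<pi>) as e_0(z + y / \<pi>) times the sum over a of e^\<mu>(a) / (\<pi> (z - a) + y), as series
  in y.\<close>

lemma partial_fractions:
  assumes "\<And>k. k \<in># \<mu> \<Longrightarrow> 1 \<le> k" "wt q \<mu> < 1" and z: "z \<notin> range (A_emb \<iota>)"
  shows "(\<Prod>k\<in>#\<mu>. fps_const (E k z) + eps k) = (fps_const (E 0 z) + eps 0) * Qf \<mu> z"
proof (rule fconv_unique)
  show "fconv (\<lambda>d. \<Prod>k\<in>#\<mu>. fps_const (E k z) + Cl (nat (int d - k)) (yv d)) (\<Prod>k\<in>#\<mu>. fps_const (E k z) + eps k)"
    using assms(1) by (intro fconv_prod_mset fconv_add fconv_const fconv_Cl) force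
  have "fconv (\<lambda>d. Cl d (yv d)) (eps 0)"
    using fconv_Cl[of 0] by simp
  thus "fconv (\<lambda>d. (fps_const (E 0 z) + Cl d (yv d)) * (\<Sum>a\<in>Ad d. fps_const (em \<mu> (A_emb \<iota> a)) * geom (av d (z - A_emb \<iota> a))))
      ((fps_const (E 0 z) + eps 0) * Qf \<mu> z)"
    by (intro fconv_mult fconv_add fconv_const fconv_Qf z)
  obtain M where M: "\<And>k. k \<in># \<mu> \<Longrightarrow> k \<le> int M"
  proof
    fix k assume "k \<in># \<mu>"
    hence "k \<le> Max (insert 0 (set_mset \<mu>))" "0 \<le> Max (insert 0 (set_mset \<mu>))"
      by auto
    thus "k \<le> int (nat (Max (insert 0 (set_mset \<mu>))))"
      by simp
  qed
  show "eventually (\<lambda>d. (\<Prod>k\<in>#\<mu>. fps_const (E k z) + Cl (nat (int d - k)) (yv d)) =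
      (fps_const (E 0 z) + Cl d (yv d)) * (\<Sum>a\<in>Ad d. fps_const (em \<mu> (A_emb \<iota> a)) * geom (av d (z - A_emb \<iota> a)))) sequentially"
    using eventually_ge_at_top[of M]
  proof eventually_elim
    case (elim d)
    have "k \<le> int d" if "k \<in># \<mu>" for k
      using M[OF that] elim by simp
    thus ?case
      by (intro partial_fractions_level assms)
  qed
qed

end

section \<open>Independence of the variables\<close>

locale carlitz_vars = carlitz_gauss \<iota> \<pi> q \<kappa> t S
  for \<iota> :: "'f::{finite,field} fls \<Rightarrow> 'c::complete_ultrametric_field" and \<pi> :: 'c and q :: nat
    and \<kappa> :: "'c \<Rightarrow> 'k::complete_ultrametric_field" and t :: "nat \<Rightarrow> 'k" and S :: "nat set" +
  assumes finite_S: "finite S"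
begin

lemma absval_mpoly_eval: "P \<in> mpolys S \<Longrightarrow> absval (mpoly_eval \<kappa> t P) = gauss_norm P"
  using gauss by (auto simp: gauss_completion_def)

lemma absval_t:
  assumes "i \<in> S"
  shows   "absval (t i) = 1"
proof -
  let ?P = "Poly_Mapping.single (Poly_Mapping.single i 1) 1 :: (nat \<Rightarrow>\<^sub>0 nat) \<Rightarrow>\<^sub>0 'c"
  have "absval (mpoly_eval \<kappa> t ?P) = gauss_norm ?P"
    using assms by (intro absval_mpoly_eval) (auto simp: mpolys_def)
  moreover have "?P \<noteq> 0"
    by (metis lookup_single_eq lookup_zero one_neq_zero)
  ultimately show ?thesis
    by (simp add: mpoly_eval_def gauss_norm_def)
qed

definition mon :: "(nat \<Rightarrow> int) \<Rightarrow> (nat \<Rightarrow>\<^sub>0 nat)" where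
  "mon k = Abs_poly_mapping (\<lambda>i. if i \<in> S then nat (k i - 1) else 0)"

definition tk :: "(nat \<Rightarrow> int) \<Rightarrow> 'k" where
  "tk k = (\<Prod>i\<in>S. t i ^ nat (k i - 1))"

abbreviation Kf :: "(nat \<Rightarrow> int) set" where "Kf \<equiv> PiE S (\<lambda>_. {1..})"

lemma lookup_mon: "Poly_Mapping.lookup (mon k) i = (if i \<in> S then nat (k i - 1) else 0)"
proof -
  have "finite {i. (if i \<in> S then nat (k i - 1) else 0) \<noteq> 0}"
    by (rule finite_subset[OF _ finite_S]) auto
  thus ?thesis
    unfolding mon_def by (subst Abs_poly_mapping_inverse) auto
qed

lemma keys_mon: "Poly_Mapping.keys (mon k) \<subseteq> S"
  by (auto simp: in_keys_iff lookup_mon split: if_splits)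

lemma mon_inj: "inj_on mon Kf"
proof (rule inj_onI)
  fix k k' assume k: "k \<in> Kf" "k' \<in> Kf" "mon k = mon k'"
  show "k = k'"
  proof (rule PiE_ext[OF k(1,2)])
    fix i assume i: "i \<in> S"
    have "nat (k i - 1) = nat (k' i - 1)"
      using arg_cong[OF k(3), of "\<lambda>m. Poly_Mapping.lookup m i"] i by (simp add: lookup_mon)
    thus "k i = k' i"
      using PiE_mem[OF k(1) i] PiE_mem[OF k(2) i] by simp
  qed
qed

lemma tk_mon: "(\<Prod>i\<in>Poly_Mapping.keys (mon k). t i ^ Poly_Mapping.lookup (mon k) i) = tk k"
proof -
  have "(\<Prod>i\<in>Poly_Mapping.keys (mon k). t i ^ Poly_Mapping.lookup (mon k) i) = (\<Prod>i\<in>S. t i ^ Poly_Mapping.lookup (mon k) i)"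
    by (rule prod.mono_neutral_left[OF finite_S keys_mon]) (auto simp: in_keys_iff)
  thus ?thesis
    by (simp add: tk_def lookup_mon)
qed

lemma absval_tk: "absval (tk k) = 1"
  unfolding tk_def absval_prod absval_power by (intro prod.neutral) (simp add: absval_t)

text \<open>The finite sum is the value of a polynomial with distinct monomials, and its Gauss norm
  is the largest coefficient.\<close>

lemma absval_finite_sum_ge:
  assumes "finite X" "X \<subseteq> Kf" "k0 \<in> X"
  shows   "absval (c k0) \<le> absval (\<Sum>k\<in>X. \<kappa> (c k) * tk k)"
proof (cases "c k0 = 0")
  case False
  define C where "C = (\<lambda>\<mu>. if \<mu> \<in> mon ` X then c (the_inv_into X mon \<mu>) else 0)"
  have inj: "inj_on mon X"
    using mon_inj assms(2) by (rule inj_on_subset)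
  have C: "C (mon k) = c k" if "k \<in> X" for k
    using that the_inv_into_f_f[OF inj] by (simp add: C_def)
  define P where "P = Abs_poly_mapping C"
  have "finite {\<mu>. C \<mu> \<noteq> 0}"
    by (rule finite_subset[of _ "mon ` X"]) (use assms(1) in \<open>auto simp: C_def\<close>)
  hence lookup: "Poly_Mapping.lookup P = C"
    by (simp add: P_def Abs_poly_mapping_inverse)
  have keys: "Poly_Mapping.keys P \<subseteq> mon ` X"
    by (auto simp: in_keys_iff lookup C_def split: if_splits)
  hence "P \<in> mpolys S"
    using keys_mon by (auto simp: mpolys_def)
  hence norm: "absval (mpoly_eval \<kappa> t P) = gauss_norm P"
    by (rule absval_mpoly_eval)
  have "mpoly_eval \<kappa> t P = (\<Sum>\<mu>\<in>mon ` X. \<kappa> (C \<mu>) * (\<Prod>i\<in>Poly_Mapping.keys \<mu>. t i ^ Poly_Mapping.lookup \<mu> i))"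
    unfolding mpoly_eval_def lookup
    by (rule sum.mono_neutral_left) (use assms(1) keys in \<open>auto simp: in_keys_iff lookup\<close>)
  also have "\<dots> = (\<Sum>k\<in>X. \<kappa> (c k) * tk k)"
    by (simp add: sum.reindex[OF inj] C tk_mon)
  finally have eval: "mpoly_eval \<kappa> t P = (\<Sum>k\<in>X. \<kappa> (c k) * tk k)" .
  have key: "mon k0 \<in> Poly_Mapping.keys P"
    using False assms(3) by (simp add: in_keys_iff lookup C)
  hence "absval (Poly_Mapping.lookup P (mon k0)) \<le> gauss_norm P"
    by (auto simp: gauss_norm_def intro!: Max_ge)
  thus ?thesis
    using assms(3) by (simp add: lookup C norm[symmetric] eval)
qed auto

text \<open>Terms with coefficient smaller than half of |c k0| cannot cancel the finite remaining
  part, whose size is bounded below by the Gauss norm.\<close>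

lemma power_series_nonzero:
  assumes I: "I \<subseteq> Kf" and sum: "((\<lambda>k. \<kappa> (c k) * tk k) has_sum s) I"
    and fin: "\<And>e. e > 0 \<Longrightarrow> finite {k\<in>I. e \<le> absval (c k)}"
    and k0: "k0 \<in> I" "c k0 \<noteq> 0"
  shows "s \<noteq> 0"
proof
  assume s: "s = 0"
  define e where "e = absval (c k0)"
  have e: "e > 0"
    using k0 by (simp add: e_def)
  define X where "X = {k\<in>I. e / 2 \<le> absval (c k)}"
  have X: "finite X" "X \<subseteq> I" "k0 \<in> X"
    using fin[of "e / 2"] e k0 by (auto simp: X_def e_def)
  have "((\<lambda>k. \<kappa> (c k) * tk k) has_sum (s - (\<Sum>k\<in>X. \<kappa> (c k) * tk k))) (I - X)"
    by (intro has_sum_Diff sum X has_sum_finite)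
  hence "absval (s - (\<Sum>k\<in>X. \<kappa> (c k) * tk k)) \<le> e / 2"
    by (rule has_sum_absval_le) (use e in \<open>auto simp: X_def absval_mult absval_kappa absval_tk\<close>)
  moreover have "e \<le> absval (\<Sum>k\<in>X. \<kappa> (c k) * tk k)"
    unfolding e_def using X I by (intro absval_finite_sum_ge) auto
  ultimately show False
    using e by (simp add: s)
qed

section \<open>Interpolation of \<open>a(t\<^sub>i)\<close>\<close>

definition chi :: "nat \<Rightarrow> 'c \<Rightarrow> 'k" where
  "chi i z = (\<Sum>\<^sub>\<infinity>k\<in>{1..}. \<kappa> (E k z) * t i ^ nat (k - 1))"

lemma absval_chi_term: "i \<in> S \<Longrightarrow> absval (\<kappa> (E k z) * t i ^ n) = absval (E k z)"
  by (simp add: absval_mult absval_kappa absval_power absval_t)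

lemma finite_E_ge:
  assumes "e > 0"
  shows   "finite {k\<in>{1..}. e \<le> absval (E k z)}"
proof -
  have "finite ((\<lambda>k. {#k#}) -` {\<mu>. size \<mu> \<le> 1 \<and> (\<forall>k\<in>#\<mu>. 1 \<le> k) \<and> e \<le> absval (em \<mu> z)})"
    by (intro finite_vimageI finite_em_ge assms) (auto simp: inj_on_def)
  thus ?thesis
    by (rule rev_finite_subset) auto
qed

lemma chi_has_sum:
  assumes "i \<in> S"
  shows   "((\<lambda>k. \<kappa> (E k z) * t i ^ nat (k - 1)) has_sum chi i z) {1..}"
  unfolding chi_def using finite_E_ge assms
  by (intro has_sum_infsum summable_on_ultrametricI) (simp add: absval_chi_term)

lemma chi_add: "i \<in> S \<Longrightarrow> chi i (x + y) = chi i x + chi i y"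
  using has_sum_unique[OF chi_has_sum[of i "x + y"]] has_sum_add[OF chi_has_sum[of i x] chi_has_sum[of i y]]
  by (simp add: E_add kap.emb_add algebra_simps)

lemma chi_const: "i \<in> S \<Longrightarrow> chi i (\<iota> (fls_const c) * x) = \<kappa> (\<iota> (fls_const c)) * chi i x"
  using has_sum_unique[OF chi_has_sum[of i "\<iota> (fls_const c) * x"]]
    has_sum_cmult_right[OF chi_has_sum[of i x], of "\<kappa> (\<iota> (fls_const c))"]
  by (simp add: E_const kap.emb_mult mult.assoc)

text \<open>As e_k(\<theta> x) = e_(k-1)(x), the series is shifted by one index. This yields the
  factor t_i and a new first term e_0(x), which vanishes on A.\<close>

lemma chi_theta:
  assumes "i \<in> S"
  shows   "chi i (\<theta> * x) = \<kappa> (E 0 x) + t i * chi i x"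
proof -
  have "((\<lambda>k. t i * (\<kappa> (E k x) * t i ^ nat (k - 1))) has_sum (t i * chi i x)) {1..}"
    by (rule has_sum_cmult_right[OF chi_has_sum[OF assms]])
  also have "?this \<longleftrightarrow> ((\<lambda>k. \<kappa> (E k (\<theta> * x)) * t i ^ nat (k - 1)) has_sum (t i * chi i x)) {2..}"
    by (rule has_sum_reindex_bij_witness[of _ "\<lambda>k. k - 1" "\<lambda>k. k + 1"])
       (auto simp: E_theta nat_add_distrib[symmetric] power_Suc[symmetric] Suc_nat_eq_nat_zadd1 simp del: power_Suc)
  finally have 1: "((\<lambda>k. \<kappa> (E k (\<theta> * x)) * t i ^ nat (k - 1)) has_sum (t i * chi i x)) {2..}" .
  have 2: "((\<lambda>k. \<kappa> (E k (\<theta> * x)) * t i ^ nat (k - 1)) has_sum \<kappa> (E 0 x)) {1}"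
    using has_sum_finite[of "{1}" "\<lambda>k. \<kappa> (E k (\<theta> * x)) * t i ^ nat (k - 1)"] by (simp add: E_theta)
  have "((\<lambda>k. \<kappa> (E k (\<theta> * x)) * t i ^ nat (k - 1)) has_sum (\<kappa> (E 0 x) + t i * chi i x)) ({1} \<union> {2..})"
    by (rule has_sum_Un_disjoint[OF 2 1]) auto
  also have "{1} \<union> {2..} = {1 :: int..}"
    by auto
  finally show ?thesis
    using has_sum_unique[OF chi_has_sum[OF assms]] by blast
qed

text \<open>The Anderson-Thakur function evaluated at t_i.\<close>

abbreviation om :: "nat \<Rightarrow> 'k" where "om i \<equiv> chi i 1"

lemma A_at_pCons: "A_at \<iota> \<kappa> x (pCons c a) = \<kappa> (\<iota> (fls_const c)) + x * A_at \<iota> \<kappa> x a"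
  by (simp add: A_at_def map_poly_pCons)

lemma chi_A:
  assumes "i \<in> S"
  shows   "chi i (A_emb \<iota> a) = A_at \<iota> \<kappa> (t i) a * om i"
proof (induction a)
  case 0
  have "chi i 0 = 0"
    using chi_add[OF assms, of 0 0] by (metis add.right_neutral add_left_cancel)
  thus ?case by (simp add: A_at_def)
next
  case (pCons c a)
  thus ?case
    using chi_const[OF assms, of c 1]
    by (simp add: A_emb_pCons A_at_pCons chi_add[OF assms] chi_theta[OF assms] algebra_simps)
qed

lemma absval_A_at:
  assumes "i \<in> S"
  shows   "absval (A_at \<iota> \<kappa> (t i) a) \<le> 1"
proof (induction a)
  case (pCons c a)
  have "absval (\<kappa> (\<iota> (fls_const c))) \<le> 1"
    using absval_const[of c] by (cases "c = 0") (auto simp: absval_kappa)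
  moreover have "absval (t i * A_at \<iota> \<kappa> (t i) a) \<le> 1"
    using pCons by (simp add: absval_mult absval_t[OF assms])
  ultimately show ?case
    unfolding A_at_pCons using absval_add_le[of "\<kappa> (\<iota> (fls_const c))" "t i * A_at \<iota> \<kappa> (t i) a"] by simp
qed (simp add: A_at_def)

text \<open>The sizes of e_k(1) decrease strictly from k = 1 on, so the first term cannot be
  cancelled.\<close>

lemma om_nz:
  assumes "i \<in> S"
  shows   "om i \<noteq> 0"
proof
  assume om: "om i = 0"
  have abs_E: "absval (E k 1) = absval \<pi> / real q powi k" if "k \<ge> 1" for k
  proof -
    have "real q powi 0 < real q powi k"
      using that real_q_gt_1 by (intro power_int_strict_increasing) auto
    thus ?thesis
      using absval_E[of 1 k] by simp
  qed
  let ?f = "\<lambda>k. \<kappa> (E k 1) * t i ^ nat (k - 1)"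
  have "(?f has_sum (om i - ?f 1)) ({1..} - {1})"
    using has_sum_finite[of "{1}" ?f] by (intro has_sum_Diff chi_has_sum assms) auto
  hence "absval (om i - ?f 1) \<le> absval \<pi> / real q powi 2"
  proof (rule has_sum_absval_le)
    fix k :: int assume k: "k \<in> {1..} - {1}"
    have "real q powi 2 \<le> real q powi k"
      using k real_q_gt_1 by (intro power_int_increasing) auto
    thus "absval (?f k) \<le> absval \<pi> / real q powi 2"
      using k q_powi_pos by (simp add: absval_chi_term[OF assms] abs_E divide_left_mono del: power_int_numeral)
  qed auto
  moreover have "absval (?f 1) = absval \<pi> / real q"
    by (simp add: absval_kappa abs_E)
  moreover have "absval \<pi> / real q powi 2 < absval \<pi> / real q"
    using real_q_gt_1 by (simp add: power2_eq_square divide_strict_left_mono)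
  ultimately show False
    unfolding om by (metis absval_minus diff_0 leD)
qed

definition ms :: "(nat \<Rightarrow> int) \<Rightarrow> int multiset" where
  "ms k = image_mset k (mset_set S)"

lemma em_ms: "em (ms k) z = (\<Prod>i\<in>S. E (k i) z)"
  by (simp add: em_def ms_def image_mset.compositionality comp_def prod_unfold_prod_mset)

lemma size_ms: "size (ms k) = card S"
  by (simp add: ms_def)

lemma set_ms: "set_mset (ms k) = k ` S"
  using finite_S by (simp add: ms_def)

lemma finite_ms_fibre: "finite {k\<in>Kf. ms k = \<nu>}"
proof (rule finite_subset)
  show "{k\<in>Kf. ms k = \<nu>} \<subseteq> PiE S (\<lambda>_. set_mset \<nu>)"
  proof clarify
    fix k assume "k \<in> Kf"
    thus "k \<in> PiE S (\<lambda>_. set_mset (ms k))"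
      by (simp add: PiE_iff set_ms)
  qed
qed (intro finite_PiE finite_S finite_set_mset)

text \<open>Different labellings of one multiset give different monomials in the t_i, so nothing
  cancels inside this sum.\<close>

definition Gc :: "int multiset \<Rightarrow> 'k" where
  "Gc \<nu> = (\<Sum>k\<in>{k\<in>Kf. ms k = \<nu>}. tk k)"

lemma mrep_prod_chi: "mrep (\<lambda>z. \<Prod>i\<in>S. chi i z) Gc"
proof -
  have sum: "((\<lambda>k. tk k * \<kappa> (em (ms k) z)) has_sum (\<Prod>i\<in>S. chi i z)) Kf" for z
  proof -
    obtain C where C: "C \<ge> 1" "\<And>k. k \<ge> 1 \<Longrightarrow> absval (E k z) \<le> C * real q powi (- k)"
      using E_bound[of 1 z] by blast
    have "absval (E k z) \<le> C" if "k \<ge> 1" for k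
    proof -
      have "real q powi (- k) \<le> real q powi 0"
        using that real_q_gt_1 by (intro power_int_increasing) auto
      hence "C * real q powi (- k) \<le> C * 1"
        using C(1) by (intro mult_left_mono) auto
      thus ?thesis
        using C(2)[OF that] by simp
    qed
    hence "((\<lambda>k. \<Prod>i\<in>S. \<kappa> (E (k i) z) * t i ^ nat (k i - 1)) has_sum (\<Prod>i\<in>S. chi i z)) Kf"
      using has_sum_prod_PiE[OF finite_S, where f = "\<lambda>i k. \<kappa> (E k z) * t i ^ nat (k - 1)"
          and s = "\<lambda>i. chi i z" and B = "{1..}" and C = "\<lambda>_. C"]
        chi_has_sum finite_E_ge C(1) by (simp add: absval_chi_term)
    thus ?thesis
      by (simp add: em_ms tk_def kap.emb_prod prod.distrib mult.commute)
  qed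
  have "mrep (\<lambda>z. \<Prod>i\<in>S. chi i z) (\<lambda>\<nu>. \<Sum>\<^sub>\<infinity>k\<in>{k\<in>Kf. ms k = \<nu>}. tk k)"
    by (rule mrep_family[where L = "card S" and K = 1 and B = 1])
       (use sum finite_ms_fibre in \<open>auto simp: size_ms set_ms absval_tk intro: summable_on_finite\<close>)
  also have "(\<lambda>\<nu>. \<Sum>\<^sub>\<infinity>k\<in>{k\<in>Kf. ms k = \<nu>}. tk k) = Gc"
    unfolding Gc_def by (intro ext infsum_finite finite_ms_fibre)
  finally show ?thesis .
qed

lemma Gc_nz: "Gc \<nu> \<noteq> 0 \<Longrightarrow> size \<nu> = card S"
  unfolding Gc_def using size_ms by (metis (mono_tags, lifting) mem_Collect_eq sum.neutral)

definition Om :: 'k where "Om = (\<Prod>i\<in>S. om i)"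

lemma Om_nz: "Om \<noteq> 0"
  using finite_S om_nz by (simp add: Om_def)

text \<open>
  Monomials containing some \<open>e\<^sub>k\<close> with \<open>k \<le> 0\<close> vanish on \<open>A\<close> and can be dropped.  The remaining
  reduced monomials have exponents less than 1.
\<close>

lemma exists_interpolation:
  "\<exists>F B. B \<ge> 1 \<and> (\<forall>\<mu>. absval (F \<mu>) \<le> B) \<and>
     (\<forall>\<mu>. F \<mu> \<noteq> 0 \<longrightarrow> base_reduced q \<mu> \<and> size \<mu> \<le> card S \<and> (\<forall>k\<in>#\<mu>. 1 \<le> k)) \<and>
     (\<forall>\<mu>. base_reduced q \<mu> \<longrightarrow> size \<mu> = card S \<longrightarrow> (\<forall>k\<in>#\<mu>. 1 \<le> k) \<longrightarrow> F \<mu> = Gc \<mu>) \<and>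
     (\<forall>a. ((\<lambda>\<mu>. F \<mu> * \<kappa> (em \<mu> (A_emb \<iota> a))) has_sum (Om * (\<Prod>i\<in>S. A_at \<iota> \<kappa> (t i) a))) UNIV)"
proof -
  obtain F where F: "mrep (\<lambda>z. \<Prod>i\<in>S. chi i z) F"
    "\<And>\<mu>. F \<mu> \<noteq> 0 \<Longrightarrow> base_reduced q \<mu> \<and> size \<mu> \<le> card S"
    "\<And>\<mu>. base_reduced q \<mu> \<Longrightarrow> size \<mu> = card S \<Longrightarrow> F \<mu> = Gc \<mu>"
    using reduce_expansion[OF mrep_prod_chi, of "card S"] Gc_nz by force
  obtain B where B: "B \<ge> 1" "\<And>\<mu>. absval (F \<mu>) \<le> B"
    using mrepE[OF F(1)] by metis
  define F' where "F' = (\<lambda>\<mu>. if \<forall>k\<in>#\<mu>. 1 \<le> k then F \<mu> else 0)"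
  have "((\<lambda>\<mu>. F' \<mu> * \<kappa> (em \<mu> (A_emb \<iota> a))) has_sum (Om * (\<Prod>i\<in>S. A_at \<iota> \<kappa> (t i) a))) UNIV" for a
  proof -
    have eq: "F \<mu> * \<kappa> (em \<mu> (A_emb \<iota> a)) = F' \<mu> * \<kappa> (em \<mu> (A_emb \<iota> a))" for \<mu>
    proof (cases "\<forall>k\<in>#\<mu>. 1 \<le> k")
      case False
      then obtain k where k: "k \<in># \<mu>" "k \<le> 0"
        by force
      then obtain \<nu> where "\<mu> = add_mset k \<nu>"
        using multi_member_split by metis
      thus ?thesis using k by simp
    qed (simp add: F'_def)
    have "(\<Prod>i\<in>S. chi i (A_emb \<iota> a)) = Om * (\<Prod>i\<in>S. A_at \<iota> \<kappa> (t i) a)"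
      by (simp add: chi_A prod.distrib Om_def mult.commute)
    thus ?thesis
      using mrep_has_sum[OF F(1), of "A_emb \<iota> a"] by (simp add: eq)
  qed
  moreover have "\<forall>\<mu>. absval (F' \<mu>) \<le> B"
    using B by (simp add: F'_def)
  moreover have "\<forall>\<mu>. F' \<mu> \<noteq> 0 \<longrightarrow> base_reduced q \<mu> \<and> size \<mu> \<le> card S \<and> (\<forall>k\<in>#\<mu>. 1 \<le> k)"
    using F(2) by (simp add: F'_def)
  moreover have "\<forall>\<mu>. base_reduced q \<mu> \<longrightarrow> size \<mu> = card S \<longrightarrow> (\<forall>k\<in>#\<mu>. 1 \<le> k) \<longrightarrow> F' \<mu> = Gc \<mu>"
    using F(3) by (simp add: F'_def)
  ultimately show ?thesis
    using B(1) by blast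
qed

end

subsection \<open>The coefficients of the translated interpolation\<close>

context carlitz_gauss
begin

definition xe :: "int multiset \<Rightarrow> 'c fps" where
  "xe \<beta> = (\<Prod>k\<in>#\<beta>. eps k)"

lemma xe_empty [simp]: "xe {#} = 1" and xe_add_mset [simp]: "xe (add_mset k \<beta>) = eps k * xe \<beta>"
  by (simp_all add: xe_def)

lemma absval_eps_nth:
  assumes "k \<ge> 0"
  shows   "absval (fps_nth (eps k) m) \<le> real q powi (- k)"
proof (cases "\<exists>i. m = q ^ i")
  case True
  then obtain i where m: "m = q ^ i" by blast
  have "absval (fps_nth (eps k) m) = real q powi (- (k * int (q ^ i))) / real q ^ (i * q ^ i)"
    unfolding m eps_nth_power absval_divide absval_power_int absval_theta absval_cd ..
  also have "\<dots> \<le> real q powi (- (k * int (q ^ i))) / 1"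
    using real_q_gt_1 q_powi_pos[of "- (k * int (q ^ i))"] by (intro divide_left_mono) auto
  also have "k * 1 \<le> k * int (q ^ i)"
    using assms q_gt_0 by (intro mult_left_mono) (simp_all add: Suc_le_eq del: of_nat_power)
  hence "real q powi (- (k * int (q ^ i))) / 1 \<le> real q powi (- k)"
    using real_q_gt_1 by (auto intro!: power_int_increasing)
  finally show ?thesis .
next
  case False
  thus ?thesis
    using q_powi_pos[of "- k"] by (simp add: eps_nth_other less_imp_le)
qed

lemma absval_xe_nth: "(\<forall>k\<in>#\<beta>. 0 \<le> k) \<Longrightarrow> absval (fps_nth (xe \<beta>) m) \<le> qm \<beta>"
proof (induction \<beta> arbitrary: m)
  case (add k \<beta>)
  have "absval (fps_nth (eps k) i * fps_nth (xe \<beta>) j) \<le> real q powi (- k) * qm \<beta>" for i j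
    unfolding absval_mult using add absval_eps_nth[of k i] q_powi_pos[of "- k"]
    by (intro mult_mono) auto
  thus ?case
    using q_powi_pos[of "- k"] qm_pos[of \<beta>] by (auto simp: fps_mult_nth intro!: absval_sum_le)
qed (auto simp: fps_one_nth)

lemma eps_nth_nz: "fps_nth (eps k) m \<noteq> 0 \<Longrightarrow> \<exists>i. m = q ^ i"
  using eps_nth_other by blast

text \<open>An exponent that occurs in a product of r of these series is a sum of r powers of q, and
  carrying never raises the number of summands.\<close>

lemma xe_nth_nz:
  assumes "fps_nth (xe \<beta>) n \<noteq> 0"
  shows   "digit_sum q (real n) \<le> size \<beta>"
proof -
  have "\<exists>\<alpha>. size \<alpha> = size \<beta> \<and> real n = wt q \<alpha>"
    using assms
  proof (induction \<beta> arbitrary: n)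
    case empty
    thus ?case by (intro exI[of _ "{#}"]) (auto simp: fps_one_nth split: if_splits)
  next
    case (add k \<beta>)
    have "(\<Sum>j=0..n. fps_nth (eps k) j * fps_nth (xe \<beta>) (n - j)) \<noteq> 0"
      using add.prems by (simp add: fps_mult_nth)
    then obtain j where j: "j \<in> {0..n}" "fps_nth (eps k) j * fps_nth (xe \<beta>) (n - j) \<noteq> 0"
      by (rule sum.not_neutral_contains_not_neutral)
    obtain i where i: "j = q ^ i"
      using eps_nth_nz[of k j] j by auto
    obtain \<alpha> where "size \<alpha> = size \<beta>" "real (n - j) = wt q \<alpha>"
      using add.IH[of "n - j"] j by auto
    thus ?case
      using j(1) by (intro exI[of _ "add_mset (- int i) \<alpha>"]) (auto simp: i of_nat_diff)
  qed
  thus ?thesis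
    using digit_sum_wt_le[OF q_ge_2] by metis
qed

text \<open>
  With the new index \<open>k\<close> large, the term of the smallest exponent \<open>q\<^sup>i\<close> dominates the others.
\<close>

lemma exists_xe_nth_nz:
  assumes "digit_sum q (real n) = r"
  shows   "\<exists>\<beta>. size \<beta> = r \<and> (\<forall>k\<in>#\<beta>. M < k) \<and> fps_nth (xe \<beta>) n \<noteq> 0"
  using assms
proof (induction r arbitrary: n)
  case 0
  obtain \<mu> where \<mu>: "base_reduced q \<mu>" "wt q \<mu> = real n"
    using exists_reduced[OF q_ge_2, of "replicate_mset n 0"] by (auto simp: wt_replicate)
  hence "size \<mu> = 0"
    using 0 digit_sum_wt[OF q_ge_2] by metis
  hence "n = 0"
    using \<mu> by simp
  thus ?case
    by (intro exI[of _ "{#}"]) simp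
next
  case (Suc r)
  obtain i0 where i0: "q ^ i0 \<le> n" "digit_sum q (real (n - q ^ i0)) = r"
    using digit_sum_nat_pred[OF q_ge_2 Suc.prems] by metis
  obtain \<beta> where \<beta>: "size \<beta> = r" "\<forall>k\<in>#\<beta>. M < k" "fps_nth (xe \<beta>) (n - q ^ i0) \<noteq> 0"
    using Suc.IH[OF i0(2)] by blast
  define J where "J = {i. q ^ i \<le> n \<and> fps_nth (xe \<beta>) (n - q ^ i) \<noteq> 0}"
  have "J \<subseteq> {..n}"
    unfolding J_def using self_le_q_power order_trans by blast
  hence finJ: "finite J"
    by (rule finite_subset) simp
  have J0: "i0 \<in> J"
    using i0 \<beta> by (simp add: J_def)
  define i1 where "i1 = Min J"
  have i1: "i1 \<in> J" "\<And>i. i \<in> J \<Longrightarrow> i1 \<le> i"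
    unfolding i1_def using finJ J0 by (auto intro: Min_in)
  define a where "a = (\<lambda>i. fps_nth (xe \<beta>) (n - q ^ i) / cd i)"
  have a1: "absval (a i1) > 0"
    using i1(1) by (simp add: a_def J_def)
  define D where "D = Max (insert 0 ((\<lambda>i. absval (a i)) ` J))"
  have D: "absval (a i) \<le> D" if "i \<in> J" for i
    unfolding D_def using finJ that by (intro Max_ge) auto
  \<comment> \<open>For i > i1 the power of \<theta> in \<open>T i\<close> is smaller than the one
    in \<open>T i1\<close> by at least the factor q^k. So \<open>T i1\<close> dominates once q^k
    exceeds the ratio of the remaining factors.\<close>
  obtain k0 :: nat where k0: "D / absval (a i1) < real q ^ k0"
    using real_arch_pow[OF real_q_gt_1] by blast
  define k where "k = int (k0 + nat M + 1)"
  have kM: "M < k"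
    by (simp add: k_def)
  have "real q ^ k0 \<le> real q powi k"
    unfolding k_def power_int_of_nat using real_q_gt_1 by (intro power_increasing) auto
  hence "absval (a i1) * real q ^ k0 \<le> absval (a i1) * real q powi k"
    by (intro mult_left_mono) auto
  moreover have "D < absval (a i1) * real q ^ k0"
    using k0 a1 by (simp add: pos_divide_less_eq mult.commute)
  ultimately have kD: "D < absval (a i1) * real q powi k"
    by linarith
  define T where "T = (\<lambda>i. \<theta> powi (- (k * int (q ^ i))) * a i)"
  have "fps_nth (xe (add_mset k \<beta>)) n = (\<Sum>j=0..n. fps_nth (eps k) j * fps_nth (xe \<beta>) (n - j))"
    by (simp add: fps_mult_nth)
  also have "\<dots> = (\<Sum>j\<in>(\<lambda>i. q ^ i) ` J. fps_nth (eps k) j * fps_nth (xe \<beta>) (n - j))"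
  proof (rule sum.mono_neutral_right)
    show "(\<lambda>i. q ^ i) ` J \<subseteq> {0..n}"
      by (auto simp: J_def)
    show "\<forall>j\<in>{0..n} - (\<lambda>i. q ^ i) ` J. fps_nth (eps k) j * fps_nth (xe \<beta>) (n - j) = 0"
    proof
      fix j assume j: "j \<in> {0..n} - (\<lambda>i. q ^ i) ` J"
      show "fps_nth (eps k) j * fps_nth (xe \<beta>) (n - j) = 0"
        using eps_nth_nz[of k j] j by (auto simp: J_def)
    qed
  qed auto
  also have "\<dots> = (\<Sum>i\<in>J. T i)"
    by (subst sum.reindex) (auto simp: inj_on_def eps_nth_power T_def a_def)
  also have "\<dots> = T i1 + (\<Sum>i\<in>J - {i1}. T i)"
    using finJ i1(1) by (rule sum.remove)
  finally have sum: "fps_nth (xe (add_mset k \<beta>)) n = T i1 + (\<Sum>i\<in>J - {i1}. T i)" .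
  have absT: "absval (T i) = real q powi (- (k * int (q ^ i))) * absval (a i)" for i
    by (simp add: T_def absval_mult absval_power_int absval_theta)
  have T1: "absval (T i1) > 0"
    unfolding absT using a1 q_powi_pos by (intro mult_pos_pos)
  have "absval (\<Sum>i\<in>J - {i1}. T i) < absval (T i1)"
  proof (rule absval_sum_less[OF _ T1])
    fix i assume i: "i \<in> J - {i1}"
    hence "i1 < i"
      using i1(2)[of i] by auto
    hence "q ^ i1 < q ^ i"
      using q_gt_1 by (intro power_strict_increasing) auto
    hence "int (q ^ i1) + 1 \<le> int (q ^ i)"
      by linarith
    hence "k * (int (q ^ i1) + 1) \<le> k * int (q ^ i)"
      by (intro mult_left_mono) (auto simp: k_def)
    hence le: "- (k * int (q ^ i)) \<le> - (k * int (q ^ i1)) - k"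
      by (simp add: algebra_simps)
    have "absval (T i) \<le> real q powi (- (k * int (q ^ i1)) - k) * D"
      unfolding absT using le D[of i] i real_q_gt_1 q_powi_pos
      by (intro mult_mono power_int_increasing) (auto intro: less_imp_le)
    also have "\<dots> < real q powi (- (k * int (q ^ i1)) - k) * (absval (a i1) * real q powi k)"
      by (intro mult_strict_left_mono kD q_powi_pos)
    also have "\<dots> = absval (T i1)"
      unfolding absT using real_q_pos by (simp add: power_int_diff)
    finally show "absval (T i) < absval (T i1)" .
  qed
  hence "absval (fps_nth (xe (add_mset k \<beta>)) n) = absval (T i1)"
    unfolding sum by (rule absval_add_eq_left)
  hence "fps_nth (xe (add_mset k \<beta>)) n \<noteq> 0"
    using T1 by auto
  thus ?case
    using \<beta> kM by (intro exI[of _ "add_mset k \<beta>"]) auto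
qed

end

subsection \<open>Sub-multisets by positions\<close>

text \<open>
  Choosing positions in the sorted list instead of sub-multisets avoids binomial coefficients, which
  could vanish in characteristic \<open>p\<close>.
\<close>

definition sel :: "int multiset \<Rightarrow> nat set \<Rightarrow> int multiset" where
  "sel \<mu> X = image_mset (\<lambda>p. sorted_list_of_multiset \<mu> ! p) (mset_set X)"

abbreviation pos :: "int multiset \<Rightarrow> nat set" where "pos \<mu> \<equiv> {..<size \<mu>}"

lemma length_sorted_list_of_multiset [simp]: "length (sorted_list_of_multiset \<mu>) = size \<mu>"
  by (metis mset_sorted_list_of_multiset size_mset)

lemma sel_pos: "sel \<mu> (pos \<mu>) = \<mu>"
proof -
  let ?ks = "sorted_list_of_multiset \<mu>"
  have "sel \<mu> (pos \<mu>) = mset (map (\<lambda>p. ?ks ! p) [0..<length ?ks])"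
    by (simp add: sel_def lessThan_atLeast0)
  thus ?thesis
    by (simp only: map_nth mset_sorted_list_of_multiset)
qed

lemma sel_union: "finite X \<Longrightarrow> finite Y \<Longrightarrow> X \<inter> Y = {} \<Longrightarrow> sel \<mu> (X \<union> Y) = sel \<mu> X + sel \<mu> Y"
  by (simp add: sel_def mset_set_Union)

lemma size_sel: "finite X \<Longrightarrow> size (sel \<mu> X) = card X"
  by (simp add: sel_def)

lemma sel_split:
  assumes "X \<subseteq> pos \<mu>"
  shows   "sel \<mu> X + sel \<mu> (pos \<mu> - X) = \<mu>"
proof -
  have "sel \<mu> (X \<union> (pos \<mu> - X)) = sel \<mu> X + sel \<mu> (pos \<mu> - X)"
    using finite_subset[OF assms] by (intro sel_union) auto
  moreover have "X \<union> (pos \<mu> - X) = pos \<mu>"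
    using assms by auto
  ultimately show ?thesis
    by (simp add: sel_pos)
qed

lemma sel_subset: "X \<subseteq> pos \<mu> \<Longrightarrow> sel \<mu> X \<subseteq># \<mu>"
  by (metis sel_split mset_subset_eq_add_left)

lemma sel_filter:
  "sel \<mu> {p\<in>pos \<mu>. P (sorted_list_of_multiset \<mu> ! p)} = filter_mset P \<mu>"
proof -
  have "filter_mset P \<mu> = filter_mset P (sel \<mu> (pos \<mu>))"
    by (simp only: sel_pos)
  also have "\<dots> = image_mset (\<lambda>p. sorted_list_of_multiset \<mu> ! p)
      (filter_mset (\<lambda>p. P (sorted_list_of_multiset \<mu> ! p)) (mset_set (pos \<mu>)))"
    by (simp add: sel_def filter_mset_image_mset)
  finally show ?thesis
    by (simp add: sel_def)
qed

lemma prod_mset_add_pos: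
  fixes f g :: "int \<Rightarrow> 'r :: comm_semiring_1"
  shows "(\<Prod>k\<in>#\<mu>. f k + g k) = (\<Sum>X\<in>Pow (pos \<mu>). (\<Prod>k\<in>#sel \<mu> X. f k) * (\<Prod>k\<in>#sel \<mu> (pos \<mu> - X). g k))"
proof -
  let ?k = "\<lambda>p. sorted_list_of_multiset \<mu> ! p"
  have *: "(\<Prod>k\<in>#sel \<mu> X. h k) = (\<Prod>p\<in>X. h (?k p))" for h :: "int \<Rightarrow> 'r" and X
    by (simp add: sel_def image_mset.compositionality comp_def prod_unfold_prod_mset)
  have "(\<Prod>k\<in>#\<mu>. f k + g k) = (\<Prod>p\<in>pos \<mu>. f (?k p) + g (?k p))"
    using *[of "\<lambda>k. f k + g k" "pos \<mu>"] by (simp add: sel_pos)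
  thus ?thesis
    by (simp add: prod_add *)
qed

section \<open>The series as a polynomial in \<open>u\<close>\<close>

lemma minus_one_power_cancel: "(- 1) ^ m * ((- 1) ^ m * x) = (x :: 'a :: comm_ring_1)"
  by (simp add: mult.assoc[symmetric] flip: power_mult_distrib)

lemma has_sum_finite_sum:
  fixes f :: "'i \<Rightarrow> 'j \<Rightarrow> 'a :: topological_comm_monoid_add"
  assumes "\<And>i. i \<in> A \<Longrightarrow> (f i has_sum s i) X"
  shows   "((\<lambda>x. \<Sum>i\<in>A. f i x) has_sum (\<Sum>i\<in>A. s i)) X"
  using assms by (induction A rule: infinite_finite_induct) (auto intro: has_sum_add)

context carlitz_gauss
begin

text \<open>The coefficients form a sequence that is zero beyond N, so that polynomials of different
  degrees in u can be added coefficientwise.\<close>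

definition upoly :: "('c \<Rightarrow> 'k) \<Rightarrow> bool" where
  "upoly h \<longleftrightarrow> (\<exists>N g. (\<forall>i. g i \<in> tame) \<and> (\<forall>i>N. g i = (\<lambda>_. 0)) \<and>
     (\<forall>z. z \<notin> range (A_emb \<iota>) \<longrightarrow> h z = (\<Sum>i\<le>N. g i z * \<kappa> (u_fun \<iota> \<pi> z) ^ i)))"

lemma upolyI_tame: "h \<in> tame \<Longrightarrow> upoly h"
  unfolding upoly_def
  by (intro exI[of _ 0] exI[of _ "\<lambda>i. if i = 0 then h else (\<lambda>_. 0)"]) (auto simp: tame_0)

lemma upoly_cong: "(\<And>z. z \<notin> range (A_emb \<iota>) \<Longrightarrow> h z = h' z) \<Longrightarrow> upoly h' \<Longrightarrow> upoly h"
  unfolding upoly_def by (elim exE) (intro exI, auto)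

lemma upoly_add:
  assumes "upoly h" "upoly h'"
  shows   "upoly (\<lambda>z. h z + h' z)"
proof -
  obtain N g where g: "\<And>i. g i \<in> tame" "\<And>i. i > N \<Longrightarrow> g i = (\<lambda>_. 0)"
    "\<And>z. z \<notin> range (A_emb \<iota>) \<Longrightarrow> h z = (\<Sum>i\<le>N. g i z * \<kappa> (u_fun \<iota> \<pi> z) ^ i)"
    using assms(1) unfolding upoly_def by blast
  obtain N' g' where g': "\<And>i. g' i \<in> tame" "\<And>i. i > N' \<Longrightarrow> g' i = (\<lambda>_. 0)"
    "\<And>z. z \<notin> range (A_emb \<iota>) \<Longrightarrow> h' z = (\<Sum>i\<le>N'. g' i z * \<kappa> (u_fun \<iota> \<pi> z) ^ i)"
    using assms(2) unfolding upoly_def by blast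
  have 1: "(\<Sum>i\<le>N. g i z * x ^ i) = (\<Sum>i\<le>max N N'. g i z * x ^ i)" for z and x :: 'k
    by (rule sum.mono_neutral_left) (auto simp: g(2))
  have 2: "(\<Sum>i\<le>N'. g' i z * x ^ i) = (\<Sum>i\<le>max N N'. g' i z * x ^ i)" for z and x :: 'k
    by (rule sum.mono_neutral_left) (auto simp: g'(2))
  show ?thesis
    unfolding upoly_def
    by (intro exI[of _ "max N N'"] exI[of _ "\<lambda>i z. g i z + g' i z"])
       (auto simp: g g' 1 2 tame_add distrib_right sum.distrib)
qed

lemma upoly_cmult:
  assumes "upoly h"
  shows   "upoly (\<lambda>z. c * h z)"
proof -
  obtain N g where g: "\<And>i. g i \<in> tame" "\<And>i. i > N \<Longrightarrow> g i = (\<lambda>_. 0)"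
    "\<And>z. z \<notin> range (A_emb \<iota>) \<Longrightarrow> h z = (\<Sum>i\<le>N. g i z * \<kappa> (u_fun \<iota> \<pi> z) ^ i)"
    using assms unfolding upoly_def by blast
  show ?thesis
    unfolding upoly_def
    by (intro exI[of _ N] exI[of _ "\<lambda>i z. c * g i z"])
       (auto simp: g tame_cmult sum_distrib_left mult.assoc)
qed

lemma upoly_sum: "(\<And>i. i \<in> A \<Longrightarrow> upoly (h i)) \<Longrightarrow> upoly (\<lambda>z. \<Sum>i\<in>A. h i z)"
  by (induction A rule: infinite_finite_induct) (auto intro: upoly_add upolyI_tame tame_0)

lemma upoly_mult_u:
  assumes "upoly h"
  shows   "upoly (\<lambda>z. \<kappa> (u_fun \<iota> \<pi> z) * h z)"
proof -
  obtain N g where g: "\<And>i. g i \<in> tame" "\<And>i. i > N \<Longrightarrow> g i = (\<lambda>_. 0)"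
    "\<And>z. z \<notin> range (A_emb \<iota>) \<Longrightarrow> h z = (\<Sum>i\<le>N. g i z * \<kappa> (u_fun \<iota> \<pi> z) ^ i)"
    using assms unfolding upoly_def by blast
  define g' where "g' = (\<lambda>i. if i = 0 then (\<lambda>_. 0) else g (i - 1))"
  have "\<kappa> (u_fun \<iota> \<pi> z) * h z = (\<Sum>i\<le>Suc N. g' i z * \<kappa> (u_fun \<iota> \<pi> z) ^ i)" if "z \<notin> range (A_emb \<iota>)" for z
    unfolding g(3)[OF that]
    by (subst sum.atMost_Suc_shift) (simp add: g'_def sum_distrib_left mult_ac)
  thus ?thesis
    unfolding upoly_def
    by (intro exI[of _ "Suc N"] exI[of _ g']) (auto simp: g'_def g tame_0)
qed

lemma sel_nonneg:
  assumes "\<forall>k\<in>#\<mu>. 1 \<le> k" "X \<subseteq> pos \<mu>"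
  shows   "\<forall>k\<in>#sel \<mu> X. 1 \<le> k"
  using sel_subset[OF assms(2)] assms(1) mset_subset_eqD by metis

lemma qm_le_1: "\<forall>k\<in>#\<mu>. 0 \<le> k \<Longrightarrow> qm \<mu> \<le> 1"
  using qm_le[of \<mu> 0 "size \<mu>" 1] by simp

end

text \<open>Fixes one family as supplied by \<open>exists_interpolation\<close>, so that the
  definitions below may refer to it.\<close>

locale carlitz_interpolation = carlitz_vars \<iota> \<pi> q \<kappa> t S
  for \<iota> :: "'f::{finite,field} fls \<Rightarrow> 'c::complete_ultrametric_field" and \<pi> :: 'c and q :: nat
    and \<kappa> :: "'c \<Rightarrow> 'k::complete_ultrametric_field" and t :: "nat \<Rightarrow> 'k" and S :: "nat set" +
  fixes F :: "int multiset \<Rightarrow> 'k" and B :: real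
  assumes B: "1 \<le> B" "\<And>\<mu>. absval (F \<mu>) \<le> B"
    and F_supp: "\<And>\<mu>. F \<mu> \<noteq> 0 \<Longrightarrow> base_reduced q \<mu> \<and> size \<mu> \<le> card S \<and> (\<forall>k\<in>#\<mu>. 1 \<le> k)"
    and F_top: "\<And>\<mu>. base_reduced q \<mu> \<Longrightarrow> size \<mu> = card S \<Longrightarrow> (\<forall>k\<in>#\<mu>. 1 \<le> k) \<Longrightarrow> F \<mu> = Gc \<mu>"
    and F_sum: "\<And>a. ((\<lambda>\<mu>. F \<mu> * \<kappa> (em \<mu> (A_emb \<iota> a))) has_sum (Om * (\<Prod>i\<in>S. A_at \<iota> \<kappa> (t i) a))) UNIV"
begin

abbreviation Apr :: "'f poly \<Rightarrow> 'k" where "Apr a \<equiv> \<Prod>i\<in>S. A_at \<iota> \<kappa> (t i) a"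

lemma absval_Apr: "absval (Apr a) \<le> 1"
  unfolding absval_prod by (intro prod_le_1) (auto simp: absval_A_at)

text \<open>
  Up to the nonzero constant \<open>Om\<close>, \<open>Psi m z\<close> is the coefficient of \<open>y\<^sup>m\<close> in the formal translate
  \<open>\<Sum> a(t) / (\<pi> (z - a) + y)\<close>.
\<close>

definition Psi :: "nat \<Rightarrow> 'c \<Rightarrow> 'k" where
  "Psi m z = (- 1) ^ m * (\<Sum>\<^sub>\<infinity>a. Om * Apr a * \<kappa> (inverse (\<pi> * (z - A_emb \<iota> a)) ^ Suc m))"

lemma absval_Psi_term:
  "absval (Om * Apr a * \<kappa> (inverse (\<pi> * (z - A_emb \<iota> a)) ^ Suc m))
     \<le> absval Om * inverse (absval (\<pi> * (z - A_emb \<iota> a))) ^ Suc m"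
proof -
  have "absval (Om * Apr a * \<kappa> (inverse (\<pi> * (z - A_emb \<iota> a)) ^ Suc m))
      = (absval Om * inverse (absval (\<pi> * (z - A_emb \<iota> a))) ^ Suc m) * absval (Apr a)"
    unfolding absval_mult[of "Om * _"] absval_mult[of Om] absval_kappa absval_power absval_inverse
    by (simp add: mult_ac)
  also have "\<dots> \<le> (absval Om * inverse (absval (\<pi> * (z - A_emb \<iota> a))) ^ Suc m) * 1"
    by (intro mult_left_mono absval_Apr) auto
  finally show ?thesis by simp
qed

lemma Psi_has_sum:
  "((\<lambda>a. Om * Apr a * \<kappa> (inverse (\<pi> * (z - A_emb \<iota> a)) ^ Suc m)) has_sum ((- 1) ^ m * Psi m z)) UNIV"
proof -
  have "(\<lambda>a. Om * Apr a * \<kappa> (inverse (\<pi> * (z - A_emb \<iota> a)) ^ Suc m)) summable_on UNIV"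
  proof (rule summable_on_ultrametricI)
    fix e :: real assume e: "e > 0"
    show "finite {a\<in>UNIV. e \<le> absval (Om * Apr a * \<kappa> (inverse (\<pi> * (z - A_emb \<iota> a)) ^ Suc m))}"
      by (rule finite_subset[OF _ finite_inverse_A_ge[OF e, of "absval Om" z m]])
         (use absval_Psi_term order_trans in blast)
  qed
  from has_sum_infsum[OF this] show ?thesis
    by (simp add: Psi_def mult.assoc[symmetric] flip: power_mult_distrib)
qed

lemma Psi_psi: "Psi m z = ((- 1) ^ m * Om * \<kappa> (inverse \<pi>) ^ Suc m) * psi \<iota> \<kappa> t S (1 + m) z"
proof -
  have c: "Om * \<kappa> (inverse \<pi>) ^ Suc m \<noteq> 0"
    using Om_nz by simp
  have "((\<lambda>a. Om * Apr a * \<kappa> (inverse (\<pi> * (z - A_emb \<iota> a)) ^ Suc m)) has_sum ((- 1) ^ m * Psi m z)) UNIV"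
    by (rule Psi_has_sum)
  also have "(\<lambda>a. Om * Apr a * \<kappa> (inverse (\<pi> * (z - A_emb \<iota> a)) ^ Suc m))
      = (\<lambda>a. (Om * \<kappa> (inverse \<pi>) ^ Suc m) * (\<kappa> (inverse ((z - A_emb \<iota> a) ^ (1 + m))) * Apr a))"
    by (simp add: fun_eq_iff inverse_mult_distrib power_mult_distrib kap.emb_mult kap.emb_power kap.emb_inverse power_inverse mult_ac)
  finally have "((\<lambda>a. \<kappa> (inverse ((z - A_emb \<iota> a) ^ (1 + m))) * Apr a)
      has_sum (((- 1) ^ m * Psi m z) / (Om * \<kappa> (inverse \<pi>) ^ Suc m))) UNIV"
    using has_sum_cmult_right_iff[OF c] by blast
  hence "psi \<iota> \<kappa> t S (1 + m) z = ((- 1) ^ m * Psi m z) / (Om * \<kappa> (inverse \<pi>) ^ Suc m)"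
    unfolding psi_def by (rule infsumI)
  hence eq: "(- 1) ^ m * Psi m z = (Om * \<kappa> (inverse \<pi>) ^ Suc m) * psi \<iota> \<kappa> t S (1 + m) z"
    using c by simp
  have "Psi m z = (- 1) ^ m * ((- 1) ^ m * Psi m z)"
    by (simp add: minus_one_power_cancel)
  thus ?thesis
    by (simp only: eq mult.assoc)
qed

lemma absval_F_em_A: "absval (F \<mu> * \<kappa> (em \<mu> (A_emb \<iota> a))) \<le> B * real q ^ card S"
proof (cases "F \<mu> = 0")
  case False
  have "absval (em \<mu> (A_emb \<iota> a)) \<le> real q ^ size \<mu>"
    by (rule absval_em_A_le)
  also have "\<dots> \<le> real q ^ card S"
    using F_supp[OF False] real_q_gt_1 by (intro power_increasing) auto
  finally show ?thesis
    unfolding absval_mult absval_kappa using B by (intro mult_mono) auto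
qed (use B in auto)

lemma F_bsupp: "bsupp (card S) 1 F"
  using F_supp by (auto simp: bsupp_def)

text \<open>The values of the interpolation at the points of A are expanded into monomials, and the
  sum over a is carried out first.\<close>

lemma Qf_sum: "((\<lambda>\<mu>. F \<mu> * \<kappa> (fps_nth (Qf \<mu> z) m)) has_sum Psi m z) UNIV"
proof -
  define w where "w = (\<lambda>a. inverse (\<pi> * (z - A_emb \<iota> a)) ^ Suc m)"
  have w: "absval (w a) = inverse (absval (\<pi> * (z - A_emb \<iota> a))) ^ Suc m" for a
    by (simp only: w_def absval_power absval_inverse)
  have "((\<lambda>\<mu>. F \<mu> * \<kappa> ((- 1) ^ m * fps_nth (Qf \<mu> z) m)) has_sum ((- 1) ^ m * Psi m z)) UNIV"
  proof (rule has_sum_ultrametric_swap)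
    show "((\<lambda>\<mu>. F \<mu> * \<kappa> (em \<mu> (A_emb \<iota> a)) * \<kappa> (w a)) has_sum (Om * Apr a * \<kappa> (w a))) UNIV" for a
      by (rule has_sum_cmult_left[OF F_sum])
    show "((\<lambda>a. F \<mu> * \<kappa> (em \<mu> (A_emb \<iota> a)) * \<kappa> (w a)) has_sum (F \<mu> * \<kappa> ((- 1) ^ m * fps_nth (Qf \<mu> z) m))) UNIV" for \<mu>
      using has_sum_cmult_right[OF has_sum_kappa[OF Qf_has_sum[of \<mu> z m]], of "F \<mu>"]
      unfolding w_def kap.emb_mult mult.assoc .
    show "((\<lambda>a. Om * Apr a * \<kappa> (w a)) has_sum ((- 1) ^ m * Psi m z)) UNIV"
      unfolding w_def by (rule Psi_has_sum)
    fix e :: real assume e: "e > 0"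
    \<comment> \<open>A uniform bound on the monomial values on A confines a to a finite set; for
      each such a only finitely many \<mu> remain.\<close>
    define c where "c = B * real q ^ card S"
    define X where "X = {a. e \<le> c * absval (w a)}"
    have X: "finite X"
      unfolding X_def w by (rule finite_inverse_A_ge[OF e])
    define Y where "Y = (\<lambda>a. {\<mu>. e / absval (w a) \<le> absval (F \<mu> * \<kappa> (em \<mu> (A_emb \<iota> a)))})"
    have Y: "finite (Y a)" if "w a \<noteq> 0" for a
      unfolding Y_def using that e B(1) by (intro mrep_finite[OF F_bsupp B(2)]) auto
    have "{(a, \<mu>). a \<in> UNIV \<and> \<mu> \<in> UNIV \<and> e \<le> absval (F \<mu> * \<kappa> (em \<mu> (A_emb \<iota> a)) * \<kappa> (w a))}
        \<subseteq> Sigma {a\<in>X. w a \<noteq> 0} Y"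
    proof safe
      fix a \<mu> assume le: "e \<le> absval (F \<mu> * \<kappa> (em \<mu> (A_emb \<iota> a)) * \<kappa> (w a))"
      hence le': "e \<le> absval (F \<mu> * \<kappa> (em \<mu> (A_emb \<iota> a))) * absval (w a)"
        by (simp only: absval_mult[of "F \<mu> * _"] absval_kappa)
      thus nz: "w a = 0 \<Longrightarrow> False"
        using e by auto
      have "absval (F \<mu> * \<kappa> (em \<mu> (A_emb \<iota> a))) * absval (w a) \<le> c * absval (w a)"
        unfolding c_def by (intro mult_right_mono absval_F_em_A) auto
      thus "a \<in> X"
        using le' by (simp add: X_def)
      have "absval (w a) > 0"
        using nz by auto
      thus "\<mu> \<in> Y a"
        using le' by (simp add: Y_def pos_divide_le_eq)
    qed
    moreover have "finite (Sigma {a\<in>X. w a \<noteq> 0} Y)"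
      using X Y by (intro finite_SigmaI) auto
    ultimately show "finite {(a, \<mu>). a \<in> UNIV \<and> \<mu> \<in> UNIV \<and> e \<le> absval (F \<mu> * \<kappa> (em \<mu> (A_emb \<iota> a)) * \<kappa> (w a))}"
      by (rule finite_subset)
  qed
  note sum = has_sum_cmult_right[OF this, of "(- 1) ^ m"]
  have sgn: "\<kappa> ((- 1) ^ m) = (- 1) ^ m"
    by (simp add: kap.emb_power kap.emb_minus)
  have eq: "(- 1) ^ m * (F \<mu> * \<kappa> ((- 1) ^ m * fps_nth (Qf \<mu> z) m)) = F \<mu> * \<kappa> (fps_nth (Qf \<mu> z) m)" for \<mu>
    by (simp only: kap.emb_mult sgn mult.left_commute[of "F \<mu>"] minus_one_power_cancel)
  show ?thesis
    using sum unfolding eq minus_one_power_cancel .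
qed

subsection \<open>The entire part\<close>

text \<open>A pair consists of a monomial and the set of positions at which e_k(z) is chosen when
  the product of the e_k(z) + \<open>eps k\<close> is expanded; the other positions contribute
  \<open>eps k\<close>.\<close>

definition J :: "(int multiset \<times> nat set) set" where
  "J = Sigma {\<mu>. F \<mu> \<noteq> 0} (\<lambda>\<mu>. Pow (pos \<mu>))"

definition cj :: "nat \<Rightarrow> int multiset \<times> nat set \<Rightarrow> 'k" where
  "cj m = (\<lambda>(\<mu>, X). F \<mu> * \<kappa> (fps_nth (xe (sel \<mu> (pos \<mu> - X))) m))"

definition nj :: "int multiset \<times> nat set \<Rightarrow> int multiset" where
  "nj = (\<lambda>(\<mu>, X). sel \<mu> X)"

text \<open>The coefficient of y^m in the interpolation translated by y / \<pi>, that is, in the sum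
  of \<open>F \<mu>\<close> times the product of the e_k(z) + \<open>eps k\<close>.\<close>

definition H :: "nat \<Rightarrow> 'c \<Rightarrow> 'k" where
  "H m z = (\<Sum>\<^sub>\<infinity>i\<in>J. cj m i * \<kappa> (em (nj i) z))"

definition \<Lambda> :: "nat \<Rightarrow> int multiset \<Rightarrow> 'k" where
  "\<Lambda> m \<nu> = (\<Sum>\<^sub>\<infinity>i\<in>{i\<in>J. nj i = \<nu>}. cj m i)"

lemma J_facts:
  assumes "(\<mu>, X) \<in> J"
  shows "F \<mu> \<noteq> 0" "X \<subseteq> pos \<mu>" "finite X" "base_reduced q \<mu>" "size \<mu> \<le> card S" "\<forall>k\<in>#\<mu>. 1 \<le> k"
    "\<forall>k\<in>#sel \<mu> X. 1 \<le> k" "\<forall>k\<in>#sel \<mu> (pos \<mu> - X). 1 \<le> k" "qm (sel \<mu> X) * qm (sel \<mu> (pos \<mu> - X)) = qm \<mu>"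
    "card X \<le> size \<mu>"
proof -
  show 1: "F \<mu> \<noteq> 0" "X \<subseteq> pos \<mu>"
    using assms by (auto simp: J_def)
  show "finite X"
    using 1(2) finite_subset by blast
  show "card X \<le> size \<mu>"
    using card_mono[OF _ 1(2)] by simp
  show "base_reduced q \<mu>" "size \<mu> \<le> card S" and 2: "\<forall>k\<in>#\<mu>. 1 \<le> k"
    using F_supp[OF 1(1)] by auto
  show "\<forall>k\<in>#sel \<mu> X. 1 \<le> k" "\<forall>k\<in>#sel \<mu> (pos \<mu> - X). 1 \<le> k"
    by (rule sel_nonneg[OF 2 1(2)], rule sel_nonneg[OF 2], rule Diff_subset)
  show "qm (sel \<mu> X) * qm (sel \<mu> (pos \<mu> - X)) = qm \<mu>"
    using sel_split[OF 1(2)] by (metis qm_union)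
qed

lemma absval_cj:
  assumes "(\<mu>, X) \<in> J"
  shows   "absval (cj m (\<mu>, X)) \<le> B * qm (sel \<mu> (pos \<mu> - X))"
proof -
  have "\<forall>k\<in>#sel \<mu> (pos \<mu> - X). 0 \<le> k"
    using J_facts(8)[OF assms] by force
  hence "absval (fps_nth (xe (sel \<mu> (pos \<mu> - X))) m) \<le> qm (sel \<mu> (pos \<mu> - X))"
    by (rule absval_xe_nth)
  thus ?thesis
    unfolding cj_def using B by (auto simp: absval_mult absval_kappa intro!: mult_mono)
qed

lemma finite_J_ge:
  assumes "e > 0"
  shows   "finite {(\<mu>, X)\<in>J. e \<le> qm \<mu>}"
proof (rule finite_subset)
  show "{(\<mu>, X)\<in>J. e \<le> qm \<mu>} \<subseteq> Sigma {\<mu>. size \<mu> \<le> card S \<and> (\<forall>k\<in>#\<mu>. 1 \<le> k) \<and> e \<le> qm \<mu>} (\<lambda>\<mu>. Pow (pos \<mu>))"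
    using J_facts by (auto simp: J_def)
  show "finite (Sigma {\<mu>. size \<mu> \<le> card S \<and> (\<forall>k\<in>#\<mu>. 1 \<le> k) \<and> e \<le> qm \<mu>} (\<lambda>\<mu>. Pow (pos \<mu>)))"
    using assms by (intro finite_SigmaI finite_qm_ge) auto
qed

lemma H_has_sum: "((\<lambda>i. cj m i * \<kappa> (em (nj i) z)) has_sum H m z) J"
  unfolding H_def
proof (intro has_sum_infsum summable_on_ultrametricI)
  fix e :: real assume e: "e > 0"
  obtain C where C: "C \<ge> 1"
    "\<And>\<mu>. (\<forall>k\<in>#\<mu>. 1 \<le> k) \<Longrightarrow> size \<mu> \<le> card S \<Longrightarrow> absval (em \<mu> z) \<le> C * qm \<mu>"
    using em_bound[of 1 "card S" z] by blast
  have "{i\<in>J. e \<le> absval (cj m i * \<kappa> (em (nj i) z))} \<subseteq> {(\<mu>, X)\<in>J. e / (B * C) \<le> qm \<mu>}"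
  proof clarify
    fix \<mu> X assume J: "(\<mu>, X) \<in> J" and le: "e \<le> absval (cj m (\<mu>, X) * \<kappa> (em (nj (\<mu>, X)) z))"
    note JF = J_facts[OF J]
    have "absval (em (sel \<mu> X) z) \<le> C * qm (sel \<mu> X)"
      using JF by (intro C(2)) (auto simp: size_sel)
    hence "absval (cj m (\<mu>, X)) * absval (em (sel \<mu> X) z) \<le> (B * qm (sel \<mu> (pos \<mu> - X))) * (C * qm (sel \<mu> X))"
      using absval_cj[OF J, of m] B(1) qm_pos[of "sel \<mu> (pos \<mu> - X)"] by (intro mult_mono) auto
    also have "\<dots> = B * C * qm \<mu>"
      unfolding JF(9)[symmetric] by (simp add: mult_ac)
    finally have "e \<le> B * C * qm \<mu>"
      using le by (simp add: nj_def absval_mult absval_kappa)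
    thus "e / (B * C) \<le> qm \<mu>"
      using B(1) C(1) by (simp add: pos_divide_le_eq mult.commute)
  qed
  thus "finite {i\<in>J. e \<le> absval (cj m i * \<kappa> (em (nj i) z))}"
    by (rule finite_subset) (rule finite_J_ge, use e B(1) C(1) in simp)
qed

text \<open>On a fibre the complementary positions have decay \<open>qm \<mu> / qm \<nu>\<close>, so
  the coefficients tend to zero even if infinitely many \<mu> occur.\<close>

lemma fibre_summable: "cj m summable_on {i\<in>J. nj i = \<nu>}"
proof (rule summable_on_ultrametricI)
  fix e :: real assume e: "e > 0"
  have "{i\<in>{i\<in>J. nj i = \<nu>}. e \<le> absval (cj m i)} \<subseteq> {(\<mu>, X)\<in>J. e * qm \<nu> / B \<le> qm \<mu>}"
  proof clarify
    fix \<mu> X assume J: "(\<mu>, X) \<in> J" and le: "e \<le> absval (cj m (\<mu>, X))" and nu: "\<nu> = nj (\<mu>, X)"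
    have "e * qm \<nu> \<le> (B * qm (sel \<mu> (pos \<mu> - X))) * qm \<nu>"
      using le absval_cj[OF J, of m] qm_pos[of \<nu>] by (intro mult_right_mono) auto
    also have "\<dots> = B * qm \<mu>"
      unfolding J_facts(9)[OF J, symmetric] nu nj_def by simp
    finally show "e * qm (nj (\<mu>, X)) / B \<le> qm \<mu>"
      using B(1) by (simp add: nu pos_divide_le_eq mult.commute)
  qed
  thus "finite {i\<in>{i\<in>J. nj i = \<nu>}. e \<le> absval (cj m i)}"
    by (rule finite_subset) (rule finite_J_ge, use e B(1) qm_pos[of \<nu>] in simp)
qed

lemma mrep_H: "mrep (H m) (\<Lambda> m)"
  unfolding \<Lambda>_def
proof (rule mrep_family[where L = "card S" and K = 1 and B = B])
  fix i assume "i \<in> J"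
  then obtain \<mu> X where i: "i = (\<mu>, X)" and J: "(\<mu>, X) \<in> J"
    by (cases i) auto
  note JF = J_facts[OF J]
  show "size (nj i) \<le> card S \<and> (\<forall>k\<in>#nj i. 1 \<le> k)"
    using JF by (auto simp: i nj_def size_sel)
  have "qm (sel \<mu> (pos \<mu> - X)) \<le> 1"
    using JF(8) by (intro qm_le_1) force
  hence "B * qm (sel \<mu> (pos \<mu> - X)) \<le> B * 1"
    using B(1) by (intro mult_left_mono) auto
  thus "absval (cj m i) \<le> B"
    unfolding i using absval_cj[OF J, of m] by simp
qed (use B(1) H_has_sum fibre_summable in auto)

lemma tame_H: "H m \<in> tame"
  unfolding tame_iff_mrep using mrep_H by blast

lemma F_wt_less_1: "F \<mu> \<noteq> 0 \<Longrightarrow> wt q \<mu> < 1"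
  using wt_tail_less[OF q_ge_2, of \<mu> 0] F_supp[of \<mu>] by force

text \<open>This is the coefficient of y^m in \<open>partial_fractions\<close>, summed over all
  monomials with the weights \<open>F\<close>.\<close>

lemma H_conv_Psi:
  assumes z: "z \<notin> range (A_emb \<iota>)"
  shows   "H m z = \<kappa> (E 0 z) * Psi m z + (\<Sum>j=0..m. \<kappa> (fps_nth (eps 0) j) * Psi (m - j) z)"
proof -
  have "((\<lambda>\<mu>. \<Sum>X\<in>Pow (pos \<mu>). cj m (\<mu>, X) * \<kappa> (em (nj (\<mu>, X)) z)) has_sum H m z) {\<mu>. F \<mu> \<noteq> 0}"
    using H_has_sum[of m z] unfolding J_def
    by (rule has_sum_SigmaD) (intro has_sum_finite, simp)
  moreover have "((\<lambda>\<mu>. F \<mu> * \<kappa> (E 0 z * fps_nth (Qf \<mu> z) m + (\<Sum>j=0..m. fps_nth (eps 0) j * fps_nth (Qf \<mu> z) (m - j))))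
      has_sum (\<kappa> (E 0 z) * Psi m z + (\<Sum>j=0..m. \<kappa> (fps_nth (eps 0) j) * Psi (m - j) z))) {\<mu>. F \<mu> \<noteq> 0}"
  proof -
    have "((\<lambda>\<mu>. \<kappa> (E 0 z) * (F \<mu> * \<kappa> (fps_nth (Qf \<mu> z) m))
          + (\<Sum>j=0..m. \<kappa> (fps_nth (eps 0) j) * (F \<mu> * \<kappa> (fps_nth (Qf \<mu> z) (m - j)))))
      has_sum (\<kappa> (E 0 z) * Psi m z + (\<Sum>j=0..m. \<kappa> (fps_nth (eps 0) j) * Psi (m - j) z))) UNIV"
      by (intro has_sum_add has_sum_finite_sum has_sum_cmult_right Qf_sum)
    thus ?thesis
      by (rule iffD1[OF has_sum_cong_neutral, rotated -1])
         (auto simp: kap.emb_add kap.emb_mult kap.emb_sum algebra_simps sum_distrib_left)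
  qed
  moreover have "(\<Sum>X\<in>Pow (pos \<mu>). cj m (\<mu>, X) * \<kappa> (em (nj (\<mu>, X)) z))
      = F \<mu> * \<kappa> (E 0 z * fps_nth (Qf \<mu> z) m + (\<Sum>j=0..m. fps_nth (eps 0) j * fps_nth (Qf \<mu> z) (m - j)))"
    if "F \<mu> \<noteq> 0" for \<mu>
  proof -
    have "(\<Sum>X\<in>Pow (pos \<mu>). fps_const (em (sel \<mu> X) z) * xe (sel \<mu> (pos \<mu> - X)))
        = (\<Prod>k\<in>#\<mu>. fps_const (E k z) + eps k)"
      unfolding prod_mset_add_pos by (simp add: fps_const_prod_mset em_def xe_def)
    also have "\<dots> = (fps_const (E 0 z) + eps 0) * Qf \<mu> z"
      using F_supp[OF that] F_wt_less_1[OF that] z by (intro partial_fractions) auto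
    finally have "fps_nth (\<Sum>X\<in>Pow (pos \<mu>). fps_const (em (sel \<mu> X) z) * xe (sel \<mu> (pos \<mu> - X))) m
       = fps_nth ((fps_const (E 0 z) + eps 0) * Qf \<mu> z) m"
      by simp
    hence "(\<Sum>X\<in>Pow (pos \<mu>). em (sel \<mu> X) z * fps_nth (xe (sel \<mu> (pos \<mu> - X))) m)
       = E 0 z * fps_nth (Qf \<mu> z) m + (\<Sum>j=0..m. fps_nth (eps 0) j * fps_nth (Qf \<mu> z) (m - j))"
      by (simp add: fps_sum_nth distrib_right fps_mult_nth[of "eps 0"])
    from this[symmetric] show ?thesis
      by (simp add: kap.emb_sum kap.emb_mult sum_distrib_left cj_def nj_def mult_ac)
  qed
  ultimately show ?thesis
    using has_sum_unique has_sum_cong by (smt (verit, ccfv_SIG) mem_Collect_eq)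
qed

lemma eps_0_nth_0: "fps_nth (eps 0) 0 = 0"
  using q_gt_0 by (intro eps_nth_other) auto

text \<open>As \<open>eps 0\<close> has no constant term, \<open>H_conv_Psi\<close> expresses e_0
  times \<open>Psi m\<close> by \<open>H m\<close> and the earlier functions \<open>Psi\<close>;
  multiplication by u solves for \<open>Psi m\<close>.\<close>

lemma upoly_Psi: "upoly (Psi m)"
proof (induction m rule: less_induct)
  case (less m)
  have "upoly (\<lambda>z. \<kappa> (u_fun \<iota> \<pi> z) * (H m z + (\<Sum>j\<in>{1..m}. - \<kappa> (fps_nth (eps 0) j) * Psi (m - j) z)))"
    by (intro upoly_mult_u upoly_add upoly_sum upoly_cmult upolyI_tame tame_H less) auto
  moreover have "Psi m z = \<kappa> (u_fun \<iota> \<pi> z) * (H m z + (\<Sum>j\<in>{1..m}. - \<kappa> (fps_nth (eps 0) j) * Psi (m - j) z))"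
    if z: "z \<notin> range (A_emb \<iota>)" for z
  proof -
    have "(\<Sum>j=0..m. \<kappa> (fps_nth (eps 0) j) * Psi (m - j) z) = (\<Sum>j\<in>{1..m}. \<kappa> (fps_nth (eps 0) j) * Psi (m - j) z)"
      by (rule sum.mono_neutral_right) (auto simp: eps_0_nth_0 not_less_eq_eq)
    hence "H m z + (\<Sum>j\<in>{1..m}. - \<kappa> (fps_nth (eps 0) j) * Psi (m - j) z) = \<kappa> (E 0 z) * Psi m z"
      by (simp add: H_conv_Psi[OF z] sum_negf)
    moreover have "\<kappa> (u_fun \<iota> \<pi> z) * \<kappa> (E 0 z) = 1"
      using z by (simp add: u_fun_conv E_0_eq_0_iff flip: kap.emb_mult)
    ultimately show ?thesis
      by (simp add: mult.assoc[symmetric])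
  qed
  ultimately show ?case
    by (rule upoly_cong[rotated])
qed

lemma upoly_psi: "upoly (psi \<iota> \<kappa> t S (1 + m))"
proof -
  define c where "c = (- 1) ^ m * Om * \<kappa> (inverse \<pi>) ^ Suc m"
  have "c \<noteq> 0"
    using Om_nz by (simp add: c_def)
  hence "psi \<iota> \<kappa> t S (1 + m) z = inverse c * Psi m z" for z
    unfolding Psi_psi c_def[symmetric] by simp
  hence "psi \<iota> \<kappa> t S (1 + m) = (\<lambda>z. inverse c * Psi m z)"
    by blast
  thus ?thesis
    using upoly_cmult[OF upoly_Psi] by simp
qed

subsection \<open>Growth of the series\<close>

lemma absval_pi_ge_1: "1 \<le> absval \<pi>"
proof (rule ccontr)
  assume "\<not> ?thesis"
  hence "absval \<pi> ^ (q - 1) \<le> 1"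
    by (intro power_le_one) auto
  moreover have "1 < real q ^ q"
    using real_q_gt_1 q_gt_0 by (intro one_less_power) auto
  ultimately show False
    using absval_pi by simp
qed

lemma absval_Psi_zt: "absval (Psi m (zt r)) \<le> absval Om * inverse (real q ^ r)"
proof -
  have "absval ((- 1) ^ m * Psi m (zt r)) \<le> absval Om * inverse (real q ^ r)"
  proof (rule has_sum_absval_le[OF Psi_has_sum])
    fix a
    define y where "y = absval (\<pi> * (zt r - A_emb \<iota> a))"
    have "real q ^ r \<le> absval (zt r)"
      using absval_eta real_q_pos by (simp add: absval_zt)
    also have "\<dots> \<le> absval (zt r - A_emb \<iota> a)"
      by (rule absval_zt_minus_A)
    also have "1 * \<dots> \<le> y"
      unfolding y_def absval_mult using absval_pi_ge_1 by (intro mult_right_mono) auto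
    finally have y: "real q ^ r \<le> y"
      by simp
    have qr: "1 \<le> real q ^ r"
      using real_q_gt_1 by simp
    have "inverse y ^ Suc m \<le> inverse y ^ 1"
      using y qr by (intro power_decreasing) (auto simp: inverse_le_1_iff)
    also have "\<dots> \<le> inverse (real q ^ r)"
      using le_imp_inverse_le[OF y] real_q_pos by simp
    finally have "absval Om * inverse y ^ Suc m \<le> absval Om * inverse (real q ^ r)"
      by (intro mult_left_mono) auto
    thus "absval (Om * Apr a * \<kappa> (inverse (\<pi> * (zt r - A_emb \<iota> a)) ^ Suc m)) \<le> absval Om * inverse (real q ^ r)"
      using absval_Psi_term[of a "zt r" m] unfolding y_def by linarith
  qed auto
  thus ?thesis
    by (simp add: absval_mult absval_power)
qed

text \<open>At the test points every \<open>Psi j\<close> tends to zero, while \<open>H m\<close>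
  stays above a positive constant because w >= 0. So e_0 times \<open>Psi m\<close> has the size of
  \<open>H m\<close>, and e_0 has growth exponent 1.\<close>

lemma grow_psi:
  assumes "grow (H m) w" "0 \<le> w"
  shows   "grow (psi \<iota> \<kappa> t S (1 + m)) (w - 1)"
proof -
  obtain c where c: "c > 0" "eventually (\<lambda>r. absval (H m (zt r)) = c * Q r powr w) sequentially"
    using assms(1) by (auto simp: grow_def)
  define d where "d = (- 1) ^ m * Om * \<kappa> (inverse \<pi>) ^ Suc m"
  have d: "d \<noteq> 0"
    using Om_nz by (simp add: d_def)
  have "eventually (\<lambda>r. absval Om * inverse (real q ^ r) < c) sequentially"
    using inverse_q_power_tendsto c(1) by (rule order_tendstoD)
  with c(2) have "eventually (\<lambda>r. absval (psi \<iota> \<kappa> t S (1 + m) (zt r)) = c / absval d * Q r powr (w - 1)) sequentially"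
  proof eventually_elim
    case (elim r)
    let ?s = "\<Sum>j=0..m. \<kappa> (fps_nth (eps 0) j) * Psi (m - j) (zt r)"
    have "absval ?s \<le> absval Om * inverse (real q ^ r)"
    proof (rule absval_sum_le)
      fix j
      have "absval (fps_nth (eps 0) j) * absval (Psi (m - j) (zt r)) \<le> 1 * (absval Om * inverse (real q ^ r))"
        using absval_eps_nth[of 0 j] absval_Psi_zt by (intro mult_mono) auto
      thus "absval (\<kappa> (fps_nth (eps 0) j) * Psi (m - j) (zt r)) \<le> absval Om * inverse (real q ^ r)"
        by (simp add: absval_mult absval_kappa)
    qed auto
    also have "\<dots> < c * 1"
      using elim by simp
    also have "\<dots> \<le> c * Q r powr w"
      using c(1) assms(2) Q_gt_1[of r] by (intro mult_left_mono ge_one_powr_ge_zero) auto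
    also have "\<dots> = absval (H m (zt r))"
      using elim by simp
    finally have "absval (H m (zt r) - \<kappa> (E 0 (zt r)) * Psi m (zt r)) < absval (H m (zt r))"
      using H_conv_Psi[OF zt_notin_A, of m r] by simp
    hence "absval (\<kappa> (E 0 (zt r)) * Psi m (zt r)) = c * Q r powr w"
      using absval_eq_of_diff_less elim by metis
    hence "Q r * absval (Psi m (zt r)) = c * Q r powr w"
      by (simp add: absval_mult absval_kappa E_0_zt)
    hence "absval (Psi m (zt r)) = c * Q r powr w / Q r"
      using Q_pos[of r] by (simp add: field_simps)
    also have "\<dots> = c * Q r powr (w - 1)"
      using Q_pos[of r] by (simp add: powr_diff)
    finally show ?case
      unfolding Psi_psi d_def[symmetric] using d by (simp add: absval_mult field_simps)
  qed
  moreover have "c / absval d > 0"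
    using c(1) d by simp
  ultimately show ?thesis
    unfolding grow_def by blast
qed

subsection \<open>The leading coefficient\<close>

lemma \<Lambda>_supp:
  assumes "\<Lambda> m \<nu> \<noteq> 0"
  shows   "base_reduced q \<nu>" "\<forall>k\<in>#\<nu>. 1 \<le> k" "size \<nu> + digit_sum q (real m) \<le> card S"
proof -
  have "\<exists>i\<in>{i\<in>J. nj i = \<nu>}. cj m i \<noteq> 0"
  proof (rule ccontr)
    assume "\<not> ?thesis"
    hence "\<Lambda> m \<nu> = 0"
      unfolding \<Lambda>_def by (intro infsum_0) blast
    thus False
      using assms by contradiction
  qed
  then obtain \<mu> X where i: "(\<mu>, X) \<in> J" "nj (\<mu>, X) = \<nu>" "cj m (\<mu>, X) \<noteq> 0"
    by auto
  note JF = J_facts[OF i(1)]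
  have nu: "\<nu> = sel \<mu> X"
    using i(2) by (simp add: nj_def)
  have "\<nu> \<subseteq># \<mu>"
    unfolding nu by (rule sel_subset[OF JF(2)])
  thus "base_reduced q \<nu>"
    using JF(4) base_reduced_subset by blast
  show "\<forall>k\<in>#\<nu>. 1 \<le> k"
    unfolding nu by (rule JF(7))
  have "digit_sum q (real m) \<le> size (sel \<mu> (pos \<mu> - X))"
    using i(3) by (intro xe_nth_nz) (auto simp: cj_def)
  moreover have "size \<nu> + size (sel \<mu> (pos \<mu> - X)) = size \<mu>"
    using arg_cong[OF sel_split[OF JF(2)], of size] by (simp add: nu)
  ultimately show "size \<nu> + digit_sum q (real m) \<le> card S"
    using JF(5) by simp
qed

text \<open>The contribution of the monomial \<mu> to the coefficient
  \<open>\<Lambda> m \<nu>\<close>, up to the factor \<open>F \<mu>\<close>.\<close>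

definition bj :: "nat \<Rightarrow> int multiset \<Rightarrow> int multiset \<Rightarrow> 'c" where
  "bj m \<nu> \<mu> = (\<Sum>X | X \<subseteq> pos \<mu> \<and> sel \<mu> X = \<nu>. fps_nth (xe (sel \<mu> (pos \<mu> - X))) m)"

lemma exists_labelling:
  assumes "size \<mu> = card S" "\<forall>k\<in>#\<mu>. 1 \<le> k"
  shows   "\<exists>k\<in>Kf. ms k = \<mu>"
proof -
  have "\<exists>k. image_mset k (mset_set A) = \<mu>" if "finite A" "size \<mu> = card A" for A :: "nat set" and \<mu> :: "int multiset"
    using that
  proof (induction A arbitrary: \<mu>)
    case (insert x A)
    then obtain y \<mu>' where \<mu>: "\<mu> = add_mset y \<mu>'"
      by (cases \<mu>) auto
    then obtain k where k: "image_mset k (mset_set A) = \<mu>'"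
      using insert by auto
    have "image_mset (k(x := y)) (mset_set A) = image_mset k (mset_set A)"
      using insert.hyps by (intro image_mset_cong) auto
    moreover have "image_mset (k(x := y)) (mset_set (insert x A)) = add_mset y (image_mset (k(x := y)) (mset_set A))"
      using insert.hyps by simp
    ultimately have "image_mset (k(x := y)) (mset_set (insert x A)) = \<mu>"
      by (simp only: \<mu> k)
    thus ?case by blast
  qed auto
  from this[OF finite_S assms(1)] obtain k where k: "image_mset k (mset_set S) = \<mu>"
    by blast
  have eq: "ms (restrict k S) = \<mu>"
    unfolding ms_def k[symmetric] using finite_S by (intro image_mset_cong) auto
  have "k i \<ge> 1" if "i \<in> S" for i
  proof -
    have "k i \<in># \<mu>"
      using that finite_S by (auto simp: k[symmetric])
    thus ?thesis using assms(2) by auto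
  qed
  hence "restrict k S \<in> Kf"
    by auto
  thus ?thesis
    using eq by blast
qed

lemma absval_bj:
  assumes "\<forall>k\<in>#\<mu>. 1 \<le> k"
  shows   "absval (bj m \<nu> \<mu>) * qm \<nu> \<le> qm \<mu>"
proof -
  have "absval (bj m \<nu> \<mu>) \<le> qm \<mu> / qm \<nu>"
    unfolding bj_def
  proof (rule absval_sum_le)
    fix X assume "X \<in> {X. X \<subseteq> pos \<mu> \<and> sel \<mu> X = \<nu>}"
    hence X: "X \<subseteq> pos \<mu>" "sel \<mu> X = \<nu>"
      by auto
    have "\<forall>k\<in>#sel \<mu> (pos \<mu> - X). 0 \<le> k"
      using sel_nonneg[OF assms, of "pos \<mu> - X"] by force
    hence "absval (fps_nth (xe (sel \<mu> (pos \<mu> - X))) m) \<le> qm (sel \<mu> (pos \<mu> - X))"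
      by (rule absval_xe_nth)
    also have "\<dots> = qm \<mu> / qm \<nu>"
    proof -
      have "qm \<nu> * qm (sel \<mu> (pos \<mu> - X)) = qm \<mu>"
        using sel_split[OF X(1)] X(2) by (metis qm_union)
      thus ?thesis
        using qm_pos[of \<nu>] by (simp add: field_simps)
    qed
    finally show "absval (fps_nth (xe (sel \<mu> (pos \<mu> - X))) m) \<le> qm \<mu> / qm \<nu>" .
  qed (use qm_pos in \<open>auto intro: divide_nonneg_pos less_imp_le\<close>)
  thus ?thesis
    using qm_pos[of \<nu>] by (simp add: pos_le_divide_eq)
qed

text \<open>
  In top degree the coefficients are those of the unreduced product, which is a power series in the
  variables: it is enough to find one nonzero coefficient.
\<close>

lemma \<Lambda>_nonzero:
  assumes size: "size \<nu> + digit_sum q (real m) = card S"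
    and \<mu>0: "base_reduced q \<mu>0" "size \<mu>0 = card S" "\<forall>k\<in>#\<mu>0. 1 \<le> k" "bj m \<nu> \<mu>0 \<noteq> 0"
  shows "\<Lambda> m \<nu> \<noteq> 0"
proof -
  define M where "M = {\<mu>. base_reduced q \<mu> \<and> size \<mu> = card S \<and> (\<forall>k\<in>#\<mu>. 1 \<le> k)}"
  define Sx where "Sx = (\<lambda>\<mu>. {X. X \<subseteq> pos \<mu> \<and> sel \<mu> X = \<nu>})"
  have finSx: "finite (Sx \<mu>)" for \<mu>
    unfolding Sx_def by (rule finite_subset[of _ "Pow (pos \<mu>)"]) auto
  have fib: "{i\<in>J. nj i = \<nu>} = Sigma {\<mu>. F \<mu> \<noteq> 0} Sx"
    by (auto simp: J_def nj_def Sx_def)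
  have "(cj m has_sum \<Lambda> m \<nu>) (Sigma {\<mu>. F \<mu> \<noteq> 0} Sx)"
    using has_sum_infsum[OF fibre_summable[of m \<nu>]] unfolding \<Lambda>_def fib .
  hence "((\<lambda>\<mu>. \<Sum>X\<in>Sx \<mu>. cj m (\<mu>, X)) has_sum \<Lambda> m \<nu>) {\<mu>. F \<mu> \<noteq> 0}"
    by (rule has_sum_SigmaD) (intro has_sum_finite finSx)
  also have "(\<lambda>\<mu>. \<Sum>X\<in>Sx \<mu>. cj m (\<mu>, X)) = (\<lambda>\<mu>. F \<mu> * \<kappa> (bj m \<nu> \<mu>))"
    by (simp add: fun_eq_iff cj_def bj_def Sx_def kap.emb_sum sum_distrib_left)
  finally have 1: "((\<lambda>\<mu>. F \<mu> * \<kappa> (bj m \<nu> \<mu>)) has_sum \<Lambda> m \<nu>) {\<mu>. F \<mu> \<noteq> 0}" .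
  \<comment> \<open>Producing y^m takes at least l_q(m) positions besides those of \<nu>, so only
    monomials of the top degree reach \<nu>; there \<open>F\<close> equals
    \<open>Gc\<close>.\<close>
  have zero: "bj m \<nu> \<mu> = 0" if "F \<mu> \<noteq> 0" "\<mu> \<notin> M" for \<mu>
  proof (rule ccontr)
    assume "bj m \<nu> \<mu> \<noteq> 0"
    hence "(\<Sum>X\<in>Sx \<mu>. fps_nth (xe (sel \<mu> (pos \<mu> - X))) m) \<noteq> 0"
      by (simp add: bj_def Sx_def)
    then obtain X where X: "X \<in> Sx \<mu>" "fps_nth (xe (sel \<mu> (pos \<mu> - X))) m \<noteq> 0"
      by (rule sum.not_neutral_contains_not_neutral)
    have "digit_sum q (real m) \<le> size (sel \<mu> (pos \<mu> - X))"
      using X(2) by (rule xe_nth_nz)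
    moreover have "size \<nu> + size (sel \<mu> (pos \<mu> - X)) = size \<mu>"
      using arg_cong[OF sel_split[of X \<mu>], of size] X(1) by (simp add: Sx_def)
    ultimately have "card S \<le> size \<mu>"
      using size by simp
    thus False
      using F_supp[OF that(1)] that(2) by (auto simp: M_def)
  qed
  have 2: "((\<lambda>\<mu>. Gc \<mu> * \<kappa> (bj m \<nu> \<mu>)) has_sum \<Lambda> m \<nu>) M"
    using 1 by (rule iffD1[OF has_sum_cong_neutral, rotated -1]) (auto simp: zero M_def F_top dest: F_supp)
  define fibk where "fibk = (\<lambda>\<mu>. {k\<in>Kf. ms k = \<mu>})"
  have finfib: "finite (fibk \<mu>)" for \<mu>
    unfolding fibk_def by (rule finite_ms_fibre)
  define K where "K = {k\<in>Kf. ms k \<in> M}"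
  have fin: "finite {k\<in>K. e \<le> absval (bj m \<nu> (ms k))}" if e: "e > 0" for e
  proof (rule finite_subset)
    let ?A = "{\<mu>. size \<mu> \<le> card S \<and> (\<forall>k\<in>#\<mu>. 1 \<le> k) \<and> e * qm \<nu> \<le> qm \<mu>}"
    show "{k\<in>K. e \<le> absval (bj m \<nu> (ms k))} \<subseteq> (\<Union>\<mu>\<in>?A. fibk \<mu>)"
    proof
      fix k assume k: "k \<in> {k\<in>K. e \<le> absval (bj m \<nu> (ms k))}"
      hence kM: "ms k \<in> M" "k \<in> Kf"
        by (auto simp: K_def)
      have "e * qm \<nu> \<le> absval (bj m \<nu> (ms k)) * qm \<nu>"
        using k qm_pos[of \<nu>] by (intro mult_right_mono) auto
      also have "\<dots> \<le> qm (ms k)"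
        using kM by (intro absval_bj) (auto simp: M_def)
      finally show "k \<in> (\<Union>\<mu>\<in>?A. fibk \<mu>)"
        using kM by (auto simp: M_def fibk_def)
    qed
    show "finite (\<Union>\<mu>\<in>?A. fibk \<mu>)"
      using e qm_pos[of \<nu>] by (intro finite_UN_I finite_qm_ge finfib) auto
  qed
  \<comment> \<open>The sum over multisets is unfolded into one over labellings, where each monomial
    in the t_i occurs once.\<close>
  have bij: "bij_betw snd (Sigma M fibk) K"
    by (auto simp: bij_betw_def inj_on_def fibk_def K_def image_iff)
  have "(\<lambda>k. \<kappa> (bj m \<nu> (ms k)) * tk k) summable_on K"
    by (rule summable_on_ultrametricI) (simp add: absval_mult absval_kappa absval_tk fin)
  then obtain L where L: "((\<lambda>k. \<kappa> (bj m \<nu> (ms k)) * tk k) has_sum L) K"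
    by (auto simp: summable_on_def)
  hence "((\<lambda>x. \<kappa> (bj m \<nu> (ms (snd x))) * tk (snd x)) has_sum L) (Sigma M fibk)"
    using has_sum_reindex_bij_betw[OF bij, of "\<lambda>k. \<kappa> (bj m \<nu> (ms k)) * tk k" L] by simp
  hence "((\<lambda>\<mu>. \<Sum>k\<in>fibk \<mu>. \<kappa> (bj m \<nu> (ms k)) * tk k) has_sum L) M"
  proof (rule has_sum_SigmaD)
    fix \<mu>
    show "((\<lambda>k. \<kappa> (bj m \<nu> (ms (snd (\<mu>, k)))) * tk (snd (\<mu>, k))) has_sum (\<Sum>k\<in>fibk \<mu>. \<kappa> (bj m \<nu> (ms k)) * tk k)) (fibk \<mu>)"
      unfolding snd_conv by (rule has_sum_finite[OF finfib])
  qed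
  also have "(\<lambda>\<mu>. \<Sum>k\<in>fibk \<mu>. \<kappa> (bj m \<nu> (ms k)) * tk k) = (\<lambda>\<mu>. Gc \<mu> * \<kappa> (bj m \<nu> \<mu>))"
    by (auto simp: fun_eq_iff Gc_def fibk_def sum_distrib_left sum_distrib_right mult.commute intro!: sum.cong)
  finally have "L = \<Lambda> m \<nu>"
    using 2 has_sum_unique by blast
  obtain k0 where k0: "k0 \<in> Kf" "ms k0 = \<mu>0"
    using exists_labelling[OF \<mu>0(2,3)] by blast
  have "L \<noteq> 0"
  proof (rule power_series_nonzero[OF _ L fin])
    show "K \<subseteq> Kf"
      by (auto simp: K_def)
    show "k0 \<in> K"
      using k0 \<mu>0 by (simp add: K_def M_def)
    show "bj m \<nu> (ms k0) \<noteq> 0"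
      using k0 \<mu>0 by simp
  qed
  thus ?thesis
    by (simp add: \<open>L = \<Lambda> m \<nu>\<close>)
qed

text \<open>All entries of \<nu> lie below those of \<beta>. So a position set that yields \<nu>
  contains only positions of small entries, and by counting it contains all of them.\<close>

lemma bj_separated:
  assumes "\<forall>k\<in>#\<nu>. k \<le> K" "\<forall>k\<in>#\<beta>. K < k"
  shows   "bj m \<nu> (\<nu> + \<beta>) = fps_nth (xe \<beta>) m"
proof -
  let ?\<mu> = "\<nu> + \<beta>"
  define X0 where "X0 = {p\<in>pos ?\<mu>. sorted_list_of_multiset ?\<mu> ! p \<le> K}"
  have X0: "X0 \<subseteq> pos ?\<mu>" "finite X0"
    by (auto simp: X0_def)
  have f\<nu>: "filter_mset (\<lambda>k. k \<le> K) \<nu> = \<nu>"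
    using assms(1) by (simp add: filter_mset_eq_conv)
  have f\<beta>: "filter_mset (\<lambda>k. k \<le> K) \<beta> = {#}"
    by (rule multiset_eqI) (use assms(2) in \<open>force simp: count_eq_zero_iff\<close>)
  have sel0: "sel ?\<mu> X0 = \<nu>"
    unfolding X0_def by (simp only: sel_filter[of _ "\<lambda>k. k \<le> K"] filter_union_mset f\<nu> f\<beta>) simp
  have compl: "sel ?\<mu> (pos ?\<mu> - X0) = \<beta>"
    using sel_split[OF X0(1)] unfolding sel0 by simp
  have "X = X0" if X: "X \<subseteq> pos ?\<mu>" "sel ?\<mu> X = \<nu>" for X
  proof (rule card_subset_eq[OF X0(2)])
    have finX: "finite X"
      using X(1) finite_subset by blast
    show "X \<subseteq> X0"
    proof
      fix p assume p: "p \<in> X"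
      hence "sorted_list_of_multiset ?\<mu> ! p \<in># sel ?\<mu> X"
        using finX by (auto simp: sel_def)
      thus "p \<in> X0"
        using X p assms(1) by (auto simp: X0_def)
    qed
    show "card X = card X0"
      using X(2) sel0 size_sel[OF finX] size_sel[OF X0(2)] by metis
  qed
  note uniq = this
  have "X \<in> {X. X \<subseteq> pos ?\<mu> \<and> sel ?\<mu> X = \<nu>} \<longleftrightarrow> X \<in> {X0}" for X
    using uniq[of X] X0(1) sel0 by blast
  hence "{X. X \<subseteq> pos ?\<mu> \<and> sel ?\<mu> X = \<nu>} = {X0}"
    by (rule set_eqI)
  hence "bj m \<nu> ?\<mu> = fps_nth (xe (sel ?\<mu> (pos ?\<mu> - X0))) m"
    by (simp add: bj_def del: size_union)
  thus ?thesis
    by (simp only: compl)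
qed

lemma grow_H:
  assumes "card S = (m - 1) * (q - 1) + l" "1 \<le> m" "1 \<le> l" "l \<le> q - 1" "digit_sum q (real n) \<le> l"
  defines "l' \<equiv> l - digit_sum q (real n)"
  shows "grow (H n) (1 - real q powi (1 - int m) + real l' * real q powi (- int m))"
proof -
  define r where "r = digit_sum q (real n)"
  define \<nu> where "\<nu> = nustar q m l'"
  have l'q: "l' < q"
    using assms(4) q_gt_0 by (simp add: l'_def)
  have size: "size \<nu> + r = card S"
    using assms by (simp add: \<nu>_def size_nustar[OF q_ge_2] r_def l'_def)
  have \<nu>_in: "1 \<le> k \<and> k \<le> int m" if "k \<in># \<nu>" for k
    using that in_nustar[OF q_ge_2 assms(2)] by (simp add: \<nu>_def)
  have \<nu>_red: "base_reduced q \<nu>"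
    unfolding \<nu>_def by (rule reduced_nustar[OF q_ge_2 assms(2) l'q])
  obtain \<beta> where \<beta>: "size \<beta> = r" "\<forall>k\<in>#\<beta>. int m < k" "fps_nth (xe \<beta>) n \<noteq> 0"
    using exists_xe_nth_nz[of n r "int m"] by (auto simp: r_def)
  \<comment> \<open>The two parts have no index in common, and \<beta> has at most l <= q - 1
    entries.\<close>
  have "base_reduced q (\<nu> + \<beta>)"
    unfolding base_reduced_def
  proof
    fix k
    show "count (\<nu> + \<beta>) k < q"
    proof (cases "k \<le> int m")
      case True
      hence "count \<beta> k = 0"
        using \<beta>(2) by (force simp: count_eq_zero_iff)
      thus ?thesis
        using \<nu>_red by (simp add: base_reduced_def)
    next
      case False
      hence "count \<nu> k = 0"
        using \<nu>_in by (force simp: count_eq_zero_iff)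
      moreover have "count \<beta> k \<le> size \<beta>"
        by (rule count_le_size)
      ultimately show ?thesis
        using \<beta>(1) assms(4,5) q_gt_0 by (simp add: r_def)
    qed
  qed
  moreover have "size (\<nu> + \<beta>) = card S"
    using size \<beta>(1) by simp
  moreover have "\<forall>k\<in>#\<nu> + \<beta>. 1 \<le> k"
    using \<nu>_in \<beta>(2) assms(2) by force
  moreover have "bj n \<nu> (\<nu> + \<beta>) \<noteq> 0"
    using bj_separated[of \<nu> "int m" \<beta> n] \<nu>_in \<beta> by simp
  ultimately have nz: "\<Lambda> n \<nu> \<noteq> 0"
    using size by (intro \<Lambda>_nonzero[of _ _ "\<nu> + \<beta>"]) (auto simp: r_def)
  have max: "wt q \<mu> \<le> wt q \<nu>" if "\<Lambda> n \<mu> \<noteq> 0" for \<mu>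
    unfolding \<nu>_def
  proof (rule wt_le_nustar[OF q_ge_2])
    show "base_reduced q \<mu>" "\<And>k. k \<in># \<mu> \<Longrightarrow> 1 \<le> k"
      using \<Lambda>_supp[OF that] by auto
    show "size \<mu> \<le> size (nustar q m l')"
      using \<Lambda>_supp(3)[OF that] size by (simp add: \<nu>_def r_def)
  qed (rule assms(2))
  have "grow (H n) (wt q \<nu>)"
    by (rule mrep_grow[OF mrep_H \<Lambda>_supp(1) nz max])
  thus ?thesis
    by (simp add: \<nu>_def wt_nustar[OF q_ge_2 assms(2)])
qed

end

theorem theorem6p15:
  fixes \<iota> :: "'f::{finite,field} fls \<Rightarrow> 'c::complete_ultrametric_field"
    and \<kappa> :: "'c \<Rightarrow> 'k::complete_ultrametric_field"
    and \<pi> :: 'c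
    and t :: "nat \<Rightarrow> 'k"
    and S :: "nat set"
    and s m l n :: nat
  assumes "completed_separable_closure \<iota>"
    and "carlitz_period \<iota> \<pi>"
    and "gauss_completion S \<kappa> t"
    and "finite S" and "S \<noteq> {}" and "0 \<notin> S" and "card S = s"
    and "s = (m - 1) * (CARD('f) - 1) + l"
    and "m \<ge> 1" and "1 \<le> l" and "l \<le> CARD('f) - 1"
    and "digit_sum CARD('f) (real n) \<le> l"
  shows "(\<exists>\<xi>\<in>tame_completion \<iota> \<pi> \<kappa>. u_polynomial_represents \<iota> \<pi> \<kappa> (psi \<iota> \<kappa> t S (1 + n)) \<xi>) \<and>
    (\<forall>\<xi>\<in>tame_completion \<iota> \<pi> \<kappa>. u_polynomial_represents \<iota> \<pi> \<kappa> (psi \<iota> \<kappa> t S (1 + n)) \<xi> \<longrightarrow>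
       completion_val \<iota> \<pi> \<kappa> \<xi> =
         ereal (real CARD('f) powi (1 - int m)
           - (real l - real (digit_sum CARD('f) (real n))) * real CARD('f) powi (- int m)))"
proof -
  define q where "q = CARD('f)"
  interpret carlitz_vars \<iota> \<pi> q \<kappa> t S
    by unfold_locales (use assms in \<open>auto simp: q_def\<close>)
  obtain F B where FB: "B \<ge> 1" "\<forall>\<mu>. absval (F \<mu>) \<le> B"
    "\<forall>\<mu>. F \<mu> \<noteq> 0 \<longrightarrow> base_reduced q \<mu> \<and> size \<mu> \<le> card S \<and> (\<forall>k\<in>#\<mu>. 1 \<le> k)"
    "\<forall>\<mu>. base_reduced q \<mu> \<longrightarrow> size \<mu> = card S \<longrightarrow> (\<forall>k\<in>#\<mu>. 1 \<le> k) \<longrightarrow> F \<mu> = Gc \<mu>"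
    "\<forall>a. ((\<lambda>\<mu>. F \<mu> * \<kappa> (em \<mu> (A_emb \<iota> a))) has_sum (Om * (\<Prod>i\<in>S. A_at \<iota> \<kappa> (t i) a))) UNIV"
    using exists_interpolation by blast
  interpret carlitz_interpolation \<iota> \<pi> q \<kappa> t S F B
    by unfold_locales (use FB in blast)+
  let ?d = "digit_sum q (real n)" and ?w = "1 - real q powi (1 - int m) + real (l - digit_sum q (real n)) * real q powi (- int m)"
  have "grow (H n) ?w"
    using assms by (intro grow_H) (simp_all add: q_def)
  \<comment> \<open>A nonnegative exponent is what keeps \<open>H n\<close> away from zero in
    \<open>grow_psi\<close>.\<close>
  moreover have "0 \<le> ?w"
  proof -
    have "real q powi (1 - int m) \<le> real q powi 0"
      using assms(9) real_q_gt_1 by (intro power_int_increasing) auto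
    moreover have "0 \<le> real (l - ?d) * real q powi (- int m)"
      using q_powi_pos[of "- int m"] by (intro mult_nonneg_nonneg) auto
    ultimately show ?thesis by simp
  qed
  ultimately have grow: "grow (psi \<iota> \<kappa> t S (1 + n)) (?w - 1)"
    by (rule grow_psi)
  \<comment> \<open>The valuation is minus the growth exponent of \<open>psi\<close>, hence 1 -
    \<open>?w\<close>.\<close>
  have val: "completion_val \<iota> \<pi> \<kappa> \<xi> = ereal (real q powi (1 - int m) - (real l - real ?d) * real q powi (- int m))"
    if "u_polynomial_represents \<iota> \<pi> \<kappa> (psi \<iota> \<kappa> t S (1 + n)) \<xi>" for \<xi>
    using completion_val_represents[OF that grow] assms(12) by (simp add: q_def of_nat_diff)
  have ex: "\<exists>\<xi>\<in>tame_completion \<iota> \<pi> \<kappa>. u_polynomial_represents \<iota> \<pi> \<kappa> (psi \<iota> \<kappa> t S (1 + n)) \<xi>"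
  proof -
    obtain N g where "\<forall>i. g i \<in> tame" "\<forall>z. z \<notin> range (A_emb \<iota>) \<longrightarrow>
        psi \<iota> \<kappa> t S (1 + n) z = (\<Sum>i\<le>N. g i z * \<kappa> (u_fun \<iota> \<pi> z) ^ i)"
      using upoly_psi[of n] unfolding upoly_def by blast
    thus ?thesis
      by (intro u_polynomial_represents_ex[of N g]) auto
  qed
  show ?thesis
    unfolding q_def[symmetric] using val ex by blast
qed

end
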